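(* Let $n\ge 1$, $m\ge 1$, $0=t_0<t_1<\dots<t_m$, and let $\mathbb{P}_n=\mathbb{P}_n(t_1,\dots,t_m;a^{(0)}_1,\dots,a^{(m)}_{2r_m})$ be the joint probability for the stationary Dyson Brownian motion of $n$ particles defined in the context, regarded as a function of $t_1,\dots,t_m$ and of the finite endpoints $a^{(l)}_i$ of the sets $U^{(l)}$, $0\le l\le m$. Define the differential operators $$\mathcal{A}_1=\sum_{l=0}^m e^{-t_l}D^{l,1},\qquad \mathcal{B}_1=\sum_{l=0}^m e^{t_l-t_m}D^{l,1},$$ $$\mathcal{A}_2=\sum_{l=0}^m e^{-2t_l}D^{l,2}+\sum_{l=1}^m(1-e^{-2t_l})\frac{\partial}{\partial t_l}-e^{-2t_m},$$ $$\mathcal{B}_2=\sum_{l=0}^m e^{2(t_l-t_m)}D^{l,2}+\sum_{l=1}^m\left(e^{2(t_l-t_m)}-e^{-2t_m}\right)\frac{\partial}{\partial t_l}-e^{-2t_m}.$$ Then $\log\mathbb{P}_n$ satisfies the third order non-linear PDE $$\mathcal{A}_1\,\frac{\mathcal{B}_2\mathcal{A}_1\log\mathbb{P}_n}{\mathcal{B}_1\mathcal{A}_1\log\mathbb{P}_n+2n e^{-t_m}}=\mathcal{B}_1\,\frac{\mathcal{A}_2\mathcal{B}_1\log\mathbb{P}_n}{\mathcal{A}_1\mathcal{B}_1\log\mathbb{P}_n+2n e^{-t_m}}.$$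
   Context: Put $s_1=t_1$, $s_i=t_i-t_{i-1}$ for $2\le i\le m$, and $c_i=e^{-s_i}$. For $\lambda=(\lambda_1,\dots,\lambda_n)$ let $V(\lambda)=\prod_{1\le i<j\le n}(\lambda_i-\lambda_j)$. The stationary Dyson Brownian motion is the eigenvalue process of the stationary Ornstein-Uhlenbeck process on $n\times n$ Hermitian matrices with stationary density proportional to $e^{-\mathrm{Tr}B^2}$ and transition density over time $t$ proportional to $e^{-\mathrm{Tr}(B-c\bar B)^2/(1-c^2)}$, $c=e^{-t}$. The (symmetrized) joint density of the eigenvalues $\lambda^{(l)}\in\mathbb{R}^n$ at the times $t_l$, $l=0,\dots,m$, is $$\tilde P=\frac1C V(\lambda^{(0)})V(\lambda^{(m)})\prod_{l=1}^m\det\left(e^{\frac{2c_l}{1-c_l^2}\lambda^{(l-1)}_i\lambda^{(l)}_j}\right)_{1\le i,j\le n}\; e^{-\frac{1}{1-c_1^2}\sum_k(\lambda^{(0)}_k)^2}\prod_{l=1}^{m-1}e^{-\left(\frac1{1-c_l^2}+\frac{c_{l+1}^2}{1-c_{l+1}^2}\right)\sum_k(\lambda^{(l)}_k)^2}\;e^{-\frac1{1-c_m^2}\sum_k(\lambda^{(m)}_k)^2},$$ where $C$ (depending on $n$ and the times) makes the total integral equal to $1$. For $l=0,\dots,m$ let $U^{(l)}=(a^{(l)}_1,a^{(l)}_2)\cup\dots\cup(a^{(l)}_{2r_l-1},a^{(l)}_{2r_l})$ with $-\infty\le a^{(l)}_1<a^{(l)}_2<\dots<a^{(l)}_{2r_l}\le\infty$.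 Define $$\mathbb{P}_n=\int_{(U^{(0)})^n\times\dots\times(U^{(m)})^n}\tilde P\;\prod_{l=0}^m\prod_{k=1}^n d\lambda^{(l)}_k ,$$ i.e. the probability that all $\lambda^{(l)}_k$ lie in $U^{(l)}$ for every $l$. Operators: $D^{l,1}=\sum_{i=1}^{2r_l}\frac{\partial}{\partial a^{(l)}_i}$ and $D^{l,2}=\sum_{i=1}^{2r_l}a^{(l)}_i\frac{\partial}{\partial a^{(l)}_i}$, where the terms corresponding to infinite endpoints ($a^{(l)}_1=-\infty$ or $a^{(l)}_{2r_l}=\infty$) are dropped. Products of operators are compositions (the operators $\partial/\partial t_l$ also differentiate the $t$-dependent coefficients of operators to their right), and scalar terms such as $-e^{-2t_m}$ act by multiplication. *)

theory Defs
  imports "HOL-Analysis.Analysis" "Jordan_Normal_Form.Determinant"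
begin

text \<open>
  A configuration \<open>x\<close> assigns to the pair \<open>(l, k)\<close> with \<open>l \<le> m\<close>, \<open>k < n\<close> the position of
  the \<open>k\<close>-th particle at time \<open>t l\<close>; particles are numbered from 0. Throughout \<open>t 0\<close> is meant to
  be 0, so that \<open>t 1 - t 0\<close> is the first time step.
\<close>

definition dyson_c :: "(nat \<Rightarrow> real) \<Rightarrow> nat \<Rightarrow> real" where
  "dyson_c t l = exp (- (t l - t (l - 1)))"

definition vandermonde :: "nat \<Rightarrow> (nat \<Rightarrow> real) \<Rightarrow> real" where
  "vandermonde n x = (\<Prod>j<n. \<Prod>i<j. x i - x j)"

definition sum_squares :: "nat \<Rightarrow> (nat \<Rightarrow> real) \<Rightarrow> real" where
  "sum_squares n x = (\<Sum>k<n. (x k)\<^sup>2)"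

definition dyson_weight :: "nat \<Rightarrow> nat \<Rightarrow> (nat \<Rightarrow> real) \<Rightarrow> (nat \<times> nat \<Rightarrow> real) \<Rightarrow> real" where
  "dyson_weight n m t x =
     (let c = dyson_c t; y = (\<lambda>l k. x (l, k)) in
        vandermonde n (y 0) * vandermonde n (y m)
      * (\<Prod>l = 1..m. Determinant.det (Matrix.mat n n
           (\<lambda>(i, j). exp (2 * c l / (1 - (c l)\<^sup>2) * y (l - 1) i * y l j))))
      * exp (- (1 / (1 - (c 1)\<^sup>2)) * sum_squares n (y 0))
      * (\<Prod>l = 1..<m. exp (- (1 / (1 - (c l)\<^sup>2) + (c (l + 1))\<^sup>2 / (1 - (c (l + 1))\<^sup>2))
                            * sum_squares n (y l)))
      * exp (- (1 / (1 - (c m)\<^sup>2)) * sum_squares n (y m)))"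

definition config_measure :: "nat \<Rightarrow> nat \<Rightarrow> (nat \<times> nat \<Rightarrow> real) measure" where
  "config_measure n m = Pi\<^sub>M ({..m} \<times> {..<n}) (\<lambda>_. lborel)"

definition dyson_const :: "nat \<Rightarrow> nat \<Rightarrow> (nat \<Rightarrow> real) \<Rightarrow> real" where
  "dyson_const n m t = (\<integral>x. dyson_weight n m t x \<partial>config_measure n m)"

definition dyson_density :: "nat \<Rightarrow> nat \<Rightarrow> (nat \<Rightarrow> real) \<Rightarrow> (nat \<times> nat \<Rightarrow> real) \<Rightarrow> real" where
  "dyson_density n m t x = 1 / dyson_const n m t * dyson_weight n m t x"

text \<open>
  The endpoints at time \<open>t l\<close> are \<open>a l 1, \<dots>, a l (2 * r l)\<close>.
\<close>

definition interval_union :: "(nat \<Rightarrow> nat) \<Rightarrow> (nat \<Rightarrow> nat \<Rightarrow> ereal) \<Rightarrow> nat \<Rightarrow> real set" where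
  "interval_union r a l = (\<Union>i\<in>{1..r l}. einterval (a l (2 * i - 1)) (a l (2 * i)))"

definition dyson_prob ::
    "nat \<Rightarrow> nat \<Rightarrow> (nat \<Rightarrow> nat) \<Rightarrow> (nat \<Rightarrow> real) \<Rightarrow> (nat \<Rightarrow> nat \<Rightarrow> ereal) \<Rightarrow> real" where
  "dyson_prob n m r t a =
     (LINT x : (\<Pi>\<^sub>E p \<in> {..m} \<times> {..<n}. interval_union r a (fst p)) | config_measure n m.
        dyson_density n m t x)"

text \<open>
  The differential operators act on functions of all times and all endpoints. The partial
  derivative with respect to an endpoint is only meaningful where that endpoint is finite.
\<close>

type_synonym dyson_fun = "(nat \<Rightarrow> real) \<Rightarrow> (nat \<Rightarrow> nat \<Rightarrow> ereal) \<Rightarrow> real"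

definition d_time :: "nat \<Rightarrow> dyson_fun \<Rightarrow> dyson_fun" where
  "d_time l F t a = deriv (\<lambda>s. F (t(l := s)) a) (t l)"

definition d_end :: "nat \<Rightarrow> nat \<Rightarrow> dyson_fun \<Rightarrow> dyson_fun" where
  "d_end l i F t a =
     deriv (\<lambda>s. F t (a(l := (a l)(i := ereal s)))) (real_of_ereal (a l i))"

definition D1 :: "(nat \<Rightarrow> nat) \<Rightarrow> nat \<Rightarrow> dyson_fun \<Rightarrow> dyson_fun" where
  "D1 r l F t a = (\<Sum>i | i \<in> {1..2 * r l} \<and> \<bar>a l i\<bar> \<noteq> \<infinity>. d_end l i F t a)"

definition D2 :: "(nat \<Rightarrow> nat) \<Rightarrow> nat \<Rightarrow> dyson_fun \<Rightarrow> dyson_fun" where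
  "D2 r l F t a =
     (\<Sum>i | i \<in> {1..2 * r l} \<and> \<bar>a l i\<bar> \<noteq> \<infinity>. real_of_ereal (a l i) * d_end l i F t a)"

definition A1 :: "nat \<Rightarrow> (nat \<Rightarrow> nat) \<Rightarrow> dyson_fun \<Rightarrow> dyson_fun" where
  "A1 m r F t a = (\<Sum>l\<le>m. exp (- t l) * D1 r l F t a)"

definition B1 :: "nat \<Rightarrow> (nat \<Rightarrow> nat) \<Rightarrow> dyson_fun \<Rightarrow> dyson_fun" where
  "B1 m r F t a = (\<Sum>l\<le>m. exp (t l - t m) * D1 r l F t a)"

definition A2 :: "nat \<Rightarrow> (nat \<Rightarrow> nat) \<Rightarrow> dyson_fun \<Rightarrow> dyson_fun" where
  "A2 m r F t a =
     (\<Sum>l\<le>m. exp (- 2 * t l) * D2 r l F t a)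
   + (\<Sum>l = 1..m. (1 - exp (- 2 * t l)) * d_time l F t a)
   - exp (- 2 * t m) * F t a"

definition B2 :: "nat \<Rightarrow> (nat \<Rightarrow> nat) \<Rightarrow> dyson_fun \<Rightarrow> dyson_fun" where
  "B2 m r F t a =
     (\<Sum>l\<le>m. exp (2 * (t l - t m)) * D2 r l F t a)
   + (\<Sum>l = 1..m. (exp (2 * (t l - t m)) - exp (- 2 * t m)) * d_time l F t a)
   - exp (- 2 * t m) * F t a"

end

theory Submission
  imports Defs "Jordan_Normal_Form.Char_Poly" "HOL-Probability.Distributions" "HOL-Real_Asymp.Real_Asymp"
begin

text \<open>
  The probability is a determinant. The weight of the process at the times \<open>t 0, \<dots>, t m\<close> is a
  product of two Vandermonde determinants, at the first and the last time, and of \<open>m\<close>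
  determinants of exponentials. Integrated over a product set, such a chain collapses by
  Andreief's identity, used once per time level (\<open>andreief_chain\<close>), to a constant times
  \<open>\<tau> n = det (\<mu> i j)\<close>, \<open>i, j < n\<close>, where \<open>\<mu> i j\<close> is the integral of \<open>z 0 ^ i * z m ^ j * exp (- E z)\<close>
  over \<open>U 0 \<times> \<dots> \<times> U m\<close> and \<open>exp (- E)\<close> is the unnormalised density of a single stationary
  Ornstein-Uhlenbeck particle at the given times. The constant is the quotient of \<open>(n!) ^ (m + 1)\<close>
  by the total mass of the weight (\<open>dyson_prob_eq\<close>). It depends on the times alone, so it
  disappears under \<open>A1\<close> and \<open>B1\<close>, which contain no time derivative.

  On a single moment the operators shift an index. Moving all endpoints at time \<open>t l\<close> with speed
  \<open>exp (- t l)\<close> amounts, by the divergence theorem, to moving the integration variables, and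
  along this motion \<open>E\<close> changes only through its term \<open>(z 0)\<^sup>2\<close>. Hence
  \<open>A1 (\<mu> i j) = i * \<mu> (i - 1) j + exp (- t m) * j * \<mu> i (j - 1) - 2 * \<mu> (i + 1) j\<close>. The operator \<open>B1\<close>
  is the time reversal of \<open>A1\<close>, while \<open>A2\<close> and \<open>B2\<close> come from the scaling of Brownian motion and
  raise an index by two (\<open>energy_translation_forward\<close>, \<open>energy_scaling_forward\<close>, their backward
  counterparts, and \<open>has_D_moment\<close>).

  In a determinant the terms that lower an index produce proportional rows or columns and
  vanish. So \<open>A1 (\<tau> n) = - 2 * X n\<close>, where \<open>X n\<close> is \<open>\<tau> n\<close> with its last row index raised by
  one, \<open>B1 (\<tau> n) = - 2 * Y n\<close> with the last column instead, and the remaining derivatives are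
  combinations of minors of the infinite moment matrix. The Desnanot-Jacobi identity relates them: by
  \<open>toda_first\<close> both denominators of the equation equal \<open>4 * \<tau> (n + 1) * \<tau> (n - 1) / (\<tau> n)\<^sup>2\<close>, and by
  \<open>toda_second\<close> the two fractions are \<open>Y (n + 1) / \<tau> (n + 1) - Y (n - 1) / \<tau> (n - 1)\<close> and
  \<open>X (n + 1) / \<tau> (n + 1) - X (n - 1) / \<tau> (n - 1)\<close>. Up to the factor \<open>- 1/2\<close> these are \<open>B1\<close> and \<open>A1\<close> of
  \<open>ln (\<tau> (n + 1) / \<tau> (n - 1))\<close>, and the equation says that \<open>A1\<close> and \<open>B1\<close> commute on this function
  (\<open>nonlinear_pde\<close>).

  The divisions and logarithms make sense because \<open>\<tau> k > 0\<close> for every \<open>k\<close>. By Andreief's identity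
  a positive multiple of \<open>\<tau> k\<close> is the integral of the weight of \<open>k\<close> particles, which is nonnegative
  since the kernel \<open>exp (x * y)\<close> is totally positive (\<open>fdet_exp_sign\<close>), and positive on an open box
  (\<open>fdet_moment_pos\<close>).
\<close>

section \<open>Determinants and the Desnanot-Jacobi identity\<close>

text \<open>
  Determinants of varying size, with entries given by a function on all pairs of indices, so
  that minors of one infinite array differ only by reindexing.
\<close>

definition fdet :: "nat \<Rightarrow> (nat \<Rightarrow> nat \<Rightarrow> 'a :: comm_ring_1) \<Rightarrow> 'a" where
  "fdet n A = Determinant.det (Matrix.mat n n (\<lambda>(i, j). A i j))"

lemma fdet_leibniz:
  "fdet n A = (\<Sum>p | p permutes {..<n}. of_int (sign p) * (\<Prod>i<n. A i (p i)))"
proof -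
  let ?M = "Matrix.mat n n (\<lambda>(i, j). A i j)"
  have eq: "{0..<n} = {..<n}" by auto
  have *: "?M \<in> carrier_mat n n" by simp
  have **: "(\<Prod>i<n. ?M $$ (i, p i)) = (\<Prod>i<n. A i (p i))" if "p permutes {..<n}" for p
    using permutes_in_image[OF that] by (intro prod.cong) auto
  have "fdet n A = (\<Sum>p | p permutes {..<n}. of_int (sign p) * (\<Prod>i<n. ?M $$ (i, p i)))"
    unfolding fdet_def det_def'[OF *] eq ..
  also have "\<dots> = (\<Sum>p | p permutes {..<n}. of_int (sign p) * (\<Prod>i<n. A i (p i)))"
    by (intro sum.cong refl arg_cong2[of _ _ _ _ "(*)"] **) simp
  finally show ?thesis .
qed

lemma fdet_cong:
  assumes "\<And>i j. i < n \<Longrightarrow> j < n \<Longrightarrow> A i j = B i j"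
  shows "fdet n A = fdet n B"
  unfolding fdet_def using assms by (intro arg_cong[of _ _ Determinant.det] eq_matI) auto

lemma fdet_0 [simp]: "fdet 0 A = 1"
  by (simp add: fdet_leibniz)

lemma fdet_transpose: "fdet n (\<lambda>i j. A j i) = fdet n A"
proof -
  have "Matrix.mat n n (\<lambda>(i, j). A j i) = transpose_mat (Matrix.mat n n (\<lambda>(i, j). A i j))"
    by (intro eq_matI) auto
  thus ?thesis
    unfolding fdet_def by (simp add: Determinant.det_transpose[of _ n])
qed

lemma fdet_permute_rows:
  assumes "p permutes {..<n}"
  shows "fdet n (\<lambda>i. A (p i)) = of_int (sign p) * fdet n A"
proof -
  have p: "p permutes {0..<n}" using assms by (simp only: lessThan_atLeast0)
  have "Matrix.mat n n (\<lambda>(i, j). A (p i) j) =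
        Matrix.mat n n (\<lambda>(i, j). Matrix.mat n n (\<lambda>(i, j). A i j) $$ (p i, j))"
    using permutes_in_image[OF p] by (intro eq_matI) auto
  thus ?thesis
    unfolding fdet_def using Determinant.det_permute_rows[OF _ p, of "Matrix.mat n n (\<lambda>(i, j). A i j)"]
    by simp
qed

lemma fdet_permute_cols:
  assumes "p permutes {..<n}"
  shows "fdet n (\<lambda>i j. A i (p j)) = of_int (sign p) * fdet n A"
  using fdet_permute_rows[OF assms, of "\<lambda>i j. A j i"]
        fdet_transpose[of n A] fdet_transpose[of n "\<lambda>i j. A i (p j)"] by simp

lemma fdet_identical_rows:
  assumes "i < n" "j < n" "i \<noteq> j" "\<And>k. k < n \<Longrightarrow> A i k = A j k"
  shows "fdet n A = 0"
  unfolding fdet_def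
  by (rule Determinant.det_identical_rows[of _ n i j]) (use assms in \<open>auto intro!: eq_vecI\<close>)

lemma fdet_identical_cols:
  assumes "i < n" "j < n" "i \<noteq> j" "\<And>k. k < n \<Longrightarrow> A k i = A k j"
  shows "fdet n A = 0"
  using fdet_identical_rows[OF assms(1-3), of "\<lambda>i j. A j i"] assms(4) fdet_transpose[of n A] by simp

text \<open>
  The derivative of the determinant at \<open>A\<close> in the direction \<open>H\<close>, by the product rule in the
  Leibniz formula. Being linear in \<open>H\<close>, it can be computed separately for each term of a
  derivative of the entries.
\<close>

definition ddet :: "nat \<Rightarrow> (nat \<Rightarrow> nat \<Rightarrow> 'a :: comm_ring_1) \<Rightarrow> (nat \<Rightarrow> nat \<Rightarrow> 'a) \<Rightarrow> 'a" where
  "ddet n A H = (\<Sum>p | p permutes {..<n}. of_int (sign p) *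
                   (\<Sum>q<n. H q (p q) * (\<Prod>i\<in>{..<n} - {q}. A i (p i))))"

lemma ddet_cong:
  assumes "\<And>i j. i < n \<Longrightarrow> j < n \<Longrightarrow> H i j = H' i j"
  shows "ddet n A H = ddet n A H'"
  unfolding ddet_def
proof (intro sum.cong arg_cong2[of _ _ _ _ "(*)"] refl)
  fix p q assume "p \<in> {p. p permutes {..<n}}" "q \<in> {..<n}"
  thus "H q (p q) = H' q (p q)"
    using permutes_in_image[of p "{..<n}" q] by (intro assms) auto
qed

lemma ddet_linear:
  "ddet n A (\<lambda>i j. \<Sum>c\<in>C. w c * G c i j) = (\<Sum>c\<in>C. w c * ddet n A (G c))"
proof (cases "finite C")
  case True
  thus ?thesis
  proof induction
    case empty
    thus ?case by (simp add: ddet_def)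
  next
    case (insert c C)
    have "ddet n A (\<lambda>i j. \<Sum>c\<in>insert c C. w c * G c i j) =
          w c * ddet n A (G c) + ddet n A (\<lambda>i j. \<Sum>c\<in>C. w c * G c i j)"
      unfolding ddet_def sum.insert[OF insert(1,2)]
      by (simp only: distrib_right distrib_left sum.distrib sum_distrib_left mult.assoc
            mult.left_commute[of _ "w c"])
    thus ?case using insert by simp
  qed
qed (simp add: ddet_def)

lemma ddet_add: "ddet n A (\<lambda>i j. G i j + H i j) = ddet n A G + ddet n A H"
  by (simp only: ddet_def distrib_right distrib_left sum.distrib)

lemma ddet_scale: "ddet n A (\<lambda>i j. c * H i j) = c * ddet n A H"
  by (simp only: ddet_def sum_distrib_left mult.assoc mult.left_commute[of _ c])

lemma ddet_rows: "ddet n A H = (\<Sum>q<n. fdet n (A(q := H q)))"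
proof -
  have *: "(\<Prod>i<n. (A(q := H q)) i (p i)) = H q (p q) * (\<Prod>i\<in>{..<n} - {q}. A i (p i))"
    if "q < n" for q p
    using that by (subst prod.remove[of _ q]) (auto intro!: prod.cong)
  show ?thesis
    unfolding ddet_def fdet_leibniz sum_distrib_left
    by (subst sum.swap, intro sum.cong refl, subst *) (auto simp: mult.assoc)
qed

lemma ddet_transpose: "ddet n (\<lambda>i j. A j i) (\<lambda>i j. H j i) = ddet n A H"
proof -
  let ?inv = Hilbert_Choice.inv
  have summand: "(\<Sum>q<n. H (?inv p q) q * (\<Prod>i\<in>{..<n} - {q}. A (?inv p i) i)) =
          (\<Sum>q<n. H q (p q) * (\<Prod>i\<in>{..<n} - {q}. A i (p i)))" if p: "p permutes {..<n}" for p
  proof -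
    have "(\<Sum>q<n. H (?inv p q) q * (\<Prod>i\<in>{..<n} - {q}. A (?inv p i) i)) =
          (\<Sum>x<n. H (?inv p (p x)) (p x) * (\<Prod>i\<in>{..<n} - {p x}. A (?inv p i) i))"
      by (rule sum.reindex_bij_betw[OF permutes_imp_bij[OF p], symmetric])
    also have "\<dots> = (\<Sum>q<n. H q (p q) * (\<Prod>i\<in>{..<n} - {q}. A i (p i)))"
    proof (rule sum.cong[OF refl])
      fix x assume x: "x \<in> {..<n}"
      have "bij_betw p ({..<n} - {x}) ({..<n} - {p x})"
        using permutes_inj[OF p] permutes_image[OF p]
        by (auto simp: bij_betw_def image_set_diff intro: inj_on_subset)
      from prod.reindex_bij_betw[OF this, of "\<lambda>i. A (?inv p i) i", symmetric]
      show "H (?inv p (p x)) (p x) * (\<Prod>i\<in>{..<n} - {p x}. A (?inv p i) i) =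
            H x (p x) * (\<Prod>i\<in>{..<n} - {x}. A i (p i))"
        by (simp add: permutes_inverses[OF p])
    qed
    finally show ?thesis .
  qed
  have "ddet n (\<lambda>i j. A j i) (\<lambda>i j. H j i) =
    (\<Sum>p | p permutes {..<n}. of_int (sign (?inv p)) *
       (\<Sum>q<n. H (?inv p q) q * (\<Prod>i\<in>{..<n} - {q}. A (?inv p i) i)))"
    unfolding ddet_def by (subst sum_permutations_inverse) simp
  also have "\<dots> = ddet n A H"
    unfolding ddet_def
    by (rule sum.cong[OF refl])
       (simp add: summand sign_inverse permutes_imp_permutation[OF finite_lessThan])
  finally show ?thesis .
qed

lemma ddet_cols: "ddet n A H = (\<Sum>q<n. fdet n (\<lambda>i. (A i)(q := H i q)))"
proof -
  have "ddet n A H = (\<Sum>q<n. fdet n ((\<lambda>i j. A j i)(q := (\<lambda>j. H j q))))"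
    by (subst ddet_transpose [symmetric], subst ddet_rows) simp
  also have "\<dots> = (\<Sum>q<n. fdet n (\<lambda>i. (A i)(q := H i q)))"
    by (intro sum.cong refl, subst fdet_transpose [symmetric])
       (auto intro!: fdet_cong)
  finally show ?thesis .
qed

lemma fdet_2: "fdet 2 A = A 0 0 * A 1 1 - A 0 1 * A 1 0"
proof -
  have eq: "{..<2::nat} = {0, 1}" by auto
  have "{p. p permutes {..<2::nat}} = {id, Transposition.transpose 0 1}"
    unfolding eq permutes_doubleton_iff by auto
  moreover have "id \<noteq> Transposition.transpose 0 (1::nat)"
    by (metis id_apply transpose_apply_first zero_neq_one)
  ultimately show ?thesis
    by (simp add: fdet_leibniz eq sign_swap_id sign_id)
qed

text \<open>
  Composed with the indices of a square array of size \<open>k + 1\<close>, this replaces the last row or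
  column by the one after it.
\<close>

definition bump :: "nat \<Rightarrow> nat \<Rightarrow> nat" where
  "bump k i = (if i = k then Suc k else i)"

text \<open>
  Multiply the matrix by one whose first \<open>k\<close> columns are those of the identity and whose last two
  are columns of the adjugate. The product is block triangular with determinant
  \<open>fdet k N * (det N)\<^sup>2\<close>, and the second factor is block triangular with the 2 by 2 block of the
  four cofactors. Cancelling \<open>det N\<close> once leaves the identity.
\<close>

lemma desnanot_jacobi_regular:
  fixes N :: "nat \<Rightarrow> nat \<Rightarrow> 'a :: idom"
  assumes nz: "fdet (k + 2) N \<noteq> 0"
  defines "\<sigma> \<equiv> bump k"
  shows "fdet (k + 2) N * fdet k N =
           fdet (k + 1) N * fdet (k + 1) (\<lambda>i j. N (\<sigma> i) (\<sigma> j)) -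
           fdet (k + 1) (\<lambda>i. N (\<sigma> i)) * fdet (k + 1) (\<lambda>i j. N i (\<sigma> j))"
proof -
  define A where "A = Matrix.mat (k + 2) (k + 2) (\<lambda>(i, j). N i j)"
  have A: "A \<in> carrier_mat (k + 2) (k + 2)" by (simp add: A_def)
  have dims [simp]: "dim_row A = k + 2" "dim_col A = k + 2" by (auto simp: A_def)
  have detA: "Determinant.det A = fdet (k + 2) N" by (simp add: A_def fdet_def)
  note adj = adj_mat[OF A]
  define B where "B = Matrix.mat (k + 2) (k + 2)
    (\<lambda>(i, j). if j < k then (if i = j then 1 else 0) else adj_mat A $$ (i, j))"
  have B: "B \<in> carrier_mat (k + 2) (k + 2)" by (simp add: B_def)
  have AB: "A * B = four_block_mat (Matrix.mat k k (\<lambda>(i, j). N i j)) (0\<^sub>m k 2)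
                      (Matrix.mat 2 k (\<lambda>(i, j). N (i + k) j)) (Determinant.det A \<cdot>\<^sub>m 1\<^sub>m 2)" (is "_ = ?R")
  proof (rule eq_matI)
    fix i j assume "i < dim_row ?R" "j < dim_col ?R"
    hence ij: "i < k + 2" "j < k + 2" by auto
    have *: "(A * B) $$ (i, j) = (\<Sum>r<k+2. A $$ (i, r) * B $$ (r, j))"
      using ij A B by (auto simp: scalar_prod_def lessThan_atLeast0 B_def)
    show "(A * B) $$ (i, j) = ?R $$ (i, j)"
    proof (cases "j < k")
      case True
      have "(\<Sum>r<k+2. A $$ (i, r) * B $$ (r, j)) = (\<Sum>r<k+2. if r = j then A $$ (i, j) else 0)"
        using True ij by (intro sum.cong) (auto simp: B_def)
      also have "\<dots> = N i j" using ij True by (simp add: A_def)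
      finally show ?thesis using * True ij by (auto simp: A_def)
    next
      case False
      have "(\<Sum>r<k+2. A $$ (i, r) * B $$ (r, j)) = (\<Sum>r<k+2. A $$ (i, r) * adj_mat A $$ (r, j))"
        using False ij by (intro sum.cong) (auto simp: B_def)
      also have "\<dots> = (A * adj_mat A) $$ (i, j)"
        using ij A adj(1) by (auto simp: scalar_prod_def lessThan_atLeast0 intro!: sum.cong)
      also have "\<dots> = (if i = j then Determinant.det A else 0)"
        unfolding adj(2) using ij by auto
      finally show ?thesis using * False ij by auto
    qed
  qed (use A B in auto)
  have detAB: "Determinant.det (A * B) = fdet k N * (Determinant.det A)\<^sup>2"
    unfolding AB
    by (subst det_four_block_mat_upper_right_zero[of _ k]) (auto simp: fdet_def)
  have Bblock: "B = four_block_mat (1\<^sub>m k) (Matrix.mat k 2 (\<lambda>(i, j). adj_mat A $$ (i, j + k))) (0\<^sub>m 2 k)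
                      (Matrix.mat 2 2 (\<lambda>(i, j). adj_mat A $$ (i + k, j + k)))" (is "_ = ?R")
  proof (rule eq_matI)
    fix i j assume "i < dim_row ?R" "j < dim_col ?R"
    hence ij: "i < k + 2" "j < k + 2" by auto
    thus "B $$ (i, j) = ?R $$ (i, j)" by (auto simp: B_def)
  qed (use B in auto)
  \<comment> \<open>Deleting row \<open>k\<close> of \<open>k + 2\<close> rows leaves the rows selected by \<open>bump k\<close>, and deleting row \<open>k + 1\<close> leaves the first ones.\<close>
  have cof: "adj_mat A $$ (i + k, j + k) =
      (-1) ^ (i + j) * fdet (k + 1) (\<lambda>a b. N (if j = 1 then a else \<sigma> a) (if i = 1 then b else \<sigma> b))"
    if "i < 2" "j < 2" for i j
  proof -
    have "mat_delete A (j + k) (i + k) = Matrix.mat (k + 1) (k + 1)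
            (\<lambda>(a, b). N (if j = 1 then a else \<sigma> a) (if i = 1 then b else \<sigma> b))"
      using that by (intro eq_matI) (auto simp: mat_delete_def A_def \<sigma>_def bump_def less_2_cases_iff)
    thus ?thesis using that by (auto simp: adj_mat_def cofactor_def fdet_def power_add less_2_cases_iff)
  qed
  have "Determinant.det B = fdet 2 (\<lambda>i j. adj_mat A $$ (i + k, j + k))"
    unfolding Bblock
    by (subst det_four_block_mat_lower_left_zero[of _ k]) (auto simp: fdet_def)
  also have "\<dots> = fdet (k + 1) N * fdet (k + 1) (\<lambda>i j. N (\<sigma> i) (\<sigma> j)) -
           fdet (k + 1) (\<lambda>i. N (\<sigma> i)) * fdet (k + 1) (\<lambda>i j. N i (\<sigma> j))"
    unfolding fdet_2 using cof[of 0 0] cof[of 0 1] cof[of 1 0] cof[of 1 1] by (simp add: mult.commute)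
  finally have detB: "Determinant.det B = \<dots>" .
  have "Determinant.det A * (Determinant.det A * fdet k N) = Determinant.det (A * B)"
    unfolding detAB by (simp only: power2_eq_square mult_ac)
  also have "\<dots> = Determinant.det A * Determinant.det B"
    by (rule Determinant.det_mult[OF A B])
  finally have "Determinant.det A * fdet k N = Determinant.det B"
    using nz by (metis detA mult_left_cancel)
  thus ?thesis unfolding detA detB .
qed

lemma poly_fdet: "poly (fdet n A) x = fdet n (\<lambda>i j. poly (A i j) x)"
  by (simp add: fdet_leibniz poly_sum poly_prod)

text \<open>
  The determinant of \<open>N + x I\<close> is a nonzero polynomial in \<open>x\<close>, so the regular case applies over
  polynomials and can be evaluated at \<open>x = 0\<close>.
\<close>

theorem desnanot_jacobi:
  fixes N :: "nat \<Rightarrow> nat \<Rightarrow> 'a :: field"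
  shows "fdet (Suc (Suc k)) N * fdet k N =
           fdet (Suc k) N * fdet (Suc k) (\<lambda>i j. N (bump k i) (bump k j)) -
           fdet (Suc k) (\<lambda>i. N (bump k i)) * fdet (Suc k) (\<lambda>i j. N i (bump k j))"
proof -
  define P where "P = (\<lambda>i j. [:N i j:] + (if i = j then [:0, 1:] else 0))"
  have "char_poly (Matrix.mat (k + 2) (k + 2) (\<lambda>(i, j). - N i j)) = fdet (k + 2) P"
    unfolding char_poly_def char_poly_matrix_def fdet_def
    by (intro arg_cong[of _ _ Determinant.det] eq_matI) (auto simp: P_def)
  moreover have "char_poly (Matrix.mat (k + 2) (k + 2) (\<lambda>(i, j). - N i j)) \<noteq> 0"
    using degree_monic_char_poly[of "Matrix.mat (k + 2) (k + 2) (\<lambda>(i, j). - N i j)" "k + 2"] by auto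
  ultimately have "fdet (k + 2) P \<noteq> 0" by simp
  have P0: "poly (P i j) 0 = N i j" for i j by (simp add: P_def)
  from arg_cong[OF desnanot_jacobi_regular[OF \<open>fdet (k + 2) P \<noteq> 0\<close>], of "\<lambda>p. poly p 0"]
  show ?thesis
    unfolding poly_mult poly_diff poly_fdet P0 by simp
qed

lemma ddet_scale_cols:
  "ddet n A (\<lambda>i j. c j * A i j) = (\<Sum>q<n. c q) * fdet n A"
proof -
  have "(\<Sum>q<n. (c (p q) * A q (p q)) * (\<Prod>i\<in>{..<n} - {q}. A i (p i))) =
        (\<Sum>q<n. c q) * (\<Prod>i<n. A i (p i))" if p: "p permutes {..<n}" for p
  proof -
    have "(\<Sum>q<n. (c (p q) * A q (p q)) * (\<Prod>i\<in>{..<n} - {q}. A i (p i))) =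
          (\<Sum>q<n. c (p q) * (\<Prod>i<n. A i (p i)))"
      by (intro sum.cong refl) (auto simp: prod.remove mult.assoc)
    also have "\<dots> = (\<Sum>q<n. c (p q)) * (\<Prod>i<n. A i (p i))"
      by (simp add: sum_distrib_right)
    also have "(\<Sum>q<n. c (p q)) = (\<Sum>q<n. c q)"
      by (rule sum.reindex_bij_betw[OF permutes_imp_bij[OF p]])
    finally show ?thesis .
  qed
  thus ?thesis
    unfolding ddet_def fdet_leibniz sum_distrib_left[of "\<Sum>q<n. c q"]
    by (intro sum.cong refl) (simp add: mult.left_commute[of "\<Sum>q<n. c q"])
qed

text \<open>
  Replacing a column by its successor duplicates a column, unless it is the last one.
\<close>

lemma ddet_shift_cols:
  "ddet (Suc k) A (\<lambda>i j. A i (j + 1)) = fdet (Suc k) (\<lambda>i j. A i (bump k j))"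
proof -
  have "fdet (Suc k) (\<lambda>i. (A i)(q := A i (q + 1))) = 0" if "q < k" for q
    using that by (intro fdet_identical_cols[of q _ "q + 1"]) auto
  hence "ddet (Suc k) A (\<lambda>i j. A i (j + 1)) = fdet (Suc k) (\<lambda>i. (A i)(k := A i (k + 1)))"
    unfolding ddet_cols by simp
  also have "\<dots> = fdet (Suc k) (\<lambda>i j. A i (bump k j))"
    by (intro fdet_cong) (auto simp: bump_def)
  finally show ?thesis .
qed

text \<open>
  Only the last two columns can move by two places without meeting another column.
\<close>

lemma ddet_shift2_cols:
  "ddet (Suc k) A (\<lambda>i j. A i (j + 2)) = fdet (Suc k) (\<lambda>i. (A i)(k := A i (k + 2))) +
     (if k = 0 then 0 else fdet (Suc k) (\<lambda>i. (A i)(k - 1 := A i (k + 1))))"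
proof (cases k)
  case 0
  thus ?thesis by (simp add: ddet_cols)
next
  case (Suc k')
  have "fdet (Suc k) (\<lambda>i. (A i)(q := A i (q + 2))) = 0" if "q < k'" for q
    using that Suc by (intro fdet_identical_cols[of q _ "q + 2"]) auto
  thus ?thesis
    unfolding ddet_cols by (simp add: Suc)
qed

lemma fdet_scale_row:
  assumes "q < n"
  shows "fdet n (A(q := (\<lambda>j. c * B j))) = c * fdet n (A(q := B))"
proof -
  have "(\<Prod>i<n. (A(q := (\<lambda>j. c * B j))) i (p i)) = c * (\<Prod>i<n. (A(q := B)) i (p i))" for p
    using assms by (simp add: prod.remove[of "{..<n}" q] mult.assoc)
  thus ?thesis
    by (simp add: fdet_leibniz sum_distrib_left mult.left_commute[of c])
qed

text \<open>
  Lowering the index of a row duplicates the previous row; the row of index 0 has the factor 0.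
\<close>

lemma ddet_lower_rows:
  "ddet k A (\<lambda>i j. of_nat i * A (i - 1) j) = 0"
  unfolding ddet_rows
proof (intro sum.neutral ballI)
  fix q assume q: "q \<in> {..<k}"
  have "of_nat q * fdet k (A(q := A (q - 1))) = 0"
  proof (cases "q = 0")
    case False
    thus ?thesis using q fdet_identical_rows[of q k "q - 1" "A(q := A (q - 1))"] by auto
  qed simp
  thus "fdet k (A(q := \<lambda>j. of_nat q * A (q - 1) j)) = 0"
    using q by (subst fdet_scale_row) auto
qed

lemma ddet_lower_cols:
  "ddet k A (\<lambda>i j. of_nat j * A i (j - 1)) = 0"
  using ddet_lower_rows[of k "\<lambda>i j. A j i"]
        ddet_transpose[of k A "\<lambda>i j. of_nat j * A i (j - 1)"] by simp

lemma ddet_shift_rows: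
  "ddet (Suc k) A (\<lambda>i j. A (i + 1) j) = fdet (Suc k) (\<lambda>i. A (bump k i))"
  using ddet_shift_cols[of k "\<lambda>i j. A j i"]
        ddet_transpose[of "Suc k" A "\<lambda>i j. A (i + 1) j"]
        fdet_transpose[of "Suc k" "\<lambda>i. A (bump k i)"] by simp

lemma ddet_scale_rows:
  "ddet n A (\<lambda>i j. c i * A i j) = (\<Sum>q<n. c q) * fdet n A"
  using ddet_scale_cols[of n "\<lambda>i j. A j i" c]
        ddet_transpose[of n A "\<lambda>i j. c i * A i j"]
        fdet_transpose[of n A] by simp

text \<open>
  With the last row index raised to \<open>k + 1\<close>, lowering it back to \<open>k\<close> is the only replacement
  that does not duplicate a row.
\<close>

lemma ddet_lower_bumped_rows:
  "ddet (Suc k) (\<lambda>i. A (bump k i)) (\<lambda>i j. of_nat (bump k i) * A (bump k i - 1) j) =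
     of_nat (Suc k) * fdet (Suc k) A"
proof -
  let ?A = "\<lambda>i. A (bump k i)"
  have "fdet (Suc k) (?A(q := \<lambda>j. of_nat q * A (q - 1) j)) = 0" if q: "q < k" for q
  proof -
    have "of_nat q * fdet (Suc k) (?A(q := A (q - 1))) = 0"
    proof (cases "q = 0")
      case False
      have "fdet (Suc k) (?A(q := A (q - 1))) = 0"
        using q False by (intro fdet_identical_rows[of q _ "q - 1"]) (auto simp: bump_def)
      thus ?thesis by simp
    qed simp
    thus ?thesis using q by (subst fdet_scale_row) auto
  qed
  hence "ddet (Suc k) ?A (\<lambda>i j. of_nat (bump k i) * A (bump k i - 1) j) =
         fdet (Suc k) (?A(k := \<lambda>j. of_nat (Suc k) * A k j))"
    unfolding ddet_rows by (simp add: bump_def)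
  also have "\<dots> = of_nat (Suc k) * fdet (Suc k) (?A(k := A k))"
    by (rule fdet_scale_row) simp
  also have "fdet (Suc k) (?A(k := A k)) = fdet (Suc k) A"
    by (intro fdet_cong) (auto simp: bump_def)
  finally show ?thesis .
qed

lemma ddet_lower_bumped_cols:
  "ddet (Suc k) (\<lambda>i j. A i (bump k j)) (\<lambda>i j. of_nat (bump k j) * A i (bump k j - 1)) =
     of_nat (Suc k) * fdet (Suc k) A"
  using ddet_lower_bumped_rows[of k "\<lambda>i j. A j i"]
        ddet_transpose[of "Suc k" "\<lambda>i j. A i (bump k j)" "\<lambda>i j. of_nat (bump k j) * A i (bump k j - 1)"]
        fdet_transpose[of "Suc k" A] by simp

text \<open>
  With \<open>M i j\<close> read as a function and each index shift as a derivation, this is the Toda lattice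
  equation for \<open>\<tau> k = fdet k M\<close>: the second logarithmic derivative of \<open>\<tau> (k + 1)\<close> is
  \<open>\<tau> (k + 2) * \<tau> k / (\<tau> (k + 1))\<^sup>2\<close>.
\<close>

lemma toda_first:
  fixes M :: "nat \<Rightarrow> nat \<Rightarrow> 'a :: field"
  shows "fdet (Suc k) M * fdet (Suc k) (\<lambda>i j. M (bump k i) (bump k j)) -
         fdet (Suc k) (\<lambda>i. M (bump k i)) * fdet (Suc k) (\<lambda>i j. M i (bump k j)) =
         fdet (Suc (Suc k)) M * fdet k M"
  using desnanot_jacobi[of k M] by simp

text \<open>
  A shift of the columns by two is the sum of the two determinants in \<open>ddet_shift2_cols\<close>. Each
  of them enters one instance of the Desnanot-Jacobi identity: the one for the columns
  \<open>0, \<dots>, k, k + 2\<close>, and the one for the columns \<open>0, \<dots>, k - 2, k, k - 1, k + 1\<close>.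
\<close>

lemma toda_second:
  fixes M :: "nat \<Rightarrow> nat \<Rightarrow> 'a :: field"
  shows "fdet (Suc k) M * ddet (Suc k) (\<lambda>i. M (bump k i)) (\<lambda>i j. M (bump k i) (j + 2)) -
         fdet (Suc k) (\<lambda>i. M (bump k i)) * ddet (Suc k) M (\<lambda>i j. M i (j + 2)) =
         fdet k M * ddet (Suc (Suc k)) M (\<lambda>i j. M i (j + 1)) -
         fdet (Suc (Suc k)) M * ddet k M (\<lambda>i j. M i (j + 1))"
proof -
  let ?T = "fdet (Suc k) M" and ?X = "fdet (Suc k) (\<lambda>i. M (bump k i))"
  define Z1 where "Z1 = fdet (Suc k) (\<lambda>i. (M i)(k := M i (k + 2)))"
  define XZ1 where "XZ1 = fdet (Suc k) (\<lambda>i. (M (bump k i))(k := M (bump k i) (k + 2)))"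
  have first: "?T * XZ1 - ?X * Z1 = fdet k M * ddet (Suc (Suc k)) M (\<lambda>i j. M i (j + 1))"
  proof -
    define N where "N = (\<lambda>i j. M i (bump (Suc k) j))"
    have "fdet (Suc (Suc k)) N = ddet (Suc (Suc k)) M (\<lambda>i j. M i (j + 1))"
      unfolding ddet_shift_cols N_def by simp
    moreover have "fdet k N = fdet k M" "fdet (Suc k) N = ?T"
      "fdet (Suc k) (\<lambda>i. N (bump k i)) = ?X"
      "fdet (Suc k) (\<lambda>i j. N i (bump k j)) = Z1"
      "fdet (Suc k) (\<lambda>i j. N (bump k i) (bump k j)) = XZ1"
      unfolding Z1_def XZ1_def N_def by (intro fdet_cong; auto simp: bump_def)+
    ultimately show ?thesis using desnanot_jacobi[of k N] by (simp add: mult.commute)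
  qed
  note shift2 = ddet_shift2_cols[of k M] ddet_shift2_cols[of k "\<lambda>i. M (bump k i)"]
  show ?thesis
  proof (cases k)
    case 0
    have "ddet k M (\<lambda>i j. M i (j + 1)) = 0" by (simp add: 0 ddet_cols)
    thus ?thesis using first unfolding shift2 by (simp add: 0 Z1_def XZ1_def)
  next
    case (Suc k')
    \<comment> \<open>The swap brings the columns into the order in which the identity for \<open>N\<close> produces \<open>Z2\<close> and
      \<open>XZ2\<close>. Every minor that contains both swapped columns changes its sign.\<close>
    define \<pi> where "\<pi> = Transposition.transpose k' k"
    have perm: "\<pi> permutes {..<n}" if "n > k" for n
      unfolding \<pi>_def using that Suc by (intro permutes_swap_id) auto
    have sgn: "sign \<pi> = -1" by (simp add: \<pi>_def sign_swap_id Suc)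
    define Z2 where "Z2 = fdet (Suc k) (\<lambda>i. (M i)(k' := M i (k + 1)))"
    define XZ2 where "XZ2 = fdet (Suc k) (\<lambda>i. (M (bump k i))(k' := M (bump k i) (k + 1)))"
    have "?T * XZ2 - ?X * Z2 = - (fdet (Suc (Suc k)) M * ddet k M (\<lambda>i j. M i (j + 1)))"
    proof -
      define N where "N = (\<lambda>i j. M i (\<pi> j))"
      have flip: "fdet n (\<lambda>i j. A i (\<pi> j)) = - fdet n A" if "n > k" for n and A :: "nat \<Rightarrow> nat \<Rightarrow> 'a"
        using fdet_permute_cols[OF perm[OF that], of A] by (simp add: sgn)
      have 1: "fdet (Suc (Suc k)) N = - fdet (Suc (Suc k)) M" "fdet (Suc k) N = - ?T"
        "fdet (Suc k) (\<lambda>i. N (bump k i)) = - ?X"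
        unfolding N_def
        using flip[of "Suc (Suc k)" M] flip[of "Suc k" M] flip[of "Suc k" "\<lambda>i. M (bump k i)"] by simp_all
      have 2: "fdet k N = ddet k M (\<lambda>i j. M i (j + 1))"
        unfolding Suc ddet_shift_cols N_def \<pi>_def
        by (intro fdet_cong) (auto simp: bump_def Transposition.transpose_def)
      have "fdet (Suc k) (\<lambda>i j. N i (bump k j)) =
            fdet (Suc k) (\<lambda>i j. ((M i)(k' := M i (k + 1))) (\<pi> j))"
        unfolding N_def \<pi>_def
        by (intro fdet_cong) (auto simp: Transposition.transpose_def Suc bump_def)
      hence 3: "fdet (Suc k) (\<lambda>i j. N i (bump k j)) = - Z2"
        using flip[of "Suc k" "\<lambda>i. (M i)(k' := M i (k + 1))"] by (simp only: Z2_def)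
      have "fdet (Suc k) (\<lambda>i j. N (bump k i) (bump k j)) =
            fdet (Suc k) (\<lambda>i j. ((M (bump k i))(k' := M (bump k i) (k + 1))) (\<pi> j))"
        unfolding N_def \<pi>_def
        by (intro fdet_cong) (auto simp: Transposition.transpose_def Suc bump_def)
      hence 4: "fdet (Suc k) (\<lambda>i j. N (bump k i) (bump k j)) = - XZ2"
        using flip[of "Suc k" "\<lambda>i. (M (bump k i))(k' := M (bump k i) (k + 1))"] by (simp only: XZ2_def)
      show ?thesis using desnanot_jacobi[of k N] unfolding 1 2 3 4 by simp
    qed
    with first show ?thesis
      unfolding shift2 using Suc by (simp add: Z1_def XZ1_def Z2_def XZ2_def algebra_simps)
  qed
qed

section \<open>First-order operators in the times and endpoints\<close>

text \<open>
  The points at which the differential equation is claimed.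
\<close>

definition admissible :: "nat \<Rightarrow> (nat \<Rightarrow> nat) \<Rightarrow> (nat \<Rightarrow> real) \<Rightarrow> (nat \<Rightarrow> nat \<Rightarrow> ereal) \<Rightarrow> bool" where
  "admissible m r t a \<longleftrightarrow> t 0 = 0 \<and> (\<forall>l<m. t l < t (l + 1)) \<and> (\<forall>l\<le>m. r l \<ge> 1) \<and>
     (\<forall>l\<le>m. \<forall>i. 1 \<le> i \<longrightarrow> i < 2 * r l \<longrightarrow> a l i < a l (i + 1))"

type_synonym coordinate = "nat + nat \<times> nat"

text \<open>
  The independent variables: \<open>Inl l\<close> stands for the time \<open>t l\<close> and \<open>Inr (l, i)\<close> for the endpoint
  \<open>a l i\<close>, which is a variable only if it is finite.
\<close>

definition coords :: "nat \<Rightarrow> (nat \<Rightarrow> nat) \<Rightarrow> (nat \<Rightarrow> nat \<Rightarrow> ereal) \<Rightarrow> coordinate set" where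
  "coords m r a = Inl ` {1..m} \<union> Inr ` (SIGMA l:{..m}. {i. i \<in> {1..2 * r l} \<and> \<bar>a l i\<bar> \<noteq> \<infinity>})"

definition along :: "coordinate \<Rightarrow> dyson_fun \<Rightarrow> (nat \<Rightarrow> real) \<Rightarrow> (nat \<Rightarrow> nat \<Rightarrow> ereal) \<Rightarrow> real \<Rightarrow> real" where
  "along c F t a s = (case c of Inl l \<Rightarrow> F (t(l := s)) a | Inr (l, i) \<Rightarrow> F t (a(l := (a l)(i := ereal s))))"

definition position :: "coordinate \<Rightarrow> (nat \<Rightarrow> real) \<Rightarrow> (nat \<Rightarrow> nat \<Rightarrow> ereal) \<Rightarrow> real" where
  "position c t a = (case c of Inl l \<Rightarrow> t l | Inr (l, i) \<Rightarrow> real_of_ereal (a l i))"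

text \<open>
  The function \<open>F\<close> has the value \<open>v\<close> under the first-order operator with coefficients \<open>w\<close>. Only
  partial derivatives with a nonzero coefficient are required to exist. Separate partial
  derivatives are enough here, since all functions arise from the moments by rational
  operations and logarithms, for which the rules of differentiation hold variable by variable.
\<close>

definition has_D :: "nat \<Rightarrow> (nat \<Rightarrow> nat) \<Rightarrow> (coordinate \<Rightarrow> real) \<Rightarrow> (nat \<Rightarrow> real) \<Rightarrow> (nat \<Rightarrow> nat \<Rightarrow> ereal)
    \<Rightarrow> dyson_fun \<Rightarrow> real \<Rightarrow> bool" where
  "has_D m r w t a F v \<longleftrightarrow> (\<exists>G.
     (\<forall>c\<in>coords m r a. w c \<noteq> 0 \<longrightarrow> (along c F t a has_real_derivative G c) (at (position c t a))) \<and>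
     v = (\<Sum>c\<in>coords m r a. w c * G c))"

lemma finite_coords [simp]: "finite (coords m r a)"
proof -
  have "finite {i. i \<in> {1..2 * r l} \<and> \<bar>a l i\<bar> \<noteq> \<infinity>}" for l
    by (rule finite_subset[of _ "{1..2 * r l}"]) auto
  thus ?thesis unfolding coords_def by (intro finite_UnI finite_imageI finite_SigmaI) auto
qed

lemma along_position:
  assumes "c \<in> coords m r a"
  shows "along c F t a (position c t a) = F t a"
proof (cases c)
  case (Inr li)
  then obtain l i where c: "c = Inr (l, i)" by (cases li) auto
  with assms have "ereal (real_of_ereal (a l i)) = a l i" by (auto simp: coords_def ereal_real')
  thus ?thesis by (simp only: c along_def position_def sum.case prod.case fun_upd_triv)
qed (simp add: along_def position_def)

lemma has_D_DERIV:
  assumes "\<And>c. c \<in> coords m r a \<Longrightarrow> w c \<noteq> 0 \<Longrightarrow> (along c F t a has_real_derivative G c) (at (position c t a))"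
    and "v = (\<Sum>c\<in>coords m r a. w c * G c)"
  shows "has_D m r w t a F v"
  using assms unfolding has_D_def by blast

lemma has_D_const: "has_D m r w t a (\<lambda>t a. k) 0"
  by (rule has_D_DERIV[of _ _ _ _ _ _ "\<lambda>_. 0"])
     (auto simp: along_def[abs_def] case_prod_unfold split: sum.splits)

text \<open>
  An operator without time derivatives does not see factors that depend on the times only.
\<close>

lemma has_D_time_coefficient:
  assumes "\<And>l. w (Inl l) = 0"
  shows "has_D m r w t a (\<lambda>t a. K t) 0"
proof (rule has_D_DERIV[of _ _ _ _ _ _ "\<lambda>_. 0"])
  fix c assume "w c \<noteq> 0"
  then obtain li where "c = Inr li" using assms by (cases c) auto
  thus "(along c (\<lambda>t a. K t) t a has_real_derivative 0) (at (position c t a))"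
    by (simp add: along_def[abs_def] case_prod_unfold)
qed simp

lemma has_D_add:
  assumes "has_D m r w t a F u" "has_D m r w t a F' v"
  shows "has_D m r w t a (\<lambda>t a. F t a + F' t a) (u + v)"
proof -
  from assms obtain G G' where
    G: "\<forall>c\<in>coords m r a. w c \<noteq> 0 \<longrightarrow> (along c F t a has_real_derivative G c) (at (position c t a))"
       "u = (\<Sum>c\<in>coords m r a. w c * G c)" and
    G': "\<forall>c\<in>coords m r a. w c \<noteq> 0 \<longrightarrow> (along c F' t a has_real_derivative G' c) (at (position c t a))"
       "v = (\<Sum>c\<in>coords m r a. w c * G' c)"
    unfolding has_D_def by blast
  have *: "along c (\<lambda>t a. F t a + F' t a) t a = (\<lambda>s. along c F t a s + along c F' t a s)" for c
    by (auto simp: along_def fun_eq_iff split: sum.splits)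
  show ?thesis
    using G G' by (intro has_D_DERIV[of _ _ _ _ _ _ "\<lambda>c. G c + G' c"])
      (auto simp: * algebra_simps sum.distrib intro!: derivative_eq_intros)
qed

lemma has_D_mult:
  assumes "has_D m r w t a F u" "has_D m r w t a F' v"
  shows "has_D m r w t a (\<lambda>t a. F t a * F' t a) (u * F' t a + F t a * v)"
proof -
  from assms obtain G G' where
    G: "\<forall>c\<in>coords m r a. w c \<noteq> 0 \<longrightarrow> (along c F t a has_real_derivative G c) (at (position c t a))"
       "u = (\<Sum>c\<in>coords m r a. w c * G c)" and
    G': "\<forall>c\<in>coords m r a. w c \<noteq> 0 \<longrightarrow> (along c F' t a has_real_derivative G' c) (at (position c t a))"
       "v = (\<Sum>c\<in>coords m r a. w c * G' c)"
    unfolding has_D_def by blast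
  have *: "along c (\<lambda>t a. F t a * F' t a) t a = (\<lambda>s. along c F t a s * along c F' t a s)" for c
    by (auto simp: along_def fun_eq_iff split: sum.splits)
  show ?thesis
    using G G' by (intro has_D_DERIV[of _ _ _ _ _ _ "\<lambda>c. G c * F' t a + F t a * G' c"])
      (auto simp: * algebra_simps sum.distrib sum_distrib_left along_position intro!: derivative_eq_intros)
qed

lemma has_D_compose:
  assumes "has_D m r w t a F u" "(f has_real_derivative d) (at (F t a))"
  shows "has_D m r w t a (\<lambda>t a. f (F t a)) (d * u)"
proof -
  from assms obtain G where
    G: "\<forall>c\<in>coords m r a. w c \<noteq> 0 \<longrightarrow> (along c F t a has_real_derivative G c) (at (position c t a))"
       "u = (\<Sum>c\<in>coords m r a. w c * G c)"
    unfolding has_D_def by blast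
  have *: "along c (\<lambda>t a. f (F t a)) t a = (\<lambda>s. f (along c F t a s))" for c
    by (auto simp: along_def fun_eq_iff split: sum.splits)
  show ?thesis
    using G assms(2) by (intro has_D_DERIV[of _ _ _ _ _ _ "\<lambda>c. d * G c"])
      (auto simp: * algebra_simps sum_distrib_left along_position intro!: DERIV_chain2[where f = f])
qed

lemma has_D_cmult: "has_D m r w t a F u \<Longrightarrow> has_D m r w t a (\<lambda>t a. k * F t a) (k * u)"
  using has_D_mult[OF has_D_const[of m r w t a k], of F u] by simp

lemma has_D_diff:
  assumes "has_D m r w t a F u" "has_D m r w t a F' v"
  shows "has_D m r w t a (\<lambda>t a. F t a - F' t a) (u - v)"
  using has_D_add[OF assms(1) has_D_cmult[OF assms(2), of "-1"]] by simp

lemma has_D_divide: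
  assumes "has_D m r w t a F u" "has_D m r w t a F' v" "F' t a \<noteq> 0"
  shows "has_D m r w t a (\<lambda>t a. F t a / F' t a) ((u * F' t a - F t a * v) / (F' t a)\<^sup>2)"
proof -
  have "has_D m r w t a (\<lambda>t a. inverse (F' t a)) (- (inverse (F' t a))\<^sup>2 * v)"
    using assms(3) by (intro has_D_compose[OF assms(2)]) (auto intro!: derivative_eq_intros simp: power2_eq_square)
  from has_D_mult[OF assms(1) this] show ?thesis
    using assms(3) by (simp add: field_simps power2_eq_square)
qed

lemma has_D_ln:
  assumes "has_D m r w t a F u" "F t a > 0"
  shows "has_D m r w t a (\<lambda>t a. ln (F t a)) (u / F t a)"
  using has_D_compose[OF assms(1) DERIV_ln_divide[OF assms(2)]] by simp

lemma DERIV_fdet: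
  fixes A :: "nat \<Rightarrow> nat \<Rightarrow> real \<Rightarrow> real"
  assumes "\<And>i j. i < k \<Longrightarrow> j < k \<Longrightarrow> (A i j has_real_derivative H i j) (at s)"
  shows "((\<lambda>s. fdet k (\<lambda>i j. A i j s)) has_real_derivative ddet k (\<lambda>i j. A i j s) H) (at s)"
  unfolding fdet_leibniz ddet_def
proof (intro DERIV_sum DERIV_cmult)
  fix p assume "p \<in> {p. p permutes {..<k}}"
  hence "p i < k" if "i < k" for i using permutes_in_image[of p "{..<k}" i] that by auto
  thus "((\<lambda>s. \<Prod>i<k. A i (p i) s) has_real_derivative
          (\<Sum>q<k. H q (p q) * (\<Prod>i\<in>{..<k} - {q}. A i (p i) s))) (at s)"
    by (intro has_field_derivative_prod) (auto intro!: assms)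
qed

lemma has_D_fdet:
  assumes "\<And>i j. i < k \<Longrightarrow> j < k \<Longrightarrow> has_D m r w t a (A i j) (H i j)"
  shows "has_D m r w t a (\<lambda>t a. fdet k (\<lambda>i j. A i j t a)) (ddet k (\<lambda>i j. A i j t a) H)"
proof -
  have "\<exists>G. i < k \<longrightarrow> j < k \<longrightarrow>
     (\<forall>c\<in>coords m r a. w c \<noteq> 0 \<longrightarrow> (along c (A i j) t a has_real_derivative G c) (at (position c t a))) \<and>
     H i j = (\<Sum>c\<in>coords m r a. w c * G c)" for i j
    using assms[of i j] unfolding has_D_def by blast
  then obtain G where G: "\<And>i j c. i < k \<Longrightarrow> j < k \<Longrightarrow> c \<in> coords m r a \<Longrightarrow> w c \<noteq> 0 \<Longrightarrow>
      (along c (A i j) t a has_real_derivative G i j c) (at (position c t a))"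
    and H: "\<And>i j. i < k \<Longrightarrow> j < k \<Longrightarrow> H i j = (\<Sum>c\<in>coords m r a. w c * G i j c)"
    by metis
  show ?thesis
  proof (rule has_D_DERIV)
    fix c assume c: "c \<in> coords m r a" "w c \<noteq> 0"
    have "along c (\<lambda>t a. fdet k (\<lambda>i j. A i j t a)) t a = (\<lambda>s. fdet k (\<lambda>i j. along c (A i j) t a s))"
      by (auto simp: along_def fun_eq_iff split: sum.splits)
    moreover have "((\<lambda>s. fdet k (\<lambda>i j. along c (A i j) t a s)) has_real_derivative
        ddet k (\<lambda>i j. along c (A i j) t a (position c t a)) (\<lambda>i j. G i j c)) (at (position c t a))"
      by (intro DERIV_fdet G c)
    ultimately show "(along c (\<lambda>t a. fdet k (\<lambda>i j. A i j t a)) t a has_real_derivative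
        ddet k (\<lambda>i j. A i j t a) (\<lambda>i j. G i j c)) (at (position c t a))"
      using c by (simp add: along_position)
  next
    have "ddet k (\<lambda>i j. A i j t a) H = ddet k (\<lambda>i j. A i j t a) (\<lambda>i j. \<Sum>c\<in>coords m r a. w c * G i j c)"
      by (intro ddet_cong H)
    thus "ddet k (\<lambda>i j. A i j t a) H =
       (\<Sum>c\<in>coords m r a. w c * ddet k (\<lambda>i j. A i j t a) (\<lambda>i j. G i j c))"
      by (simp add: ddet_linear)
  qed
qed

text \<open>
  Admissibility is an open condition in each variable, so the derivatives of \<open>F\<close> are determined
  by its values at admissible points.
\<close>

lemma eventually_admissible:
  assumes adm: "admissible m r t a" and c: "c \<in> coords m r a"
  shows "\<forall>\<^sub>F s in nhds (position c t a).
           case c of Inl l \<Rightarrow> admissible m r (t(l := s)) a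
                   | Inr (l, i) \<Rightarrow> admissible m r t (a(l := (a l)(i := ereal s)))"
proof (cases c)
  case (Inl l)
  with c have l: "1 \<le> l" "l \<le> m" by (auto simp: coords_def)
  have "\<forall>\<^sub>F s in nhds (t l). s > t (l - 1)"
    using adm l eventually_nhds_in_open[of "{t (l - 1)<..}" "t l"]
    by (auto simp: admissible_def dest: spec[of _ "l - 1"])
  moreover have "\<forall>\<^sub>F s in nhds (t l). l < m \<longrightarrow> s < t (l + 1)"
    using adm l eventually_nhds_in_open[of "{..<t (l + 1)}" "t l", simplified]
    by (cases "l < m") (auto simp: admissible_def)
  ultimately have "\<forall>\<^sub>F s in nhds (t l). admissible m r (t(l := s)) a"
  proof eventually_elim
    case (elim s)
    thus ?case using adm l by (auto simp: admissible_def)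
  qed
  thus ?thesis by (simp add: Inl position_def)
next
  case (Inr li)
  then obtain l i where c': "c = Inr (l, i)" by (cases li) auto
  with c have l: "l \<le> m" "1 \<le> i" "i \<le> 2 * r l" "\<bar>a l i\<bar> \<noteq> \<infinity>" by (auto simp: coords_def)
  define x where "x = real_of_ereal (a l i)"
  have x: "a l i = ereal x" using l by (auto simp: x_def ereal_real')
  have incr: "a l i < a l (i + 1)" if "1 \<le> i" "i < 2 * r l" for i
    using adm l that by (simp add: admissible_def)
  have lim: "((\<lambda>s. ereal s) \<longlongrightarrow> ereal x) (nhds x)"
    by (intro tendsto_intros filterlim_ident)
  \<comment> \<open>An endpoint at the border of its list has a neighbour on one side only.\<close>
  have "\<forall>\<^sub>F s in nhds x. i > 1 \<longrightarrow> ereal s > a l (i - 1)"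
  proof (cases "i > 1")
    case True
    hence "a l (i - 1) < ereal x"
      using incr[of "i - 1"] l x by simp
    thus ?thesis using order_tendstoD(1)[OF lim] by simp
  qed simp
  moreover have "\<forall>\<^sub>F s in nhds x. i < 2 * r l \<longrightarrow> ereal s < a l (i + 1)"
  proof (cases "i < 2 * r l")
    case True
    hence "ereal x < a l (i + 1)" using incr[of i] l x by simp
    thus ?thesis using order_tendstoD(2)[OF lim] by simp
  qed simp
  ultimately have "\<forall>\<^sub>F s in nhds x. admissible m r t (a(l := (a l)(i := ereal s)))"
  proof eventually_elim
    case (elim s)
    have "(a(l := (a l)(i := ereal s))) k j < (a(l := (a l)(i := ereal s))) k (j + 1)"
      if k: "k \<le> m" "1 \<le> j" "j < 2 * r k" for k j
    proof -
      have "a k j < a k (j + 1)" using adm k by (simp add: admissible_def)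
      thus ?thesis using elim k l by (cases "k = l"; cases "j = i"; cases "j + 1 = i") auto
    qed
    thus ?case using adm by (simp add: admissible_def del: fun_upd_apply)
  qed
  thus ?thesis by (simp add: c' position_def x_def)
qed

lemma has_D_cong:
  assumes "has_D m r w t a F v" "admissible m r t a"
    and eq: "\<And>t a. admissible m r t a \<Longrightarrow> F t a = F' t a"
  shows "has_D m r w t a F' v"
proof -
  from assms obtain G where
    G: "\<forall>c\<in>coords m r a. w c \<noteq> 0 \<longrightarrow> (along c F t a has_real_derivative G c) (at (position c t a))"
       "v = (\<Sum>c\<in>coords m r a. w c * G c)"
    unfolding has_D_def by blast
  show ?thesis
  proof (rule has_D_DERIV[OF _ G(2)])
    fix c assume c: "c \<in> coords m r a" "w c \<noteq> 0"
    have "\<forall>\<^sub>F s in nhds (position c t a). along c F t a s = along c F' t a s"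
      using eventually_admissible[OF assms(2) c(1)]
      by eventually_elim (auto simp: along_def eq split: sum.splits)
    thus "(along c F' t a has_real_derivative G c) (at (position c t a))"
      using G(1) c DERIV_cong_ev[OF refl _ refl] by blast
  qed
qed

lemma sum_coords:
  "(\<Sum>c\<in>coords m r a. g c) = (\<Sum>l = 1..m. g (Inl l)) +
     (\<Sum>l\<le>m. \<Sum>i | i \<in> {1..2 * r l} \<and> \<bar>a l i\<bar> \<noteq> \<infinity>. g (Inr (l, i)))"
proof -
  have fin: "finite {i. i \<in> {1..2 * r l} \<and> \<bar>a l i\<bar> \<noteq> \<infinity>}" for l
    by (rule finite_subset[of _ "{1..2 * r l}"]) auto
  have "(\<Sum>c\<in>coords m r a. g c) = (\<Sum>c\<in>Inl ` {1..m}. g c) +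
            (\<Sum>c\<in>Inr ` (SIGMA l:{..m}. {i. i \<in> {1..2 * r l} \<and> \<bar>a l i\<bar> \<noteq> \<infinity>}). g c)"
    unfolding coords_def using fin by (intro sum.union_disjoint finite_imageI finite_SigmaI) auto
  also have "(\<Sum>c\<in>Inl ` {1..m}. g c) = (\<Sum>l = 1..m. g (Inl l))"
    by (subst sum.reindex) auto
  also have "(\<Sum>c\<in>Inr ` (SIGMA l:{..m}. {i. i \<in> {1..2 * r l} \<and> \<bar>a l i\<bar> \<noteq> \<infinity>}). g c) =
             (\<Sum>(l, i)\<in>(SIGMA l:{..m}. {i. i \<in> {1..2 * r l} \<and> \<bar>a l i\<bar> \<noteq> \<infinity>}). g (Inr (l, i)))"
    by (subst sum.reindex) (auto simp: case_prod_unfold)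
  also have "\<dots> = (\<Sum>l\<le>m. \<Sum>i | i \<in> {1..2 * r l} \<and> \<bar>a l i\<bar> \<noteq> \<infinity>. g (Inr (l, i)))"
    using fin by (subst sum.Sigma) auto
  finally show ?thesis .
qed

text \<open>
  The operators are defined through \<open>deriv\<close>, whose value means nothing where no derivative
  exists; in directions with coefficient 0 this does no harm.
\<close>

lemma has_D_imp_eq:
  assumes "has_D m r w t a F v"
  shows "v = (\<Sum>l = 1..m. w (Inl l) * d_time l F t a) +
             (\<Sum>l\<le>m. \<Sum>i | i \<in> {1..2 * r l} \<and> \<bar>a l i\<bar> \<noteq> \<infinity>. w (Inr (l, i)) * d_end l i F t a)"
proof -
  from assms obtain G where
    G: "\<And>c. c\<in>coords m r a \<Longrightarrow> w c \<noteq> 0 \<Longrightarrow> (along c F t a has_real_derivative G c) (at (position c t a))"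
       "v = (\<Sum>c\<in>coords m r a. w c * G c)"
    unfolding has_D_def by blast
  have time: "w (Inl l) * G (Inl l) = w (Inl l) * d_time l F t a" if "l \<in> {1..m}" for l
  proof -
    have "Inl l \<in> coords m r a" using that by (auto simp: coords_def)
    from G(1)[OF this] show ?thesis
      by (cases "w (Inl l) = 0") (auto simp: d_time_def along_def[abs_def] position_def dest!: DERIV_imp_deriv)
  qed
  have endpoint: "w (Inr (l, i)) * G (Inr (l, i)) = w (Inr (l, i)) * d_end l i F t a"
    if "l \<in> {..m}" "i \<in> {i. i \<in> {1..2 * r l} \<and> \<bar>a l i\<bar> \<noteq> \<infinity>}" for l i
  proof -
    have "Inr (l, i) \<in> coords m r a" using that by (auto simp: coords_def)
    from G(1)[OF this] show ?thesis
      by (cases "w (Inr (l, i)) = 0") (auto simp: d_end_def along_def[abs_def] position_def dest!: DERIV_imp_deriv)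
  qed
  show ?thesis
    unfolding G(2) sum_coords by (intro arg_cong2[of _ _ _ _ "(+)"] sum.cong refl time endpoint)
qed

section \<open>The equation for determinants of moments\<close>

text \<open>
  The coefficients of the first-order parts of the four operators. The scalar terms of \<open>A2\<close> and
  \<open>B2\<close> reappear in \<open>has_D_imp_A2\<close> and \<open>has_D_imp_B2\<close>.
\<close>

definition w_A1 :: "(nat \<Rightarrow> real) \<Rightarrow> coordinate \<Rightarrow> real" where
  "w_A1 t c = (case c of Inl l \<Rightarrow> 0 | Inr (l, i) \<Rightarrow> exp (- t l))"

definition w_B1 :: "nat \<Rightarrow> (nat \<Rightarrow> real) \<Rightarrow> coordinate \<Rightarrow> real" where
  "w_B1 m t c = (case c of Inl l \<Rightarrow> 0 | Inr (l, i) \<Rightarrow> exp (t l - t m))"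

definition w_A2 :: "(nat \<Rightarrow> real) \<Rightarrow> (nat \<Rightarrow> nat \<Rightarrow> ereal) \<Rightarrow> coordinate \<Rightarrow> real" where
  "w_A2 t a c = (case c of Inl l \<Rightarrow> 1 - exp (- 2 * t l)
                   | Inr (l, i) \<Rightarrow> exp (- 2 * t l) * real_of_ereal (a l i))"

definition w_B2 :: "nat \<Rightarrow> (nat \<Rightarrow> real) \<Rightarrow> (nat \<Rightarrow> nat \<Rightarrow> ereal) \<Rightarrow> coordinate \<Rightarrow> real" where
  "w_B2 m t a c = (case c of Inl l \<Rightarrow> exp (2 * (t l - t m)) - exp (- 2 * t m)
                     | Inr (l, i) \<Rightarrow> exp (2 * (t l - t m)) * real_of_ereal (a l i))"

lemma has_D_imp_A1: "has_D m r (w_A1 t) t a F v \<Longrightarrow> A1 m r F t a = v"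
  by (drule has_D_imp_eq) (simp add: A1_def D1_def w_A1_def sum_distrib_left)

lemma has_D_imp_B1: "has_D m r (w_B1 m t) t a F v \<Longrightarrow> B1 m r F t a = v"
  by (drule has_D_imp_eq) (simp add: B1_def D1_def w_B1_def sum_distrib_left)

lemma has_D_imp_A2: "has_D m r (w_A2 t a) t a F v \<Longrightarrow> A2 m r F t a = v - exp (- 2 * t m) * F t a"
  by (drule has_D_imp_eq) (simp add: A2_def D2_def w_A2_def sum_distrib_left mult.assoc)

lemma has_D_imp_B2: "has_D m r (w_B2 m t a) t a F v \<Longrightarrow> B2 m r F t a = v - exp (- 2 * t m) * F t a"
  by (drule has_D_imp_eq) (simp add: B2_def D2_def w_B2_def sum_distrib_left mult.assoc)

text \<open>
  What the differential equation uses of the moments: each operator raises one index, apart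
  from terms that vanish or act as scalars inside a determinant. The functions \<open>\<alpha>\<close> and \<open>\<beta>\<close> of the
  times stand for the divergences of the dilations in \<open>A2\<close> and \<open>B2\<close>. They cancel in the end.
\<close>

locale moment_array =
  fixes m :: nat and r :: "nat \<Rightarrow> nat" and M :: "nat \<Rightarrow> nat \<Rightarrow> dyson_fun"
    and \<alpha> \<beta> :: "(nat \<Rightarrow> real) \<Rightarrow> real"
  assumes A1_moment: "admissible m r t a \<Longrightarrow> has_D m r (w_A1 t) t a (M i j)
        (real i * M (i - 1) j t a + exp (- t m) * (real j * M i (j - 1) t a) + (- 2) * M (i + 1) j t a)"
    and B1_moment: "admissible m r t a \<Longrightarrow> has_D m r (w_B1 m t) t a (M i j)
        (exp (- t m) * (real i * M (i - 1) j t a) + real j * M i (j - 1) t a + (- 2) * M i (j + 1) t a)"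
    and A2_moment: "admissible m r t a \<Longrightarrow> has_D m r (w_A2 t a) t a (M i j)
        ((\<alpha> t + real i) * M i j t a + (exp (- 2 * t m) * real j) * M i j t a + (- 2) * M (i + 2) j t a)"
    and B2_moment: "admissible m r t a \<Longrightarrow> has_D m r (w_B2 m t a) t a (M i j)
        ((exp (- 2 * t m) * real i) * M i j t a + (\<beta> t + real j) * M i j t a + (- 2) * M i (j + 2) t a)"
    and tau_pos: "admissible m r t a \<Longrightarrow> fdet k (\<lambda>i j. M i j t a) > 0"
begin

definition tau :: "nat \<Rightarrow> dyson_fun" where
  "tau k t a = fdet k (\<lambda>i j. M i j t a)"

text \<open>
  In these names each \<open>X\<close> stands for one raising of the row index and each \<open>Y\<close> for one raising
  of the column index, applied as a derivation to the determinant \<open>tau\<close>. For a double letter the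
  index is raised by two at once. The mixed and double shifts with the argument \<open>k\<close> belong to the
  determinant of size \<open>k + 1\<close>.
\<close>

definition tauX :: "nat \<Rightarrow> dyson_fun" where
  "tauX k t a = ddet k (\<lambda>i j. M i j t a) (\<lambda>i j. M (i + 1) j t a)"

definition tauY :: "nat \<Rightarrow> dyson_fun" where
  "tauY k t a = ddet k (\<lambda>i j. M i j t a) (\<lambda>i j. M i (j + 1) t a)"

lemma tauX_Suc: "tauX (Suc k) t a = fdet (Suc k) (\<lambda>i j. M (bump k i) j t a)"
  unfolding tauX_def by (rule ddet_shift_rows)

lemma tauY_Suc: "tauY (Suc k) t a = fdet (Suc k) (\<lambda>i j. M i (bump k j) t a)"
  unfolding tauY_def by (rule ddet_shift_cols)

definition tauXY :: "nat \<Rightarrow> dyson_fun" where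
  "tauXY k t a = fdet (Suc k) (\<lambda>i j. M (bump k i) (bump k j) t a)"

text \<open>
  The lowering terms contribute nothing to the determinant.
\<close>

lemma A1_tau:
  assumes "admissible m r t a"
  shows "has_D m r (w_A1 t) t a (tau k) (- 2 * tauX k t a)"
proof -
  have "has_D m r (w_A1 t) t a (tau k) (ddet k (\<lambda>i j. M i j t a) (\<lambda>i j.
          real i * M (i - 1) j t a + exp (- t m) * (real j * M i (j - 1) t a) + (- 2) * M (i + 1) j t a))"
    unfolding tau_def[abs_def] by (intro has_D_fdet A1_moment assms)
  thus ?thesis
    unfolding ddet_add ddet_scale ddet_lower_cols[of k "\<lambda>i j. M i j t a"]
      ddet_lower_rows[of k "\<lambda>i j. M i j t a"] tauX_def by simp
qed

lemma B1_tau: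
  assumes "admissible m r t a"
  shows "has_D m r (w_B1 m t) t a (tau k) (- 2 * tauY k t a)"
proof -
  have "has_D m r (w_B1 m t) t a (tau k) (ddet k (\<lambda>i j. M i j t a) (\<lambda>i j.
          exp (- t m) * (real i * M (i - 1) j t a) + real j * M i (j - 1) t a + (- 2) * M i (j + 1) t a))"
    unfolding tau_def[abs_def] by (intro has_D_fdet B1_moment assms)
  thus ?thesis
    unfolding ddet_add ddet_scale ddet_lower_cols[of k "\<lambda>i j. M i j t a"]
      ddet_lower_rows[of k "\<lambda>i j. M i j t a"] tauY_def by simp
qed

text \<open>
  In contrast to \<open>B1_tau\<close>, lowering the raised last row gives back \<open>tau\<close>. This is the source of
  the term \<open>2 n exp (- t m)\<close> in the denominators of the equation.
\<close>

lemma B1_tauX: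
  assumes "admissible m r t a"
  shows "has_D m r (w_B1 m t) t a (tauX (Suc k)) (real (Suc k) * exp (- t m) * tau (Suc k) t a - 2 * tauXY k t a)"
proof -
  have "has_D m r (w_B1 m t) t a (tauX (Suc k)) (ddet (Suc k) (\<lambda>i j. M (bump k i) j t a) (\<lambda>i j.
          exp (- t m) * (real (bump k i) * M (bump k i - 1) j t a) + real j * M (bump k i) (j - 1) t a
            + (- 2) * M (bump k i) (j + 1) t a))"
    unfolding tauX_Suc[abs_def] by (intro has_D_fdet B1_moment assms)
  thus ?thesis
    unfolding ddet_add ddet_scale
      ddet_lower_bumped_rows[of k "\<lambda>i j. M i j t a"]
      ddet_lower_cols[of "Suc k" "\<lambda>i j. M (bump k i) j t a"]
      ddet_shift_cols[of k "\<lambda>i j. M (bump k i) j t a"]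
      tauXY_def tau_def by (simp add: algebra_simps)
qed

lemma A1_tauY:
  assumes "admissible m r t a"
  shows "has_D m r (w_A1 t) t a (tauY (Suc k)) (real (Suc k) * exp (- t m) * tau (Suc k) t a - 2 * tauXY k t a)"
proof -
  have "has_D m r (w_A1 t) t a (tauY (Suc k)) (ddet (Suc k) (\<lambda>i j. M i (bump k j) t a) (\<lambda>i j.
          real i * M (i - 1) (bump k j) t a + exp (- t m) * (real (bump k j) * M i (bump k j - 1) t a)
            + (- 2) * M (i + 1) (bump k j) t a))"
    unfolding tauY_Suc[abs_def] by (intro has_D_fdet A1_moment assms)
  thus ?thesis
    unfolding ddet_add ddet_scale
      ddet_lower_bumped_cols[of k "\<lambda>i j. M i j t a"]
      ddet_lower_rows[of "Suc k" "\<lambda>i j. M i (bump k j) t a"]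
      ddet_shift_rows[of k "\<lambda>i j. M i (bump k j) t a"]
      tauXY_def tau_def by (simp add: algebra_simps)
qed

definition tauXX :: "nat \<Rightarrow> dyson_fun" where
  "tauXX k t a = ddet (Suc k) (\<lambda>i j. M i j t a) (\<lambda>i j. M (i + 2) j t a)"

definition tauYY :: "nat \<Rightarrow> dyson_fun" where
  "tauYY k t a = ddet (Suc k) (\<lambda>i j. M i j t a) (\<lambda>i j. M i (j + 2) t a)"

definition tauXYY :: "nat \<Rightarrow> dyson_fun" where
  "tauXYY k t a = ddet (Suc k) (\<lambda>i j. M (bump k i) j t a) (\<lambda>i j. M (bump k i) (j + 2) t a)"

definition tauXXY :: "nat \<Rightarrow> dyson_fun" where
  "tauXXY k t a = ddet (Suc k) (\<lambda>i j. M i (bump k j) t a) (\<lambda>i j. M (i + 2) (bump k j) t a)"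

lemma sum_bump: "(\<Sum>q<Suc k. c * real (bump k q)) = (\<Sum>q<Suc k. c * real q) + c"
  by (simp add: bump_def algebra_simps)

lemma B2_tau:
  assumes "admissible m r t a"
  shows "has_D m r (w_B2 m t a) t a (tau (Suc k))
    (((\<Sum>q<Suc k. exp (- 2 * t m) * real q) + (\<Sum>q<Suc k. \<beta> t + real q)) * tau (Suc k) t a - 2 * tauYY k t a)"
proof -
  have "has_D m r (w_B2 m t a) t a (tau (Suc k)) (ddet (Suc k) (\<lambda>i j. M i j t a) (\<lambda>i j.
          (exp (- 2 * t m) * real i) * M i j t a + (\<beta> t + real j) * M i j t a + (- 2) * M i (j + 2) t a))"
    unfolding tau_def[abs_def] by (intro has_D_fdet B2_moment assms)
  thus ?thesis
    unfolding ddet_add ddet_scale[of _ _ "-2"]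
      ddet_scale_cols[of _ _ "\<lambda>j. \<beta> t + real j"]
      ddet_scale_rows[of _ "\<lambda>i j. M i j t a" "\<lambda>i. exp (- 2 * t m) * real i"]
      tauYY_def tau_def[symmetric] by (simp only: distrib_right) simp
qed

text \<open>
  The factor of the determinant exceeds the one in \<open>B2_tau\<close> by \<open>exp (- 2 * t m)\<close>, since the index
  of the last row has grown by one. The scalar term of \<open>B2\<close> compensates for this difference.
\<close>

lemma B2_tauX:
  assumes "admissible m r t a"
  shows "has_D m r (w_B2 m t a) t a (tauX (Suc k))
    (((\<Sum>q<Suc k. exp (- 2 * t m) * real q) + exp (- 2 * t m) + (\<Sum>q<Suc k. \<beta> t + real q)) * tauX (Suc k) t a
      - 2 * tauXYY k t a)"
proof -
  have "has_D m r (w_B2 m t a) t a (tauX (Suc k)) (ddet (Suc k) (\<lambda>i j. M (bump k i) j t a) (\<lambda>i j.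
          (exp (- 2 * t m) * real (bump k i)) * M (bump k i) j t a + (\<beta> t + real j) * M (bump k i) j t a
             + (- 2) * M (bump k i) (j + 2) t a))"
    unfolding tauX_Suc[abs_def] by (intro has_D_fdet B2_moment assms)
  thus ?thesis
    unfolding ddet_add ddet_scale[of _ _ "-2"]
      ddet_scale_cols[of _ _ "\<lambda>j. \<beta> t + real j"]
      ddet_scale_rows[of _ "\<lambda>i j. M (bump k i) j t a" "\<lambda>i. exp (- 2 * t m) * real (bump k i)"]
      tauXYY_def tauX_Suc[symmetric] sum_bump by (simp only: distrib_right) simp
qed

lemma A2_tau:
  assumes "admissible m r t a"
  shows "has_D m r (w_A2 t a) t a (tau (Suc k))
    (((\<Sum>q<Suc k. \<alpha> t + real q) + (\<Sum>q<Suc k. exp (- 2 * t m) * real q)) * tau (Suc k) t a - 2 * tauXX k t a)"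
proof -
  have "has_D m r (w_A2 t a) t a (tau (Suc k)) (ddet (Suc k) (\<lambda>i j. M i j t a) (\<lambda>i j.
          (\<alpha> t + real i) * M i j t a + (exp (- 2 * t m) * real j) * M i j t a + (- 2) * M (i + 2) j t a))"
    unfolding tau_def[abs_def] by (intro has_D_fdet A2_moment assms)
  thus ?thesis
    unfolding ddet_add ddet_scale[of _ _ "-2"]
      ddet_scale_rows[of _ "\<lambda>i j. M i j t a" "\<lambda>i. \<alpha> t + real i"]
      ddet_scale_cols[of _ _ "\<lambda>j. exp (- 2 * t m) * real j"]
      tauXX_def tau_def[symmetric] by (simp only: distrib_right) simp
qed

lemma A2_tauY:
  assumes "admissible m r t a"
  shows "has_D m r (w_A2 t a) t a (tauY (Suc k))
    (((\<Sum>q<Suc k. \<alpha> t + real q) + ((\<Sum>q<Suc k. exp (- 2 * t m) * real q) + exp (- 2 * t m))) * tauY (Suc k) t a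
      - 2 * tauXXY k t a)"
proof -
  have "has_D m r (w_A2 t a) t a (tauY (Suc k)) (ddet (Suc k) (\<lambda>i j. M i (bump k j) t a) (\<lambda>i j.
          (\<alpha> t + real i) * M i (bump k j) t a + (exp (- 2 * t m) * real (bump k j)) * M i (bump k j) t a
             + (- 2) * M (i + 2) (bump k j) t a))"
    unfolding tauY_Suc[abs_def] by (intro has_D_fdet A2_moment assms)
  thus ?thesis
    unfolding ddet_add ddet_scale[of _ _ "-2"]
      ddet_scale_rows[of _ "\<lambda>i j. M i (bump k j) t a" "\<lambda>i. \<alpha> t + real i"]
      ddet_scale_cols[of _ _ "\<lambda>j. exp (- 2 * t m) * real (bump k j)"]
      tauXXY_def tauY_Suc[symmetric] sum_bump by (simp only: distrib_right) simp
qed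

lemma toda_XY:
  "tau (Suc k) t a * tauXY k t a - tauX (Suc k) t a * tauY (Suc k) t a = tau (Suc (Suc k)) t a * tau k t a"
  unfolding tau_def tauXY_def tauX_Suc tauY_Suc by (rule toda_first)

lemma toda_XYY:
  "tau (Suc k) t a * tauXYY k t a - tauX (Suc k) t a * tauYY k t a =
     tau k t a * tauY (Suc (Suc k)) t a - tau (Suc (Suc k)) t a * tauY k t a"
  unfolding tau_def tauXYY_def tauYY_def tauX_Suc tauY_def
  by (rule toda_second[of k "\<lambda>i j. M i j t a"])

lemma toda_XXY:
  "tau (Suc k) t a * tauXXY k t a - tauY (Suc k) t a * tauXX k t a =
     tau k t a * tauX (Suc (Suc k)) t a - tau (Suc (Suc k)) t a * tauX k t a"
  using toda_second[of k "\<lambda>i j. M j i t a"]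
  unfolding tau_def tauXXY_def tauXX_def tauY_Suc tauX_def
    fdet_transpose[of _ "\<lambda>i j. M i j t a"] fdet_transpose[of _ "\<lambda>i j. M i (bump k j) t a"]
    ddet_transpose[of _ "\<lambda>i j. M i j t a" "\<lambda>i j. M (i + 1) j t a"]
    ddet_transpose[of _ "\<lambda>i j. M i j t a" "\<lambda>i j. M (i + 2) j t a"]
    ddet_transpose[of _ "\<lambda>i j. M i (bump k j) t a" "\<lambda>i j. M (i + 2) (bump k j) t a"] .

lemma tau_gt_0: "admissible m r t a \<Longrightarrow> tau k t a > 0"
  unfolding tau_def by (rule tau_pos)

text \<open>
  The common value of \<open>A1 (Y / \<tau>)\<close> and \<open>B1 (X / \<tau>)\<close>: up to the factor \<open>- 1/2\<close> it is the mixed second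
  derivative of \<open>ln (\<tau> k)\<close>. For \<open>k = 0\<close> the determinant is constant.
\<close>

definition hirota :: "nat \<Rightarrow> dyson_fun" where
  "hirota k t a = (if k = 0 then 0 else
     real k * exp (- t m) - 2 * (tau k t a * tauXY (k - 1) t a - tauX k t a * tauY k t a) / (tau k t a)\<^sup>2)"

lemma A1_tauY_quotient:
  assumes "admissible m r t a"
  shows "has_D m r (w_A1 t) t a (\<lambda>t a. tauY k t a / tau k t a) (hirota k t a)"
proof (cases k)
  case 0
  thus ?thesis by (simp add: tauY_def ddet_rows hirota_def has_D_const)
next
  case (Suc k')
  have "tau k t a \<noteq> 0" using tau_gt_0[OF assms, of k] by simp
  thus ?thesis
    using has_D_divide[OF A1_tauY[OF assms, of k'] A1_tau[OF assms, of k], folded Suc]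
    by (simp add: hirota_def Suc field_simps power2_eq_square)
qed

lemma B1_tauX_quotient:
  assumes "admissible m r t a"
  shows "has_D m r (w_B1 m t) t a (\<lambda>t a. tauX k t a / tau k t a) (hirota k t a)"
proof (cases k)
  case 0
  thus ?thesis by (simp add: tauX_def ddet_rows hirota_def has_D_const)
next
  case (Suc k')
  have "tau k t a \<noteq> 0" using tau_gt_0[OF assms, of k] by simp
  thus ?thesis
    using has_D_divide[OF B1_tauX[OF assms, of k'] B1_tau[OF assms, of k], folded Suc]
    by (simp add: hirota_def Suc field_simps power2_eq_square)
qed

text \<open>
  By \<open>toda_XY\<close>, \<open>toda_XYY\<close> and \<open>toda_XXY\<close> the two fractions are differences of logarithmic derivatives
  of \<open>tau (n + 1)\<close> and \<open>tau (n - 1)\<close>, in the direction \<open>B1\<close> on the left and \<open>A1\<close> on the right. The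
  outer operators then yield the same mixed derivative on both sides.
\<close>

lemma nonlinear_pde:
  assumes log: "\<And>t a. admissible m r t a \<Longrightarrow> logP t a = ln (K t) + ln (tau n t a)"
    and n: "n \<ge> 1" and adm: "admissible m r t a"
  shows "A1 m r (\<lambda>t a. B2 m r (A1 m r logP) t a
                     / (B1 m r (A1 m r logP) t a + 2 * real n * exp (- t m))) t a
       = B1 m r (\<lambda>t a. A2 m r (B1 m r logP) t a
                     / (A1 m r (B1 m r logP) t a + 2 * real n * exp (- t m))) t a"
proof -
  obtain k where n: "n = Suc k" using n by (cases n) auto
  have A1_log: "A1 m r logP t a = (- 2) * (tauX n t a / tau n t a)" if "admissible m r t a" for t a
  proof (rule has_D_imp_A1)
    have "has_D m r (w_A1 t) t a (\<lambda>t a. ln (K t) + ln (tau n t a)) (0 + - 2 * tauX n t a / tau n t a)"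
      using that tau_gt_0[OF that, of n]
      by (intro has_D_add has_D_ln has_D_time_coefficient A1_tau) (auto simp: w_A1_def)
    from has_D_cong[OF this that log[symmetric]]
    show "has_D m r (w_A1 t) t a logP ((- 2) * (tauX n t a / tau n t a))" by simp
  qed
  have B1_log: "B1 m r logP t a = (- 2) * (tauY n t a / tau n t a)" if "admissible m r t a" for t a
  proof (rule has_D_imp_B1)
    have "has_D m r (w_B1 m t) t a (\<lambda>t a. ln (K t) + ln (tau n t a)) (0 + - 2 * tauY n t a / tau n t a)"
      using that tau_gt_0[OF that, of n]
      by (intro has_D_add has_D_ln has_D_time_coefficient B1_tau) (auto simp: w_B1_def)
    from has_D_cong[OF this that log[symmetric]]
    show "has_D m r (w_B1 m t) t a logP ((- 2) * (tauY n t a / tau n t a))" by simp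
  qed
  \<comment> \<open>Both mixed derivatives are \<open>- 2 * hirota\<close>, so this computes both denominators.\<close>
  have den: "- 2 * hirota n t a + 2 * real n * exp (- t m) =
               4 * (tau (Suc n) t a * tau k t a) / (tau n t a)\<^sup>2" for t a
    using toda_XY[of k t a] by (simp add: hirota_def n algebra_simps)
  have B1A1: "B1 m r (A1 m r logP) t a = - 2 * hirota n t a" if "admissible m r t a" for t a
    by (rule has_D_imp_B1, rule has_D_cong[OF has_D_cmult[OF B1_tauX_quotient[OF that]] that])
       (simp add: A1_log)
  have A1B1: "A1 m r (B1 m r logP) t a = - 2 * hirota n t a" if "admissible m r t a" for t a
    by (rule has_D_imp_A1, rule has_D_cong[OF has_D_cmult[OF A1_tauY_quotient[OF that]] that])
       (simp add: B1_log)
  have B2A1: "B2 m r (A1 m r logP) t a =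
      4 * (tau k t a * tauY (Suc n) t a - tau (Suc n) t a * tauY k t a) / (tau n t a)\<^sup>2"
    if "admissible m r t a" for t a
  proof -
    have nz: "tau n t a \<noteq> 0" using tau_gt_0[OF that, of n] by simp
    let ?e = "exp (- 2 * t m)"
    \<comment> \<open>The scalars \<open>?s\<close> and \<open>?u\<close> cancel in the derivative of the quotient. What is left of them, \<open>?e\<close>,
      cancels against the scalar term of \<open>B2\<close>.\<close>
    let ?s = "(\<Sum>q<n. ?e * real q)" and ?u = "(\<Sum>q<n. \<beta> t + real q)"
    let ?d = "(((?s + ?e + ?u) * tauX n t a - 2 * tauXYY k t a) * tau n t a
                - tauX n t a * ((?s + ?u) * tau n t a - 2 * tauYY k t a)) / (tau n t a)\<^sup>2"
    have "has_D m r (w_B2 m t a) t a (\<lambda>t a. (- 2) * (tauX n t a / tau n t a)) ((- 2) * ?d)"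
      unfolding n using nz n
      by (intro has_D_cmult has_D_divide B2_tauX B2_tau that) auto
    hence "has_D m r (w_B2 m t a) t a (A1 m r logP) ((- 2) * ?d)"
      by (rule has_D_cong[OF _ that]) (simp add: A1_log)
    hence "B2 m r (A1 m r logP) t a = (- 2) * ?d - ?e * ((- 2) * (tauX n t a / tau n t a))"
      using has_D_imp_B2 A1_log[OF that] by metis
    also have "?d = ?e * (tauX n t a / tau n t a)
        - 2 * (tau n t a * tauXYY k t a - tauX n t a * tauYY k t a) / (tau n t a)\<^sup>2"
      using nz by (simp add: field_simps power2_eq_square)
    finally show ?thesis
      using toda_XYY[of k t a] by (simp add: n)
  qed
  have A2B1: "A2 m r (B1 m r logP) t a =
      4 * (tau k t a * tauX (Suc n) t a - tau (Suc n) t a * tauX k t a) / (tau n t a)\<^sup>2"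
    if "admissible m r t a" for t a
  proof -
    have nz: "tau n t a \<noteq> 0" using tau_gt_0[OF that, of n] by simp
    let ?e = "exp (- 2 * t m)"
    let ?s = "(\<Sum>q<n. ?e * real q)" and ?u = "(\<Sum>q<n. \<alpha> t + real q)"
    let ?d = "(((?u + (?s + ?e)) * tauY n t a - 2 * tauXXY k t a) * tau n t a
                - tauY n t a * ((?u + ?s) * tau n t a - 2 * tauXX k t a)) / (tau n t a)\<^sup>2"
    have "has_D m r (w_A2 t a) t a (\<lambda>t a. (- 2) * (tauY n t a / tau n t a)) ((- 2) * ?d)"
      unfolding n using nz n
      by (intro has_D_cmult has_D_divide A2_tauY A2_tau that) auto
    hence "has_D m r (w_A2 t a) t a (B1 m r logP) ((- 2) * ?d)"
      by (rule has_D_cong[OF _ that]) (simp add: B1_log)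
    hence "A2 m r (B1 m r logP) t a = (- 2) * ?d - ?e * ((- 2) * (tauY n t a / tau n t a))"
      using has_D_imp_A2 B1_log[OF that] by metis
    also have "?d = ?e * (tauY n t a / tau n t a)
        - 2 * (tau n t a * tauXXY k t a - tauY n t a * tauXX k t a) / (tau n t a)\<^sup>2"
      using nz by (simp add: field_simps power2_eq_square)
    finally show ?thesis
      using toda_XXY[of k t a] by (simp add: n)
  qed
  have quotient: "4 * (p * y - q * z) / s\<^sup>2 / (4 * (q * p) / s\<^sup>2) = y / q - z / p"
    if "s > 0" "p > 0" "q > 0" for p q s y z :: real
    using that by (simp add: field_simps)
  have L: "B2 m r (A1 m r logP) t a / (B1 m r (A1 m r logP) t a + 2 * real n * exp (- t m)) =
           tauY (Suc n) t a / tau (Suc n) t a - tauY k t a / tau k t a"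
    if "admissible m r t a" for t a
    unfolding B1A1[OF that] den B2A1[OF that] by (intro quotient tau_gt_0 that)
  have R: "A2 m r (B1 m r logP) t a / (A1 m r (B1 m r logP) t a + 2 * real n * exp (- t m)) =
           tauX (Suc n) t a / tau (Suc n) t a - tauX k t a / tau k t a"
    if "admissible m r t a" for t a
    unfolding A1B1[OF that] den A2B1[OF that] by (intro quotient tau_gt_0 that)
  have "A1 m r (\<lambda>t a. B2 m r (A1 m r logP) t a
                     / (B1 m r (A1 m r logP) t a + 2 * real n * exp (- t m))) t a =
        hirota (Suc n) t a - hirota k t a"
    by (rule has_D_imp_A1,
        rule has_D_cong[OF has_D_diff[OF A1_tauY_quotient[OF adm] A1_tauY_quotient[OF adm]] adm])
       (rule L[symmetric])
  moreover have "B1 m r (\<lambda>t a. A2 m r (B1 m r logP) t a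
                     / (A1 m r (B1 m r logP) t a + 2 * real n * exp (- t m))) t a =
        hirota (Suc n) t a - hirota k t a"
    by (rule has_D_imp_B1,
        rule has_D_cong[OF has_D_diff[OF B1_tauX_quotient[OF adm] B1_tauX_quotient[OF adm]] adm])
       (rule R[symmetric])
  ultimately show ?thesis by simp
qed

end

section \<open>Total positivity of the exponential kernel\<close>

lemma fdet_last_col:
  assumes "\<And>i. i < n \<Longrightarrow> A i n = 0"
  shows "fdet (Suc n) A = A n n * fdet n A"
proof -
  let ?A = "Matrix.mat (Suc n) (Suc n) (\<lambda>(i, j). A i j)"
  have "mat_delete ?A n n = Matrix.mat n n (\<lambda>(i, j). A i j)"
    by (intro eq_matI) (auto simp: mat_delete_def)
  hence cof: "cofactor ?A n n = fdet n A" by (simp add: cofactor_def fdet_def)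
  have "fdet (Suc n) A = (\<Sum>i<Suc n. ?A $$ (i, n) * cofactor ?A i n)"
    unfolding fdet_def by (intro laplace_expansion_column) auto
  also have "\<dots> = A n n * fdet n A"
    using assms by (simp add: cof)
  finally show ?thesis .
qed

lemma fdet_col_linear:
  assumes q: "q < n"
  shows "fdet n (\<lambda>i. (A i)(q := (\<Sum>c\<in>C. w c * B c i))) = (\<Sum>c\<in>C. w c * fdet n (\<lambda>i. (A i)(q := B c i)))"
proof -
  have split: "fdet n (\<lambda>i. (A i)(q := b i)) = ddet n (\<lambda>i. (A i)(q := 0)) (\<lambda>i j. if j = q then b i else 0)" for b
  proof -
    have "fdet n (\<lambda>i. ((A i)(q := 0))(j := if j = q then b i else 0)) = 0" if "j < n" "j \<noteq> q" for j
    proof -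
      show ?thesis
        using that q by (intro fdet_identical_cols[of q n j]) auto
    qed
    hence "ddet n (\<lambda>i. (A i)(q := 0)) (\<lambda>i j. if j = q then b i else 0) =
           (\<Sum>j<n. if j = q then fdet n (\<lambda>i. (A i)(q := b i)) else 0)"
      unfolding ddet_cols by (intro sum.cong) auto
    thus ?thesis using q by simp
  qed
  have "ddet n (\<lambda>i. (A i)(q := 0)) (\<lambda>i j. if j = q then (\<Sum>c\<in>C. w c * B c i) else 0) =
        ddet n (\<lambda>i. (A i)(q := 0)) (\<lambda>i j. \<Sum>c\<in>C. w c * (if j = q then B c i else 0))"
    by (intro ddet_cong) auto
  thus ?thesis unfolding split ddet_linear .
qed

lemma monic_prod_expansion:
  fixes x :: "nat \<Rightarrow> real"
  shows "\<exists>c. \<forall>y. (\<Prod>k<n. y - x k) = y ^ n + (\<Sum>j<n. c j * y ^ j)"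
proof -
  define p where "p = (\<Prod>k<n. [:- x k, 1:])"
  have deg: "degree p = n"
    unfolding p_def by (subst degree_prod_eq_sum_degree) auto
  have "lead_coeff p = 1" unfolding p_def by (simp add: lead_coeff_prod)
  hence lc: "coeff p n = 1" by (simp add: deg)
  have "(\<Prod>k<n. y - x k) = y ^ n + (\<Sum>j<n. coeff p j * y ^ j)" for y
  proof -
    have "(\<Prod>k<n. y - x k) = poly p y" by (simp add: p_def poly_prod)
    also have "\<dots> = (\<Sum>j\<le>n. coeff p j * y ^ j)" by (simp add: poly_altdef deg)
    also have "{..n} = insert n {..<n}" by auto
    finally show ?thesis by (simp add: lc)
  qed
  thus ?thesis by blast
qed

text \<open>
  Column operations turn the last column into the values of the monic polynomial with roots
  \<open>x 0, \<dots>, x (n - 1)\<close>, which vanish in all rows but the last.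
\<close>

lemma fdet_vandermonde:
  fixes x :: "nat \<Rightarrow> real"
  shows "fdet n (\<lambda>i j. x i ^ j) = (\<Prod>j<n. \<Prod>i<j. x j - x i)"
proof (induction n)
  case (Suc n)
  obtain c where c: "\<And>y. (\<Prod>k<n. y - x k) = y ^ n + (\<Sum>j<n. c j * y ^ j)"
    using monic_prod_expansion by blast
  define c' where "c' = (\<lambda>j. if j = n then 1 else c j)"
  have "(\<Prod>k<n. x i - x k) = (\<Sum>j<Suc n. c' j * x i ^ j)" for i
    by (simp add: c c'_def)
  hence "fdet (Suc n) (\<lambda>i. ((^) (x i))(n := (\<Prod>k<n. x i - x k))) =
         (\<Sum>j<Suc n. c' j * fdet (Suc n) (\<lambda>i. ((^) (x i))(n := x i ^ j)))"
    using fdet_col_linear[of n "Suc n" "\<lambda>i. (^) (x i)" c' "\<lambda>j i. x i ^ j" "{..<Suc n}"] by simp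
  also have "fdet (Suc n) (\<lambda>i. ((^) (x i))(n := x i ^ j)) = 0" if "j < n" for j
    using that by (intro fdet_identical_cols[of j _ n]) auto
  hence "(\<Sum>j<Suc n. c' j * fdet (Suc n) (\<lambda>i. ((^) (x i))(n := x i ^ j))) =
         fdet (Suc n) (\<lambda>i j. x i ^ j)"
    by (simp add: c'_def)
  finally have "fdet (Suc n) (\<lambda>i j. x i ^ j) = fdet (Suc n) (\<lambda>i. ((^) (x i))(n := (\<Prod>k<n. x i - x k)))" ..
  also have "\<dots> = (\<Prod>k<n. x n - x k) * fdet n (\<lambda>i. ((^) (x i))(n := (\<Prod>k<n. x i - x k)))"
    by (subst fdet_last_col) auto
  also have "fdet n (\<lambda>i. ((^) (x i))(n := (\<Prod>k<n. x i - x k))) = fdet n (\<lambda>i j. x i ^ j)"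
    by (intro fdet_cong) auto
  finally show ?case by (simp add: Suc.IH)
qed simp

text \<open>
  The factors \<open>x i - x j\<close>, \<open>i < j\<close>, of the product in \<open>vandermonde\<close> have the opposite sign of those in
  the determinant. The sign cancels from a product of two.
\<close>

definition vsign :: "nat \<Rightarrow> real" where
  "vsign n = (\<Prod>j<n. \<Prod>i<j. -1)"

lemma vsign_square: "vsign n * vsign n = 1"
  unfolding vsign_def prod.distrib[symmetric] by simp

lemma vandermonde_eq_fdet: "vandermonde n x = vsign n * fdet n (\<lambda>i j. x i ^ j)"
  unfolding vandermonde_def vsign_def fdet_vandermonde prod.distrib[symmetric]
  by (intro prod.cong refl) simp

lemma vandermonde_nonzero:
  assumes "inj_on x {..<n}"
  shows "vandermonde n x \<noteq> 0"
proof -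
  have "x i \<noteq> x j" if "j < n" "i < j" for i j
    using inj_onD[OF assms, of i j] that by auto
  thus ?thesis by (auto simp: vandermonde_def)
qed

text \<open>
  The strict bound \<open>x < y\<close> in the induction keeps the new zero, which lies to the right of all
  of \<open>S\<close>, apart from those found before.
\<close>

lemma rolle_card:
  fixes f f' :: "real \<Rightarrow> real"
  assumes "finite S" "\<And>x. x \<in> S \<Longrightarrow> f x = 0" and der: "\<And>x. (f has_real_derivative f' x) (at x)"
  obtains S' where "finite S'" "card S \<le> card S' + 1" "\<And>x. x \<in> S' \<Longrightarrow> f' x = 0"
proof -
  have "\<exists>S'. finite S' \<and> card S \<le> card S' + 1 \<and> (\<forall>x\<in>S'. f' x = 0 \<and> (\<exists>y\<in>S. x < y))"
    using assms(1,2)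
  proof (induction S rule: finite_linorder_max_induct)
    case empty
    show ?case by (intro exI[of _ "{}"]) auto
  next
    case (insert b S)
    show ?case
    proof (cases "S = {}")
      case True
      thus ?thesis by (intro exI[of _ "{}"]) auto
    next
      case False
      from insert obtain S' where S': "finite S'" "card S \<le> card S' + 1" "\<forall>x\<in>S'. f' x = 0 \<and> (\<exists>y\<in>S. x < y)"
        by auto
      define a where "a = Max S"
      have a: "a \<in> S" "a < b" "f a = f b"
        using False insert by (auto simp: a_def)
      have "continuous_on {a..b} f"
        by (intro continuous_at_imp_continuous_on ballI DERIV_isCont[OF der])
      moreover have "f differentiable (at x)" for x
        unfolding real_differentiable_def by (rule exI, rule der)
      ultimately obtain z where z: "a < z" "z < b" "DERIV f z :> 0"
        using Rolle[OF a(2,3)] by auto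
      have "f' z = 0" by (rule DERIV_unique[OF der z(3)])
      moreover have "z \<notin> S'"
      proof
        assume "z \<in> S'"
        then obtain y where "y \<in> S" "z < y" using S'(3) by blast
        with Max_ge[OF insert(1) this(1)] z(1) show False unfolding a_def by simp
      qed
      moreover have "b \<notin> S" using insert by auto
      ultimately show ?thesis
        using S' z insert(1) by (intro exI[of _ "insert z S'"]) auto
    qed
  qed
  thus ?thesis using that by blast
qed

text \<open>
  Descartes' argument: after division by one of its exponentials, a derivative has one term
  less, and by Rolle's theorem it loses at most one zero.
\<close>

lemma exp_sum_zeros:
  fixes c y :: "nat \<Rightarrow> real"
  assumes "finite J" "inj_on y J" "k \<in> J" "c k \<noteq> 0" "finite S"
    and "\<And>x. x \<in> S \<Longrightarrow> (\<Sum>j\<in>J. c j * exp (y j * x)) = 0"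
  shows "card S < card J"
  using assms
proof (induction "card J" arbitrary: J c k S y rule: less_induct)
  case less
  show ?case
  proof (cases "\<exists>i\<in>J. i \<noteq> k \<and> c i \<noteq> 0")
    case False
    have "(\<Sum>j\<in>J. c j * exp (y j * x)) = c k * exp (y k * x)" for x
      using False less.prems(1,3) by (subst sum.remove[of _ k]) (auto intro!: sum.neutral)
    hence "S = {}" using less.prems by auto
    thus ?thesis using less.prems by (auto simp: card_gt_0_iff)
  next
    case True
    then obtain i where i: "i \<in> J" "i \<noteq> k" "c i \<noteq> 0" by blast
    \<comment> \<open>The sum divided by \<open>exp (y k * x)\<close>: its term of index \<open>k\<close> is constant.\<close>
    define f where "f = (\<lambda>x. \<Sum>j\<in>J. c j * exp ((y j - y k) * x))"
    define f' where "f' = (\<lambda>x. \<Sum>j\<in>J - {k}. (c j * (y j - y k)) * exp ((y j - y k) * x))"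
    have f: "f x = exp (- y k * x) * (\<Sum>j\<in>J. c j * exp (y j * x))" for x
    proof -
      have "exp ((y j - y k) * x) = exp (- y k * x) * exp (y j * x)" for j
        unfolding exp_add[symmetric] by (simp add: algebra_simps)
      thus ?thesis by (simp add: f_def sum_distrib_left mult.left_commute)
    qed
    have "(f has_real_derivative (\<Sum>j\<in>J. (c j * (y j - y k)) * exp ((y j - y k) * x))) (at x)" for x
      unfolding f_def by (auto intro!: derivative_eq_intros sum.cong)
    moreover have "(\<Sum>j\<in>J. (c j * (y j - y k)) * exp ((y j - y k) * x)) = f' x" for x
      unfolding f'_def using less.prems by (subst sum.remove[of _ k]) auto
    ultimately have der: "(f has_real_derivative f' x) (at x)" for x by simp
    obtain S' where S': "finite S'" "card S \<le> card S' + 1" "\<And>x. x \<in> S' \<Longrightarrow> f' x = 0"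
      by (rule rolle_card[OF less.prems(5) _ der]) (use less.prems f in auto)
    have "card S' < card (J - {k})"
    proof (rule less.hyps)
      show "card (J - {k}) < card J" using less.prems(1,3) by (rule card_Diff1_less)
      show "inj_on (\<lambda>j. y j - y k) (J - {k})"
        using less.prems(2) by (auto simp: inj_on_def)
      show "i \<in> J - {k}" using i by auto
      show "c i * (y i - y k) \<noteq> 0"
        using i less.prems inj_onD[OF less.prems(2), of i k] by auto
    qed (use less.prems S' in \<open>auto simp: f'_def\<close>)
    thus ?thesis using S' less.prems by (simp add: card_Diff_singleton)
  qed
qed

text \<open>
  A vector in the kernel would be an exponential sum with \<open>n\<close> terms and \<open>n\<close> zeros.
\<close>

lemma fdet_exp_nonzero:
  fixes x y :: "nat \<Rightarrow> real"
  assumes "inj_on x {..<n}" "inj_on y {..<n}"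
  shows "fdet n (\<lambda>i j. exp (x i * y j)) \<noteq> 0"
proof
  let ?A = "Matrix.mat n n (\<lambda>(i, j). exp (x i * y j))"
  assume "fdet n (\<lambda>i j. exp (x i * y j)) = 0"
  then obtain v where v: "v \<in> carrier_vec n" "v \<noteq> 0\<^sub>v n" "?A *\<^sub>v v = 0\<^sub>v n"
    unfolding fdet_def using det_0_iff_vec_prod_zero_field[of ?A n] by auto
  then obtain k where k: "k < n" "vec_index v k \<noteq> 0"
    by (metis carrier_vecD eq_vecI index_zero_vec)
  have "card (x ` {..<n}) < card {..<n}"
  proof (rule exp_sum_zeros[OF _ assms(2), of k "vec_index v"])
    fix z assume "z \<in> x ` {..<n}"
    then obtain i where i: "i < n" "z = x i" by auto
    have "vec_index (?A *\<^sub>v v) i = 0" unfolding v(3) using i by simp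
    also have "vec_index (?A *\<^sub>v v) i = (\<Sum>j<n. vec_index v j * exp (y j * z))"
      using i v(1) by (auto simp: scalar_prod_def lessThan_atLeast0 mult_ac intro!: sum.cong)
    finally show "(\<Sum>j<n. vec_index v j * exp (y j * z)) = 0" .
  qed (use k in auto)
  thus False using card_image[OF assms(1)] by simp
qed

lemma same_sign_of_nonvanishing:
  fixes f :: "real \<Rightarrow> real"
  assumes "continuous_on {0..1} f" "\<And>s. 0 \<le> s \<Longrightarrow> s \<le> 1 \<Longrightarrow> f s \<noteq> 0"
  shows "f 0 * f 1 > 0"
proof -
  have "\<not> (f 0 \<le> 0 \<and> 0 \<le> f 1)"
    using IVT'[of f 0 0 1] assms by auto
  moreover have "\<not> (f 1 \<le> 0 \<and> 0 \<le> f 0)"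
    using IVT2'[of f 1 0 0] assms by auto
  ultimately show ?thesis by (auto simp: zero_less_mult_iff)
qed

lemma fdet_power_permute:
  fixes z :: "nat \<Rightarrow> real"
  assumes "p permutes {..<n}"
  shows "fdet n (\<lambda>i j. z j ^ p i) = of_int (sign p) * fdet n (\<lambda>i j. z i ^ j)"
  using fdet_permute_rows[OF assms, of "\<lambda>i j. z j ^ i"] fdet_transpose[of n "\<lambda>i j. z i ^ j"] by simp

text \<open>
  The rank of \<open>x i\<close> among the values of \<open>x\<close> defines a permutation that is ordered like \<open>x\<close>.
\<close>

lemma rank_permutes:
  fixes x :: "nat \<Rightarrow> real"
  assumes "inj_on x {..<n}"
  defines "p \<equiv> (\<lambda>i. if i < n then card {j. j < n \<and> x j < x i} else i)"
  shows "p permutes {..<n}" "\<And>i j. i < n \<Longrightarrow> j < n \<Longrightarrow> x i < x j \<Longrightarrow> p i < p j"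
proof -
  show mono: "p i < p j" if "i < n" "j < n" "x i < x j" for i j
  proof -
    have "{k. k < n \<and> x k < x i} \<subset> {k. k < n \<and> x k < x j}"
      using that by auto
    thus ?thesis using that by (auto simp: p_def intro!: psubset_card_mono)
  qed
  have "p i < n" if "i < n" for i
  proof -
    have "{k. k < n \<and> x k < x i} \<subset> {..<n}" using that by auto
    from psubset_card_mono[OF _ this] show ?thesis using that by (simp add: p_def)
  qed
  moreover have "inj_on p {..<n}"
  proof (rule inj_onI)
    fix i j assume ij: "i \<in> {..<n}" "j \<in> {..<n}" "p i = p j"
    hence "\<not> x i < x j" "\<not> x j < x i" using mono[of i j] mono[of j i] by auto
    thus "i = j" using inj_onD[OF assms(1), of i j] ij by auto
  qed
  ultimately have "bij_betw p {..<n} {..<n}"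
    unfolding bij_betw_def by (metis endo_inj_surj finite_lessThan image_subsetI lessThan_iff)
  thus "p permutes {..<n}" by (intro bij_imp_permutes) (auto simp: p_def)
qed

lemma vandermonde_mult_pos:
  assumes "\<And>i j. i < j \<Longrightarrow> j < n \<Longrightarrow> (x i - x j) * (y i - y j) > 0"
  shows "vandermonde n x * vandermonde n y > 0"
  unfolding vandermonde_def prod.distrib[symmetric]
  using assms by (intro prod_pos) auto

text \<open>
  The signs of the determinant and of the Vandermonde product do not change while the points
  \<open>x i\<close> move without collision. They can be moved to their ranks \<open>p i\<close>, where the determinant
  becomes a Vandermonde determinant in \<open>exp (y j)\<close> up to the sign of \<open>p\<close>.
\<close>

lemma fdet_exp_sign:
  fixes x y :: "nat \<Rightarrow> real"
  assumes x: "inj_on x {..<n}" and y: "inj_on y {..<n}"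
  shows "fdet n (\<lambda>i j. exp (x i * y j)) * vandermonde n x * vandermonde n y > 0"
proof -
  define p where "p = (\<lambda>i. if i < n then card {j. j < n \<and> x j < x i} else i)"
  have p: "p permutes {..<n}" "\<And>i j. i < n \<Longrightarrow> j < n \<Longrightarrow> x i < x j \<Longrightarrow> p i < p j"
    using rank_permutes[OF x] unfolding p_def by blast+
  \<comment> \<open>The path from \<open>x\<close> to its ranks keeps the order of the points.\<close>
  define u where "u = (\<lambda>s i. (1 - s) * x i + s * real (p i))"
  define f where "f = (\<lambda>s. fdet n (\<lambda>i j. exp (u s i * y j)) * vandermonde n (u s))"
  have less: "u s i < u s j" if "0 \<le> s" "s \<le> 1" "i < n" "j < n" "x i < x j" for s i j
  proof (cases "s = 1")
    case True
    thus ?thesis using p(2)[OF that(3-5)] by (simp add: u_def)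
  next
    case False
    hence "(1 - s) * x i < (1 - s) * x j" using that by simp
    moreover have "s * real (p i) \<le> s * real (p j)"
      using p(2)[OF that(3-5)] that by (intro mult_left_mono) auto
    ultimately show ?thesis by (simp add: u_def)
  qed
  have inj: "inj_on (u s) {..<n}" if "0 \<le> s" "s \<le> 1" for s
  proof (rule inj_onI)
    fix i j assume ij: "i \<in> {..<n}" "j \<in> {..<n}" "u s i = u s j"
    hence "\<not> x i < x j" "\<not> x j < x i" using less[OF that, of i j] less[OF that, of j i] by auto
    thus "i = j" using inj_onD[OF x, of i j] ij by auto
  qed
  have "continuous_on {0..1} f"
    unfolding f_def fdet_leibniz vandermonde_def u_def by (intro continuous_intros)
  hence pos: "f 0 * f 1 > 0"
    using fdet_exp_nonzero[OF inj y] vandermonde_nonzero[OF inj]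
    by (intro same_sign_of_nonvanishing) (auto simp: f_def)
  define z where "z = (\<lambda>j. exp (y j))"
  have "fdet n (\<lambda>i j. exp (u 1 i * y j)) = fdet n (\<lambda>i j. z j ^ p i)"
    by (simp add: u_def z_def exp_of_nat_mult)
  also have "\<dots> = of_int (sign p) * fdet n (\<lambda>i j. z i ^ j)"
    by (rule fdet_power_permute[OF p(1)])
  also have "fdet n (\<lambda>i j. z i ^ j) = vsign n * vandermonde n z"
    using vsign_square[of n] by (simp add: vandermonde_eq_fdet)
  finally have 1: "fdet n (\<lambda>i j. exp (u 1 i * y j)) = of_int (sign p) * (vsign n * vandermonde n z)" .
  have 2: "vandermonde n (u 1) = of_int (sign p) * vandermonde n real"
    using fdet_permute_rows[OF p(1), of "\<lambda>i j. real i ^ j"]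
    by (simp add: u_def vandermonde_eq_fdet)
  have "(of_int (sign p) * of_int (sign p) :: real) = 1"
    by (simp flip: of_int_mult)
  hence f1: "f 1 = (vsign n * vandermonde n real) * vandermonde n z"
    unfolding f_def 1 2 by (simp add: algebra_simps)
  have "vsign n * vandermonde n real = fdet n (\<lambda>i j. real i ^ j)"
    using vsign_square[of n] by (simp add: vandermonde_eq_fdet)
  also have "\<dots> > 0" unfolding fdet_vandermonde by (intro prod_pos) auto
  finally have "vsign n * vandermonde n real > 0" .
  moreover have "vandermonde n z * vandermonde n y > 0"
  proof (rule vandermonde_mult_pos)
    fix i j assume "i < j" "j < n"
    hence "y i \<noteq> y j" using inj_onD[OF y, of i j] by auto
    thus "(z i - z j) * (y i - y j) > 0"
      by (cases "y i < y j") (auto simp: z_def intro: mult_neg_neg mult_pos_pos)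
  qed
  ultimately have "(vsign n * vandermonde n real) * (vandermonde n z * vandermonde n y) > 0"
    by (rule mult_pos_pos)
  hence "f 1 * vandermonde n y > 0"
    unfolding f1 by (simp only: mult.assoc)
  with pos have "f 0 * vandermonde n y > 0"
    by (auto simp: zero_less_mult_iff)
  thus ?thesis by (simp add: f_def u_def)
qed

lemma fdet_exp_scaled_sign:
  fixes x y :: "nat \<Rightarrow> real"
  assumes "inj_on x {..<n}" "inj_on y {..<n}" "b > 0"
  shows "fdet n (\<lambda>i j. exp (b * x i * y j)) * vandermonde n x * vandermonde n y > 0"
proof -
  have "inj_on (\<lambda>i. b * x i) {..<n}"
    using assms by (auto simp: inj_on_def)
  from fdet_exp_sign[OF this assms(2)]
  have "fdet n (\<lambda>i j. exp (b * x i * y j)) * vandermonde n (\<lambda>i. b * x i) * vandermonde n y > 0" .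
  moreover have "vandermonde n (\<lambda>i. b * x i) = (\<Prod>j<n. \<Prod>i<j. b) * vandermonde n x"
    unfolding vandermonde_def prod.distrib[symmetric] by (simp add: right_diff_distrib)
  ultimately have "(\<Prod>j<n. \<Prod>i<j. b) *
      (fdet n (\<lambda>i j. exp (b * x i * y j)) * vandermonde n x * vandermonde n y) > 0"
    by (simp only: mult_ac)
  moreover have "(\<Prod>j<n. \<Prod>i<j. b) > 0" using assms by (intro prod_pos) auto
  ultimately show ?thesis by (rule zero_less_mult_pos)
qed

text \<open>
  Each interior level contributes its Vandermonde product twice.
\<close>

lemma chain_of_determinants_pos:
  fixes y :: "nat \<Rightarrow> nat \<Rightarrow> real"
  assumes "\<And>l. l \<le> m \<Longrightarrow> inj_on (y l) {..<n}" "\<And>l. 1 \<le> l \<Longrightarrow> l \<le> m \<Longrightarrow> b l > 0" "m \<ge> 1"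
  shows "vandermonde n (y 0) * vandermonde n (y m) *
         (\<Prod>l = 1..m. fdet n (\<lambda>i j. exp (b l * y (l - 1) i * y l j))) > 0"
  using assms(3,1,2)
proof (induction m rule: dec_induct)
  case base
  thus ?case using fdet_exp_scaled_sign[of "y 0" n "y 1" "b 1"] by (simp add: mult_ac)
next
  case (step m)
  define d where "d = fdet n (\<lambda>i j. exp (b (Suc m) * y m i * y (Suc m) j))"
  define P where "P = (\<Prod>l = 1..m. fdet n (\<lambda>i j. exp (b l * y (l - 1) i * y l j)))"
  have "vandermonde n (y 0) * vandermonde n (y m) * P > 0"
    unfolding P_def using step by auto
  moreover have "d * vandermonde n (y m) * vandermonde n (y (Suc m)) > 0"
    unfolding d_def using step.prems by (intro fdet_exp_scaled_sign) auto
  moreover have "(\<Prod>l = 1..Suc m. fdet n (\<lambda>i j. exp (b l * y (l - 1) i * y l j))) = P * d"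
    by (simp add: P_def d_def)
  moreover have "vandermonde n (y m) * vandermonde n (y m) > 0"
    using vandermonde_nonzero[of "y m" n] step by (simp add: zero_less_mult_iff linorder_neq_iff disj_commute)
  moreover have "v * w * P > 0 \<Longrightarrow> d * w * u > 0 \<Longrightarrow> w * w > 0 \<Longrightarrow> v * u * (P * d) > 0" for u v w :: real
  proof -
    assume "v * w * P > 0" "d * w * u > 0" "w * w > 0"
    hence "(v * w * P) * (d * w * u) > 0" by - (rule mult_pos_pos)
    hence "(w * w) * (v * u * (P * d)) > 0" by (simp only: mult_ac)
    thus "v * u * (P * d) > 0" using \<open>w * w > 0\<close> by (rule zero_less_mult_pos)
  qed
  ultimately show ?case by simp
qed

section \<open>Product Lebesgue measures\<close>

abbreviation lborel_on :: "'i set \<Rightarrow> ('i \<Rightarrow> real) measure" where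
  "lborel_on I \<equiv> Pi\<^sub>M I (\<lambda>_. lborel)"

lemma product_sigma_finite_lborel: "product_sigma_finite (\<lambda>_. lborel :: real measure)"
  by (simp add: product_sigma_finite_def sigma_finite_lborel)

lemma distr_PiM_lborel_reindex:
  assumes "finite I" "bij_betw f I K"
  shows "distr (lborel_on K) (lborel_on I) (\<lambda>\<omega>. \<lambda>i\<in>I. \<omega> (f i)) =
         lborel_on I"
proof -
  interpret product_sigma_finite "\<lambda>_. lborel :: real measure" by (rule product_sigma_finite_lborel)
  have K: "finite K" using assms bij_betw_finite by blast
  have fI: "f i \<in> K" if "i \<in> I" for i using assms that by (auto simp: bij_betw_def)
  have meas: "(\<lambda>\<omega>. \<lambda>i\<in>I. \<omega> (f i)) \<in> measurable (lborel_on K) (lborel_on I)"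
    by (intro measurable_restrict measurable_component_singleton fI)
  show ?thesis
  proof (rule PiM_eqI[OF assms(1)])
    fix A :: "'a \<Rightarrow> real set" assume A: "\<And>i. i \<in> I \<Longrightarrow> A i \<in> sets lborel"
    define B where "B = (\<lambda>k. A (the_inv_into I f k))"
    have inv: "the_inv_into I f (f i) = i" if "i \<in> I" for i
      using assms(2) that by (auto simp: bij_betw_def the_inv_into_f_f)
    have inv': "the_inv_into I f k \<in> I" "f (the_inv_into I f k) = k" if "k \<in> K" for k
      using assms(2) that f_the_inv_into_f[of f I k] the_inv_into_into[of f I k I]
      by (auto simp: bij_betw_def)
    have B: "B k \<in> sets lborel" if "k \<in> K" for k
      using A inv'[OF that] by (auto simp: B_def)
    have "(\<lambda>\<omega>. \<lambda>i\<in>I. \<omega> (f i)) -` Pi\<^sub>E I A \<inter> space (lborel_on K) = Pi\<^sub>E K B"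
    proof (intro equalityI subsetI)
      fix \<omega> assume "\<omega> \<in> (\<lambda>\<omega>. \<lambda>i\<in>I. \<omega> (f i)) -` Pi\<^sub>E I A \<inter> space (lborel_on K)"
      hence *: "\<And>i. i \<in> I \<Longrightarrow> \<omega> (f i) \<in> A i" "\<omega> \<in> extensional K"
        by (auto simp: space_PiM PiE_iff restrict_def)
      have "\<omega> k \<in> B k" if "k \<in> K" for k
        using *(1)[OF inv'(1)[OF that]] inv'(2)[OF that] by (simp add: B_def)
      with * show "\<omega> \<in> Pi\<^sub>E K B" by (auto simp: PiE_iff)
    next
      fix \<omega> assume \<omega>: "\<omega> \<in> Pi\<^sub>E K B"
      have "\<omega> (f i) \<in> A i" if "i \<in> I" for i
        using \<omega> fI[OF that] inv[OF that] by (auto simp: PiE_iff B_def)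
      with \<omega> show "\<omega> \<in> (\<lambda>\<omega>. \<lambda>i\<in>I. \<omega> (f i)) -` Pi\<^sub>E I A \<inter> space (lborel_on K)"
        by (auto simp: space_PiM PiE_iff)
    qed
    hence "emeasure (distr (lborel_on K) (lborel_on I) (\<lambda>\<omega>. \<lambda>i\<in>I. \<omega> (f i))) (Pi\<^sub>E I A) =
          emeasure (lborel_on K) (Pi\<^sub>E K B)"
      using A assms by (subst emeasure_distr[OF meas]) (auto intro!: sets_PiM_I_finite)
    also have "\<dots> = (\<Prod>k\<in>K. emeasure lborel (B k))"
      using B K by (intro emeasure_PiM) auto
    also have "\<dots> = (\<Prod>i\<in>I. emeasure lborel (A i))"
      using assms(2) by (subst prod.reindex_bij_betw[OF assms(2), symmetric]) (simp add: B_def inv)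
    finally show "emeasure (distr (lborel_on K) (lborel_on I) (\<lambda>\<omega>. \<lambda>i\<in>I. \<omega> (f i))) (Pi\<^sub>E I A)
      = (\<Prod>i\<in>I. emeasure lborel (A i))" .
  qed simp
qed

text \<open>
  A configuration indexed by levels and particles is the same as a family of one-particle
  paths.
\<close>

lemma distr_PiM_lborel_curry:
  assumes "finite I" "finite J"
  shows "distr (Pi\<^sub>M J (\<lambda>_. lborel_on I)) (lborel_on (I \<times> J))
           (\<lambda>y. \<lambda>p\<in>I \<times> J. y (snd p) (fst p)) = lborel_on (I \<times> J)"
proof -
  interpret A: product_sigma_finite "\<lambda>_. lborel :: real measure" by (rule product_sigma_finite_lborel)
  interpret I: finite_product_sigma_finite "\<lambda>_. lborel :: real measure" I by standard fact
  interpret B: product_sigma_finite "\<lambda>_. lborel_on I"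
    by standard
  let ?f = "\<lambda>y. \<lambda>p\<in>I \<times> J. y (snd p) (fst p)"
  let ?N = "Pi\<^sub>M J (\<lambda>_. lborel_on I)"
  have meas: "?f \<in> measurable ?N (lborel_on (I \<times> J))"
  proof (intro measurable_restrict)
    fix p assume "p \<in> I \<times> J"
    hence "fst p \<in> I" "snd p \<in> J" by auto
    thus "(\<lambda>y. y (snd p) (fst p)) \<in> measurable ?N lborel"
      by (intro measurable_compose[of "\<lambda>y. y (snd p)" ?N "lborel_on I" "\<lambda>z. z (fst p)"]
            measurable_component_singleton)
  qed
  show ?thesis
  proof (rule A.PiM_eqI)
    fix A :: "'a \<times> 'b \<Rightarrow> real set" assume A: "\<And>p. p \<in> I \<times> J \<Longrightarrow> A p \<in> sets lborel"
    have "?f -` Pi\<^sub>E (I \<times> J) A \<inter> space ?N = Pi\<^sub>E J (\<lambda>k. Pi\<^sub>E I (\<lambda>l. A (l, k)))"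
      by (auto simp: space_PiM PiE_iff restrict_def extensional_def)
    hence "emeasure (distr ?N (lborel_on (I \<times> J)) ?f) (Pi\<^sub>E (I \<times> J) A) =
           emeasure ?N (Pi\<^sub>E J (\<lambda>k. Pi\<^sub>E I (\<lambda>l. A (l, k))))"
      using A assms by (subst emeasure_distr[OF meas]) (auto intro!: sets_PiM_I_finite)
    also have "\<dots> = (\<Prod>k\<in>J. emeasure (lborel_on I) (Pi\<^sub>E I (\<lambda>l. A (l, k))))"
      using A assms by (intro B.emeasure_PiM) (auto intro!: sets_PiM_I_finite)
    also have "\<dots> = (\<Prod>k\<in>J. \<Prod>l\<in>I. emeasure lborel (A (l, k)))"
      using A assms by (intro prod.cong A.emeasure_PiM) auto
    also have "\<dots> = (\<Prod>p\<in>I \<times> J. emeasure lborel (A p))"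
      by (subst prod.swap) (simp add: prod.cartesian_product case_prod_beta)
    finally show "emeasure (distr ?N (lborel_on (I \<times> J)) ?f) (Pi\<^sub>E (I \<times> J) A) = \<dots>" .
  qed (use assms in auto)
qed

text \<open>
  Fubini's theorem for particles that do not interact.
\<close>

lemma integral_prod_columns:
  fixes \<phi> :: "'b \<Rightarrow> ('a \<Rightarrow> real) \<Rightarrow> real"
  assumes fin: "finite I" "finite J"
    and int: "\<And>k. k \<in> J \<Longrightarrow> integrable (lborel_on I) (\<phi> k)"
  shows "integrable (lborel_on (I \<times> J)) (\<lambda>x. \<Prod>k\<in>J. \<phi> k (\<lambda>l. x (l, k)))" (is "integrable ?P ?F")
    and "(\<integral>x. (\<Prod>k\<in>J. \<phi> k (\<lambda>l. x (l, k))) \<partial>lborel_on (I \<times> J)) =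
           (\<Prod>k\<in>J. \<integral>z. \<phi> k z \<partial>lborel_on I)"
proof -
  interpret A: product_sigma_finite "\<lambda>_. lborel :: real measure" by (rule product_sigma_finite_lborel)
  interpret I: finite_product_sigma_finite "\<lambda>_. lborel :: real measure" I by standard fact
  interpret B: product_sigma_finite "\<lambda>_. lborel_on I"
    by standard
  let ?f = "\<lambda>y. \<lambda>p\<in>I \<times> J. y (snd p) (fst p)"
  let ?N = "Pi\<^sub>M J (\<lambda>_. lborel_on I)"
  have meas: "?f \<in> measurable ?N ?P"
  proof (intro measurable_restrict)
    fix p assume "p \<in> I \<times> J"
    hence "fst p \<in> I" "snd p \<in> J" by auto
    thus "(\<lambda>y. y (snd p) (fst p)) \<in> measurable ?N lborel"
      by (intro measurable_compose[of "\<lambda>y. y (snd p)" ?N "lborel_on I" "\<lambda>z. z (fst p)"]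
            measurable_component_singleton)
  qed
  have col: "(\<lambda>x. \<lambda>l. x (l, k)) \<in> measurable ?P (lborel_on I)" if "k \<in> J" for k
  proof -
    have "(\<lambda>x. \<lambda>l\<in>I. x (l, k)) \<in> measurable ?P (lborel_on I)"
      using that by (intro measurable_restrict measurable_component_singleton) auto
    also have "?this \<longleftrightarrow> ?thesis"
      using that by (intro measurable_cong) (auto simp: space_PiM PiE_iff extensional_def restrict_def fun_eq_iff)
    finally show ?thesis .
  qed
  have measF: "?F \<in> borel_measurable ?P"
    using int by (intro borel_measurable_prod measurable_compose[OF col]) auto
  have F: "?F (?f y) = (\<Prod>k\<in>J. \<phi> k (y k))" if "y \<in> space ?N" for y
  proof (intro prod.cong refl)
    fix k assume "k \<in> J"
    hence "(\<lambda>l. ?f y (l, k)) = y k"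
      using that by (auto simp: space_PiM PiE_iff extensional_def restrict_def fun_eq_iff)
    thus "\<phi> k (\<lambda>l. ?f y (l, k)) = \<phi> k (y k)" by simp
  qed
  have "integrable ?N (\<lambda>y. \<Prod>k\<in>J. \<phi> k (y k))"
    by (rule B.product_integrable_prod[OF fin(2) int])
  hence "integrable ?N (\<lambda>y. ?F (?f y))"
    using F by (subst Bochner_Integration.integrable_cong[OF refl F]) auto
  hence "integrable (distr ?N ?P ?f) ?F"
    by (subst integrable_distr_eq[OF meas measF])
  thus "integrable ?P ?F" by (simp add: distr_PiM_lborel_curry[OF fin])
  have "integral\<^sup>L ?P ?F = integral\<^sup>L (distr ?N ?P ?f) ?F"
    by (simp add: distr_PiM_lborel_curry[OF fin])
  also have "\<dots> = (\<integral>y. ?F (?f y) \<partial>?N)"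
    by (rule integral_distr[OF meas measF])
  also have "\<dots> = (\<integral>y. (\<Prod>k\<in>J. \<phi> k (y k)) \<partial>?N)"
    by (rule Bochner_Integration.integral_cong[OF refl F])
  also have "\<dots> = (\<Prod>k\<in>J. integral\<^sup>L (lborel_on I) (\<phi> k))"
    by (rule B.product_integral_prod[OF fin(2) int])
  finally show "integral\<^sup>L ?P ?F = \<dots>" .
qed

lemma reindex_PiM_lborel:
  fixes F :: "('a \<Rightarrow> real) \<Rightarrow> real"
  assumes "finite I" "bij_betw f I I" "integrable (lborel_on I) F"
  shows "integrable (lborel_on I) (\<lambda>x. F (\<lambda>i\<in>I. x (f i)))"
    and "(\<integral>x. F (\<lambda>i\<in>I. x (f i)) \<partial>lborel_on I) = integral\<^sup>L (lborel_on I) F"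
proof -
  let ?P = "lborel_on I" and ?f = "\<lambda>x. \<lambda>i\<in>I. x (f i)"
  have meas: "?f \<in> measurable ?P ?P"
    using assms(2) by (intro measurable_restrict measurable_component_singleton) (auto simp: bij_betw_def)
  have measF: "F \<in> borel_measurable ?P" using assms(3) by auto
  have D: "distr ?P ?P ?f = ?P" by (rule distr_PiM_lborel_reindex[OF assms(1,2)])
  show "integrable ?P (\<lambda>x. F (?f x))"
    using integrable_distr_eq[OF meas measF] assms(3) D by simp
  show "(\<integral>x. F (?f x) \<partial>?P) = integral\<^sup>L ?P F"
    using integral_distr[OF meas measF] D by simp
qed

section \<open>Andreief's identity for chains of determinants\<close>

text \<open>
  The weight of a one-particle path: nearest-neighbour couplings and one factor per level.
\<close>

definition chain_kernel :: "nat \<Rightarrow> (nat \<Rightarrow> real) \<Rightarrow> (nat \<Rightarrow> real \<Rightarrow> real) \<Rightarrow> (nat \<Rightarrow> real) \<Rightarrow> real" where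
  "chain_kernel m b g z = (\<Prod>l = 1..m. exp (b l * z (l - 1) * z l)) * (\<Prod>l\<le>m. g l (z l))"

text \<open>
  The weight of \<open>n\<close> particles in which the first \<open>p\<close> determinants have been replaced by the
  products of their diagonal entries. It interpolates between the full weight, \<open>p = 0\<close>, and a
  product over particles with two Vandermonde determinants, \<open>p = m\<close>.
\<close>

definition partial_weight :: "nat \<Rightarrow> nat \<Rightarrow> (nat \<Rightarrow> real) \<Rightarrow> (nat \<Rightarrow> real \<Rightarrow> real) \<Rightarrow> nat \<Rightarrow> (nat \<times> nat \<Rightarrow> real) \<Rightarrow> real" where
  "partial_weight n m b g p x =
     vandermonde n (\<lambda>k. x (0, k)) * vandermonde n (\<lambda>k. x (m, k))
   * (\<Prod>l = 1..p. \<Prod>k<n. exp (b l * x (l - 1, k) * x (l, k)))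
   * (\<Prod>l = p + 1..m. fdet n (\<lambda>i j. exp (b l * x (l - 1, i) * x (l, j))))
   * (\<Prod>l\<le>m. \<Prod>k<n. g l (x (l, k)))"

lemma partial_weight_cong:
  assumes "\<And>l k. l \<le> m \<Longrightarrow> k < n \<Longrightarrow> x (l, k) = x' (l, k)" "p \<le> m"
  shows "partial_weight n m b g p x = partial_weight n m b g p x'"
  unfolding partial_weight_def vandermonde_def
  using assms by (intro arg_cong2[of _ _ _ _ "(*)"] prod.cong fdet_cong refl) auto

lemma vandermonde_permute:
  assumes "\<pi> permutes {..<n}"
  shows "vandermonde n (\<lambda>k. x (\<pi> k)) = of_int (sign \<pi>) * vandermonde n x"
  unfolding vandermonde_eq_fdet using fdet_permute_rows[OF assms, of "\<lambda>i j. x i ^ j"] by simp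

text \<open>
  Expand the determinant that couples the levels \<open>p\<close> and \<open>p + 1\<close>. The remaining factors are
  alternating or symmetric in the particles of level \<open>p + 1\<close>, so relabelling these particles
  brings each term of the expansion to the diagonal one and absorbs its sign.
\<close>

lemma partial_weight_step:
  assumes p: "p < m"
  shows "partial_weight n m b g p x =
    (\<Sum>\<pi> | \<pi> permutes {..<n}. partial_weight n m b g (Suc p) (\<lambda>(l, k). x (l, if l = Suc p then \<pi> k else k)))"
proof -
  define q where "q = Suc p"
  define y where "y = (\<lambda>\<pi> (l, k). x (l, if l = q then \<pi> k else k))"
  define F where "F = vandermonde n (\<lambda>k. x (0, k)) * (\<Prod>l = 1..p. \<Prod>k<n. exp (b l * x (l - 1, k) * x (l, k)))
     * (\<Prod>l\<le>m. \<Prod>k<n. g l (x (l, k)))"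
  define R where "R = (\<lambda>x :: nat \<times> nat \<Rightarrow> real. vandermonde n (\<lambda>k. x (m, k)) *
     (\<Prod>l = q + 1..m. fdet n (\<lambda>i j. exp (b l * x (l - 1, i) * x (l, j)))))"
  have "partial_weight n m b g (Suc p) (y \<pi>) =
        of_int (sign \<pi>) * (\<Prod>k<n. exp (b q * x (q - 1, k) * x (q, \<pi> k))) * F * R x"
    if \<pi>: "\<pi> permutes {..<n}" for \<pi>
  proof -
    have G: "(\<Prod>l\<le>m. \<Prod>k<n. g l (y \<pi> (l, k))) = (\<Prod>l\<le>m. \<Prod>k<n. g l (x (l, k)))"
    proof (rule prod.cong[OF refl])
      fix l
      show "(\<Prod>k<n. g l (y \<pi> (l, k))) = (\<Prod>k<n. g l (x (l, k)))"
        using prod.reindex_bij_betw[OF permutes_imp_bij[OF \<pi>], of "\<lambda>k. g l (x (l, k))"]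
        by (cases "l = q") (simp_all add: y_def)
    qed
    have D: "(\<Prod>l = 1..Suc p. \<Prod>k<n. exp (b l * y \<pi> (l - 1, k) * y \<pi> (l, k))) =
       (\<Prod>l = 1..p. \<Prod>k<n. exp (b l * x (l - 1, k) * x (l, k))) * (\<Prod>k<n. exp (b q * x (q - 1, k) * x (q, \<pi> k)))"
    proof -
      have "(\<Prod>l = 1..p. \<Prod>k<n. exp (b l * y \<pi> (l - 1, k) * y \<pi> (l, k))) =
            (\<Prod>l = 1..p. \<Prod>k<n. exp (b l * x (l - 1, k) * x (l, k)))"
        by (intro prod.cong refl) (auto simp: y_def q_def)
      thus ?thesis by (simp add: y_def q_def)
    qed
    have R: "R (y \<pi>) = of_int (sign \<pi>) * R x"
    proof (cases "q = m")
      case True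
      thus ?thesis using vandermonde_permute[OF \<pi>, of "\<lambda>k. x (m, k)"] by (simp add: R_def y_def)
    next
      case False
      hence "q < m" using p by (simp add: q_def)
      hence split: "{q + 1..m} = insert (q + 1) {q + 2..m}" by auto
      have "fdet n (\<lambda>i j. exp (b (q + 1) * y \<pi> (q, i) * y \<pi> (q + 1, j))) =
            of_int (sign \<pi>) * fdet n (\<lambda>i j. exp (b (q + 1) * x (q, i) * x (q + 1, j)))"
        using fdet_permute_rows[OF \<pi>, of "\<lambda>i j. exp (b (q + 1) * x (q, i) * x (q + 1, j))"]
        by (simp add: y_def)
      moreover have "(\<Prod>l = q + 2..m. fdet n (\<lambda>i j. exp (b l * y \<pi> (l - 1, i) * y \<pi> (l, j)))) =
                     (\<Prod>l = q + 2..m. fdet n (\<lambda>i j. exp (b l * x (l - 1, i) * x (l, j))))"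
        by (intro prod.cong refl fdet_cong) (auto simp: y_def)
      moreover have "vandermonde n (\<lambda>k. y \<pi> (m, k)) = vandermonde n (\<lambda>k. x (m, k))"
        using False by (simp add: y_def)
      ultimately show ?thesis unfolding R_def split by (simp add: mult_ac)
    qed
    have V: "vandermonde n (\<lambda>k. y \<pi> (0, k)) = vandermonde n (\<lambda>k. x (0, k))"
      by (simp add: y_def q_def)
    have "partial_weight n m b g (Suc p) (y \<pi>) =
      vandermonde n (\<lambda>k. y \<pi> (0, k)) * (\<Prod>l = 1..Suc p. \<Prod>k<n. exp (b l * y \<pi> (l - 1, k) * y \<pi> (l, k)))
      * (\<Prod>l\<le>m. \<Prod>k<n. g l (y \<pi> (l, k))) * R (y \<pi>)"
      unfolding partial_weight_def R_def q_def Suc_eq_plus1 by (simp only: mult_ac)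
    also have "\<dots> = of_int (sign \<pi>) * (\<Prod>k<n. exp (b q * x (q - 1, k) * x (q, \<pi> k))) * F * R x"
      unfolding G D R V F_def by (simp only: mult_ac)
    finally show ?thesis .
  qed
  hence "(\<Sum>\<pi> | \<pi> permutes {..<n}. partial_weight n m b g (Suc p) (y \<pi>)) =
         (\<Sum>\<pi> | \<pi> permutes {..<n}. of_int (sign \<pi>) * (\<Prod>k<n. exp (b q * x (q - 1, k) * x (q, \<pi> k))) * F * R x)"
    by (intro sum.cong refl) auto
  also have "\<dots> = fdet n (\<lambda>i j. exp (b q * x (q - 1, i) * x (q, j))) * F * R x"
    by (simp add: fdet_leibniz sum_distrib_right)
  also have "\<dots> = partial_weight n m b g p x"
  proof -
    have split: "{p + 1..m} = insert q {q + 1..m}" using p by (auto simp: q_def)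
    show ?thesis unfolding partial_weight_def split F_def R_def by (simp add: mult_ac)
  qed
  finally show ?thesis by (simp add: y_def q_def)
qed

lemma partial_weight_diagonal:
  "partial_weight n m b g m x =
     (\<Sum>\<sigma> | \<sigma> permutes {..<n}. \<Sum>\<tau> | \<tau> permutes {..<n}. of_int (sign \<sigma>) * of_int (sign \<tau>) *
        (\<Prod>k<n. x (0, k) ^ \<sigma> k * x (m, k) ^ \<tau> k * chain_kernel m b g (\<lambda>l. x (l, k))))"
proof -
  have "partial_weight n m b g m x =
     (vsign n * vsign n) * (fdet n (\<lambda>i j. x (0, i) ^ j) * fdet n (\<lambda>i j. x (m, i) ^ j)) *
     (\<Prod>k<n. chain_kernel m b g (\<lambda>l. x (l, k)))"
    unfolding partial_weight_def vandermonde_eq_fdet chain_kernel_def prod.distrib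
    by (simp add: prod.swap[of _ "{..<n}"] mult_ac)
  also have "\<dots> = (\<Sum>\<sigma> | \<sigma> permutes {..<n}. \<Sum>\<tau> | \<tau> permutes {..<n}. of_int (sign \<sigma>) * of_int (sign \<tau>) *
        (\<Prod>k<n. x (0, k) ^ \<sigma> k * x (m, k) ^ \<tau> k * chain_kernel m b g (\<lambda>l. x (l, k))))"
    unfolding vsign_square fdet_leibniz sum_product prod.distrib
    by (simp add: sum_distrib_left sum_distrib_right mult_ac)
  finally show ?thesis .
qed

text \<open>
  By \<open>partial_weight_step\<close> each of the \<open>m\<close> determinants costs a factor \<open>n!\<close>, the number of
  relabellings of one level. For \<open>p = m\<close> the particles decouple, and the two Vandermonde
  determinants combine the one-particle integrals into \<open>n!\<close> copies of one determinant.
\<close>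

theorem andreief_chain:
  fixes b :: "nat \<Rightarrow> real" and g :: "nat \<Rightarrow> real \<Rightarrow> real"
  assumes int: "\<And>i j. integrable (lborel_on {..m}) (\<lambda>z. z 0 ^ i * z m ^ j * chain_kernel m b g z)"
  defines "Mom \<equiv> (\<lambda>i j. \<integral>z. z 0 ^ i * z m ^ j * chain_kernel m b g z \<partial>lborel_on {..m})"
  shows "integrable (config_measure n m) (partial_weight n m b g 0)"
    and "integral\<^sup>L (config_measure n m) (partial_weight n m b g 0) = fact n ^ Suc m * fdet n Mom"
proof -
  let ?I = "{..m} \<times> {..<n}"
  let ?P = "lborel_on ?I"
  let ?S = "{\<pi>. \<pi> permutes {..<n}}"
  have fin: "finite ?S" by (simp add: finite_permutations)
  have cardS: "card ?S = fact n" by (simp add: card_permutations[of _ n])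
  have diag: "integrable ?P (partial_weight n m b g m) \<and>
        integral\<^sup>L ?P (partial_weight n m b g m) = fact n * fdet n Mom"
  proof
    define \<phi> where "\<phi> = (\<lambda>(\<sigma> :: nat \<Rightarrow> nat) (\<tau> :: nat \<Rightarrow> nat) (k :: nat) z. z 0 ^ \<sigma> k * z m ^ \<tau> k * chain_kernel m b g z)"
    have diagonal: "partial_weight n m b g m x = (\<Sum>\<sigma>\<in>?S. \<Sum>\<tau>\<in>?S. of_int (sign \<sigma>) * of_int (sign \<tau>) *
        (\<Prod>k<n. \<phi> \<sigma> \<tau> k (\<lambda>l. x (l, k))))" for x
      unfolding \<phi>_def by (rule partial_weight_diagonal)
    have \<phi>: "integrable (lborel_on {..m}) (\<phi> \<sigma> \<tau> k)" for \<sigma> \<tau> k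
      unfolding \<phi>_def by (rule int)
    have colint: "integrable ?P (\<lambda>x. of_int (sign \<sigma>) * of_int (sign \<tau>) * (\<Prod>k<n. \<phi> \<sigma> \<tau> k (\<lambda>l. x (l, k))))" for \<sigma> \<tau>
      by (intro integrable_mult_right integral_prod_columns(1) \<phi>) auto
    have colval: "(\<integral>x. of_int (sign \<sigma>) * of_int (sign \<tau>) * (\<Prod>k<n. \<phi> \<sigma> \<tau> k (\<lambda>l. x (l, k))) \<partial>?P) =
        of_int (sign \<sigma>) * of_int (sign \<tau>) * (\<Prod>k<n. Mom (\<sigma> k) (\<tau> k))" for \<sigma> \<tau>
      using integral_prod_columns(2)[of "{..m}" "{..<n}" "\<phi> \<sigma> \<tau>"] \<phi> by (simp add: Mom_def \<phi>_def)
    show "integrable ?P (partial_weight n m b g m)"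
      unfolding diagonal by (intro Bochner_Integration.integrable_sum colint)
    have "integral\<^sup>L ?P (partial_weight n m b g m) =
       (\<Sum>\<sigma>\<in>?S. \<Sum>\<tau>\<in>?S. of_int (sign \<sigma>) * of_int (sign \<tau>) * (\<Prod>k<n. Mom (\<sigma> k) (\<tau> k)))"
      unfolding diagonal
      by (subst Bochner_Integration.integral_sum, rule Bochner_Integration.integrable_sum, rule colint,
          subst Bochner_Integration.integral_sum, rule colint, simp only: colval)
    also have "\<dots> = (\<Sum>\<sigma>\<in>?S. of_int (sign \<sigma>) * fdet n (\<lambda>i. Mom (\<sigma> i)))"
      unfolding fdet_leibniz by (simp add: sum_distrib_left mult_ac)
    also have "\<dots> = (\<Sum>\<sigma>\<in>?S. fdet n Mom)"
    proof (rule sum.cong[OF refl])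
      fix \<sigma> assume "\<sigma> \<in> ?S"
      hence "fdet n (\<lambda>i. Mom (\<sigma> i)) = of_int (sign \<sigma>) * fdet n Mom"
        by (intro fdet_permute_rows) auto
      moreover have "(of_int (sign \<sigma>) * of_int (sign \<sigma>) :: real) = 1" by (simp flip: of_int_mult)
      ultimately show "of_int (sign \<sigma>) * fdet n (\<lambda>i. Mom (\<sigma> i)) = fdet n Mom"
        by (simp only: mult.assoc[symmetric] mult_1)
    qed
    also have "\<dots> = fact n * fdet n Mom" by (simp add: cardS)
    finally show "integral\<^sup>L ?P (partial_weight n m b g m) = fact n * fdet n Mom" .
  qed
  have "integrable ?P (partial_weight n m b g (m - q)) \<and>
        integral\<^sup>L ?P (partial_weight n m b g (m - q)) = fact n ^ Suc q * fdet n Mom" if "q \<le> m" for q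
    using that
  proof (induction q)
    case 0
    thus ?case using diag by simp
  next
    case (Suc q)
    define p where "p = m - Suc q"
    have p: "p < m" "m - q = Suc p" using Suc.prems by (auto simp: p_def)
    \<comment> \<open>The map on indices that relabels the particles of level \<open>p + 1\<close>, as in \<open>partial_weight_step\<close>.\<close>
    define f where "f = (\<lambda>\<pi> (l, k). (l :: nat, if l = Suc p then \<pi> k else k :: nat))"
    have IH: "integrable ?P (partial_weight n m b g (Suc p))"
      "integral\<^sup>L ?P (partial_weight n m b g (Suc p)) = fact n ^ Suc q * fdet n Mom"
      using Suc.IH Suc.prems unfolding p by auto
    have bij: "bij_betw (f \<pi>) ?I ?I" if "\<pi> \<in> ?S" for \<pi>
    proof (rule bij_betwI[where g = "f (Hilbert_Choice.inv \<pi>)"])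
      have \<pi>: "\<pi> permutes {..<n}" using that by simp
      have range: "f \<rho> \<in> ?I \<rightarrow> ?I" if "\<rho> permutes {..<n}" for \<rho>
      proof
        fix x assume "x \<in> ?I"
        then obtain l k where "x = (l, k)" "l \<le> m" "k < n" by auto
        moreover have "\<rho> k < n" if "k < n" for k
          using permutes_in_image[OF \<open>\<rho> permutes {..<n}\<close>, of k] that by simp
        ultimately show "f \<rho> x \<in> ?I" by (simp add: f_def)
      qed
      show "f \<pi> \<in> ?I \<rightarrow> ?I" by (rule range[OF \<pi>])
      show "f (Hilbert_Choice.inv \<pi>) \<in> ?I \<rightarrow> ?I" by (rule range[OF permutes_inv[OF \<pi>]])
      show "f (Hilbert_Choice.inv \<pi>) (f \<pi> x) = x" "f \<pi> (f (Hilbert_Choice.inv \<pi>) x) = x" for x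
        by (simp_all add: f_def permutes_inverses[OF \<pi>] split: prod.splits)
    qed
    have eq: "partial_weight n m b g p x = (\<Sum>\<pi>\<in>?S. partial_weight n m b g (Suc p) (\<lambda>i\<in>?I. x (f \<pi> i)))" for x
      unfolding partial_weight_step[OF p(1)]
    proof (rule sum.cong[OF refl], rule partial_weight_cong)
      fix \<pi> l k assume "l \<le> m" "k < n"
      thus "(case (l, k) of (l, k) \<Rightarrow> x (l, if l = Suc p then \<pi> k else k)) = (\<lambda>i\<in>?I. x (f \<pi> i)) (l, k)"
        by (simp add: f_def)
    qed (use p in auto)
    note R = reindex_PiM_lborel[OF _ bij IH(1)]
    have "integrable ?P (partial_weight n m b g p)"
      unfolding eq by (rule Bochner_Integration.integrable_sum, rule R(1)) simp_all
    moreover have "integral\<^sup>L ?P (partial_weight n m b g p) = (\<Sum>\<pi>\<in>?S. fact n ^ Suc q * fdet n Mom)"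
      unfolding eq by (subst Bochner_Integration.integral_sum, rule R(1), simp, assumption)
        (intro sum.cong refl, subst R(2), simp_all add: IH(2))
    ultimately show ?case by (simp add: cardS p_def)
  qed
  from this[of m] show "integrable (config_measure n m) (partial_weight n m b g 0)"
    "integral\<^sup>L (config_measure n m) (partial_weight n m b g 0) = fact n ^ Suc m * fdet n Mom"
    by (simp_all add: config_measure_def)
qed

section \<open>Integrals depending on a parameter\<close>

lemma dominated_integral_isCont:
  fixes f :: "real \<Rightarrow> 'a \<Rightarrow> real"
  assumes meas: "\<And>s. f s \<in> borel_measurable M" and g: "integrable M g"
    and bound: "\<And>s x. x \<in> space M \<Longrightarrow> \<bar>f s x\<bar> \<le> g x"
    and cont: "\<And>s x. x \<in> space M \<Longrightarrow> isCont (\<lambda>s. f s x) s"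
  shows "isCont (\<lambda>s. \<integral>x. f s x \<partial>M) s0"
proof -
  have "(\<lambda>i. \<integral>x. f (X i) x \<partial>M) \<longlonglongrightarrow> (\<integral>x. f s0 x \<partial>M)" if "X \<longlonglongrightarrow> s0" for X
  proof (rule integral_dominated_convergence[OF meas meas g])
    show "AE x in M. (\<lambda>i. f (X i) x) \<longlonglongrightarrow> f s0 x"
      by (intro AE_I2 isCont_tendsto_compose[OF cont that])
    show "AE x in M. norm (f (X i) x) \<le> g x" for i
      by (intro AE_I2) (simp add: bound)
  qed
  thus ?thesis
    by (simp add: isCont_def tendsto_at_iff_sequentially comp_def)
qed

text \<open>
  Difference quotients are dominated by means of the mean value theorem.
\<close>

lemma dominated_integral_DERIV:
  fixes f f' :: "real \<Rightarrow> 'a \<Rightarrow> real"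
  assumes e: "e > 0"
    and int: "\<And>s. \<bar>s - s0\<bar> < e \<Longrightarrow> integrable M (f s)"
    and der: "\<And>s x. x \<in> space M \<Longrightarrow> \<bar>s - s0\<bar> < e \<Longrightarrow> ((\<lambda>s. f s x) has_real_derivative f' s x) (at s)"
    and bound: "\<And>s x. x \<in> space M \<Longrightarrow> \<bar>s - s0\<bar> < e \<Longrightarrow> \<bar>f' s x\<bar> \<le> g x"
    and g: "integrable M g"
    and meas: "f' s0 \<in> borel_measurable M"
  shows "((\<lambda>s. \<integral>x. f s x \<partial>M) has_real_derivative (\<integral>x. f' s0 x \<partial>M)) (at s0)"
  unfolding has_field_derivative_iff tendsto_at_iff_sequentially comp_def
proof safe
  fix X :: "nat \<Rightarrow> real" assume X: "\<forall>i. X i \<in> UNIV - {s0}" "X \<longlonglongrightarrow> s0"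
  have "\<forall>\<^sub>F i in sequentially. \<bar>X i - s0\<bar> < e"
    using X(2) e by (auto simp: tendsto_iff dist_real_def)
  then obtain N where N: "\<And>i. i \<ge> N \<Longrightarrow> \<bar>X i - s0\<bar> < e"
    by (auto simp: eventually_sequentially)
  define Y where "Y = (\<lambda>i. X (i + N))"
  have Y: "Y i \<noteq> s0" "\<bar>Y i - s0\<bar> < e" for i using X(1) N[of "i + N"] by (auto simp: Y_def)
  have limY: "Y \<longlonglongrightarrow> s0" unfolding Y_def by (rule LIMSEQ_ignore_initial_segment[OF X(2)])
  have s0: "integrable M (f s0)" using int[of s0] e by simp
  have "(\<lambda>i. \<integral>x. (f (Y i) x - f s0 x) / (Y i - s0) \<partial>M) \<longlonglongrightarrow> (\<integral>x. f' s0 x \<partial>M)"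
  proof (rule integral_dominated_convergence[OF meas _ g])
    show "(\<lambda>x. (f (Y i) x - f s0 x) / (Y i - s0)) \<in> borel_measurable M" for i
      using int[OF Y(2)[of i]] s0 by (intro borel_measurable_divide borel_measurable_diff) auto
    show "AE x in M. (\<lambda>i. (f (Y i) x - f s0 x) / (Y i - s0)) \<longlonglongrightarrow> f' s0 x"
    proof (rule AE_I2)
      fix x assume "x \<in> space M"
      from der[OF this, of s0] e
      have "((\<lambda>y. (f y x - f s0 x) / (y - s0)) \<longlongrightarrow> f' s0 x) (at s0)"
        by (simp add: has_field_derivative_iff)
      thus "(\<lambda>i. (f (Y i) x - f s0 x) / (Y i - s0)) \<longlonglongrightarrow> f' s0 x"
        unfolding tendsto_at_iff_sequentially comp_def using Y(1) limY by blast
    qed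
    show "AE x in M. norm ((f (Y i) x - f s0 x) / (Y i - s0)) \<le> g x" for i
    proof (rule AE_I2)
      fix x assume x: "x \<in> space M"
      have "\<exists>z. min s0 (Y i) < z \<and> z < max s0 (Y i) \<and>
              f (max s0 (Y i)) x - f (min s0 (Y i)) x = (max s0 (Y i) - min s0 (Y i)) * f' z x"
      proof (rule MVT2)
        show "min s0 (Y i) < max s0 (Y i)" using Y(1)[of i] by auto
        fix z assume "min s0 (Y i) \<le> z" "z \<le> max s0 (Y i)"
        hence "\<bar>z - s0\<bar> < e" using Y(2)[of i] e by (auto simp: abs_if min_def max_def split: if_splits)
        thus "DERIV (\<lambda>s. f s x) z :> f' z x" by (rule der[OF x])
      qed
      then obtain z where z: "min s0 (Y i) < z" "z < max s0 (Y i)"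
        "f (max s0 (Y i)) x - f (min s0 (Y i)) x = (max s0 (Y i) - min s0 (Y i)) * f' z x" by blast
      have "\<bar>z - s0\<bar> < e" using z(1,2) Y(2)[of i] by (auto simp: abs_if min_def max_def split: if_splits)
      moreover have "(f (Y i) x - f s0 x) / (Y i - s0) = f' z x"
        using z(3) Y(1)[of i] by (cases "Y i < s0") (auto simp: min_def max_def field_simps split: if_splits)
      ultimately show "norm ((f (Y i) x - f s0 x) / (Y i - s0)) \<le> g x"
        using bound[OF x] by simp
    qed
  qed
  moreover have "(\<integral>x. (f (Y i) x - f s0 x) / (Y i - s0) \<partial>M) =
                 ((\<integral>x. f (Y i) x \<partial>M) - (\<integral>x. f s0 x \<partial>M)) / (Y i - s0)" for i
    using int[OF Y(2)[of i]] s0 by simp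
  ultimately have "(\<lambda>i. ((\<integral>x. f (Y i) x \<partial>M) - (\<integral>x. f s0 x \<partial>M)) / (Y i - s0)) \<longlonglongrightarrow> (\<integral>x. f' s0 x \<partial>M)"
    by (simp only:)
  thus "(\<lambda>i. ((\<integral>x. f (X i) x \<partial>M) - (\<integral>x. f s0 x \<partial>M)) / (X i - s0)) \<longlonglongrightarrow> (\<integral>x. f' s0 x \<partial>M)"
    unfolding Y_def by (rule LIMSEQ_offset)
qed

text \<open>
  A function of the extended endpoint \<open>x\<close>, so that infinite endpoints need no separate formulas.
\<close>

definition lower_integral :: "(real \<Rightarrow> real) \<Rightarrow> ereal \<Rightarrow> real" where
  "lower_integral h x = (\<integral>s. indicator {s. ereal s < x} s * h s \<partial>lborel)"

lemma lower_set_measurable [measurable]: "{s. ereal s < x} \<in> sets borel"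
  by (cases x) (auto simp: lessThan_def[symmetric])

lemma lower_integral_eq_interval: "lower_integral h x = (LBINT s=-\<infinity>..x. h s)"
proof -
  have "{s. ereal s < x} = einterval (-\<infinity>) x" by (auto simp: einterval_def)
  thus ?thesis
    by (simp add: lower_integral_def interval_lebesgue_integral_le_eq set_lebesgue_integral_def)
qed

lemma DERIV_lower_integral:
  assumes int: "integrable lborel h" and cont: "\<And>s. isCont h s"
  shows "((\<lambda>s. lower_integral h (ereal s)) has_real_derivative h s0) (at s0)"
proof -
  have "\<exists>F. \<forall>x. -\<infinity> < ereal x \<longrightarrow> ereal x < \<infinity> \<longrightarrow> (F has_vector_derivative h x) (at x)"
    by (rule einterval_antiderivative) (auto simp: cont)
  then obtain F where F: "\<And>x. (F has_vector_derivative h x) (at x)" by auto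
  define c where "c = lower_integral h (ereal 0)"
  have "lower_integral h (ereal s) = c + (F s - F 0)" for s
  proof -
    have *: "set_integrable lborel A h" if "A \<in> sets borel" for A
      using integrable_mult_indicator[of A lborel h] int that by (simp add: set_integrable_def)
    have "interval_lebesgue_integrable lborel x y h" for x y
      unfolding interval_lebesgue_integrable_def by (simp add: *)
    hence "(LBINT s=-\<infinity>..ereal 0. h s) + (LBINT s=ereal 0..ereal s. h s) = (LBINT s=-\<infinity>..ereal s. h s)"
      by (intro interval_integral_sum)
    moreover have "(LBINT s=ereal 0..ereal s. h s) = F s - F 0"
    proof (rule interval_integral_FTC_finite)
      show "continuous_on {min 0 s..max 0 s} h"
        by (intro continuous_at_imp_continuous_on ballI cont)
      show "(F has_vector_derivative h x) (at x within {min 0 s..max 0 s})" for x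
        by (rule has_vector_derivative_at_within[OF F])
    qed
    ultimately show ?thesis by (simp add: lower_integral_eq_interval c_def)
  qed
  moreover have "(F has_real_derivative h s0) (at s0)"
    using F[of s0] by (simp add: has_real_derivative_iff_has_vector_derivative)
  from DERIV_add[OF DERIV_const DERIV_diff[OF this DERIV_const]]
  have "((\<lambda>s. c + (F s - F 0)) has_real_derivative 0 + (h s0 - 0)) (at s0)" .
  ultimately show ?thesis by simp
qed

text \<open>
  The fundamental theorem of calculus on a half-line, where infinite endpoints contribute no
  boundary term because \<open>h\<close> vanishes at infinity.
\<close>

lemma lower_integral_derivative:
  assumes int: "integrable lborel h'" and cont: "\<And>s. isCont h' s"
    and der: "\<And>s. (h has_real_derivative h' s) (at s)"
    and lim: "(h \<longlongrightarrow> 0) at_top" "(h \<longlongrightarrow> 0) at_bot"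
  shows "lower_integral h' x = (if \<bar>x\<bar> = \<infinity> then 0 else h (real_of_ereal x))"
proof (cases "x = -\<infinity>")
  case True
  thus ?thesis by (simp add: lower_integral_def)
next
  case False
  have "(LBINT s=-\<infinity>..x. h' s) = (if \<bar>x\<bar> = \<infinity> then 0 else h (real_of_ereal x)) - 0"
  proof (rule interval_integral_FTC_integrable)
    show "-\<infinity> < x" using False by auto
    show "set_integrable lborel (einterval (-\<infinity>) x) h'"
      using integrable_mult_indicator[of "einterval (-\<infinity>) x" lborel h'] int by (simp add: set_integrable_def)
    show "((h \<circ> real_of_ereal) \<longlongrightarrow> 0) (at_right (-\<infinity>))"
      using lim(2) by (simp add: ereal_tendsto_simps)
    show "((h \<circ> real_of_ereal) \<longlongrightarrow> (if \<bar>x\<bar> = \<infinity> then 0 else h (real_of_ereal x))) (at_left x)"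
    proof (cases x)
      case (real r)
      have "(h \<longlongrightarrow> h r) (at r)"
        using DERIV_isCont[OF der[of r]] by (simp add: isCont_def)
      hence "(h \<longlongrightarrow> h r) (at_left r)"
        by (rule tendsto_mono[OF at_le, rotated]) simp
      thus ?thesis using real by (simp add: ereal_tendsto_simps)
    next
      case PInf
      thus ?thesis using lim(1) by (simp add: ereal_tendsto_simps)
    qed (use False in simp)
    show "(h has_vector_derivative h' y) (at y)" for y
      using der[of y] by (simp add: has_real_derivative_iff_has_vector_derivative)
    show "isCont h' y" for y by (rule cont)
  qed
  thus ?thesis by (simp add: lower_integral_eq_interval)
qed

text \<open>
  Each interval is the difference of two half-lines. The second conjunct is what makes the
  intervals disjoint in the induction. Endpoints have to be excluded, since the
  difference of two half-lines contains its left end.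
\<close>

lemma indicator_interval_union:
  fixes a :: "nat \<Rightarrow> ereal"
  assumes "\<And>i. 1 \<le> i \<Longrightarrow> i < 2 * r \<Longrightarrow> a i < a (i + 1)" "\<And>i. ereal s \<noteq> a i"
  shows "indicator (\<Union>i\<in>{1..r}. einterval (a (2 * i - 1)) (a (2 * i))) s =
           (\<Sum>j = 1..2 * r. (-1) ^ j * indicator {s. ereal s < a j} s :: real) \<and>
         (s \<in> (\<Union>i\<in>{1..r}. einterval (a (2 * i - 1)) (a (2 * i))) \<longrightarrow> ereal s < a (2 * r))"
  using assms
proof (induction r)
  case (Suc r)
  let ?U = "\<Union>i\<in>{1..r}. einterval (a (2 * i - 1)) (a (2 * i))"
  have IH: "indicator ?U s = (\<Sum>j = 1..2 * r. (-1) ^ j * indicator {s. ereal s < a j} s :: real)"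
    "s \<in> ?U \<Longrightarrow> ereal s < a (2 * r)"
    using Suc by auto
  have U: "(\<Union>i\<in>{1..Suc r}. einterval (a (2 * i - 1)) (a (2 * i))) = ?U \<union> einterval (a (2 * r + 1)) (a (2 * r + 2))"
    by (simp add: atLeastAtMostSuc_conv Un_commute)
  have 1: "a (2 * r + 1) < a (2 * r + 2)" using Suc.prems(1)[of "2 * r + 1"] by simp
  have 2: "s \<in> ?U \<Longrightarrow> ereal s < a (2 * r + 1)"
  proof -
    assume s: "s \<in> ?U"
    hence "r \<ge> 1" by auto
    hence "a (2 * r) < a (2 * r + 1)" using Suc.prems(1)[of "2 * r"] by simp
    thus ?thesis using IH(2)[OF s] by simp
  qed
  have 3: "ereal s \<noteq> a (2 * r + 1)" by (rule Suc.prems)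
  have "indicator (?U \<union> einterval (a (2 * r + 1)) (a (2 * r + 2))) s =
        (indicator ?U s + indicator (einterval (a (2 * r + 1)) (a (2 * r + 2))) s :: real)"
  proof (cases "s \<in> ?U")
    case True
    hence "s \<notin> einterval (a (2 * r + 1)) (a (2 * r + 2))"
      using 2 by (simp add: einterval_def not_less less_imp_le)
    thus ?thesis using True by (simp add: indicator_def)
  qed (simp add: indicator_def)
  also have "indicator (einterval (a (2 * r + 1)) (a (2 * r + 2))) s =
        (indicator {s. ereal s < a (2 * r + 2)} s - indicator {s. ereal s < a (2 * r + 1)} s :: real)"
    using 1 3 by (auto simp: indicator_def einterval_def)
  finally have "indicator (\<Union>i\<in>{1..Suc r}. einterval (a (2 * i - 1)) (a (2 * i))) s =
           (\<Sum>j = 1..2 * Suc r. (-1) ^ j * indicator {s. ereal s < a j} s :: real)"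
    unfolding U IH(1) by simp
  moreover have "s \<in> (\<Union>i\<in>{1..Suc r}. einterval (a (2 * i - 1)) (a (2 * i))) \<longrightarrow> ereal s < a (2 * Suc r)"
  proof
    assume "s \<in> (\<Union>i\<in>{1..Suc r}. einterval (a (2 * i - 1)) (a (2 * i)))"
    then consider "s \<in> ?U" | "s \<in> einterval (a (2 * r + 1)) (a (2 * r + 2))" unfolding U by blast
    thus "ereal s < a (2 * Suc r)"
    proof cases
      case 1
      from less_trans[OF 2[OF this] \<open>a (2 * r + 1) < a (2 * r + 2)\<close>] show ?thesis by simp
    qed (simp add: einterval_def)
  qed
  ultimately show ?case ..
qed simp

lemma integral_interval_union:
  fixes a :: "nat \<Rightarrow> nat \<Rightarrow> ereal"
  assumes incr: "\<And>i. 1 \<le> i \<Longrightarrow> i < 2 * r l \<Longrightarrow> a l i < a l (i + 1)" and int: "integrable lborel h"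
  shows "(\<integral>s. indicator (interval_union r a l) s * h s \<partial>lborel) =
           (\<Sum>j = 1..2 * r l. (-1) ^ j * lower_integral h (a l j))"
proof -
  have int': "integrable lborel (\<lambda>s. indicator {s. ereal s < x} s * h s)" for x
    using integrable_mult_indicator[OF _ int, of "{s. ereal s < x}"] by simp
  have "(\<integral>s. indicator (interval_union r a l) s * h s \<partial>lborel) =
        (\<integral>s. (\<Sum>j = 1..2 * r l. (-1) ^ j * (indicator {s. ereal s < a l j} s * h s)) \<partial>lborel)"
  \<comment> \<open>The indicator identity fails at most at the endpoints, a countable set.\<close>
  proof (rule integral_discrete_difference[of "(\<lambda>i. real_of_ereal (a l i)) ` UNIV"])
    fix s assume s: "s \<notin> (\<lambda>i. real_of_ereal (a l i)) ` UNIV"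
    have "ereal s \<noteq> a l i" for i
    proof
      assume "ereal s = a l i"
      hence "s = real_of_ereal (a l i)" by (metis real_of_ereal.simps(1))
      thus False using s by auto
    qed
    from indicator_interval_union[of "r l" "a l" s, OF incr this]
    have "indicator (interval_union r a l) s =
          (\<Sum>j = 1..2 * r l. (-1) ^ j * indicator {s. ereal s < a l j} s :: real)"
      by (simp only: interval_union_def)
    thus "indicator (interval_union r a l) s * h s =
          (\<Sum>j = 1..2 * r l. (-1) ^ j * (indicator {s. ereal s < a l j} s * h s))"
      by (simp only: sum_distrib_right mult.assoc)
  qed auto
  also have "\<dots> = (\<Sum>j = 1..2 * r l. (-1) ^ j * lower_integral h (a l j))"
    unfolding lower_integral_def
    by (subst Bochner_Integration.integral_sum) (intro integrable_mult_right int', simp)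
  finally show ?thesis .
qed

section \<open>Integrands of Gaussian decay\<close>

lemma integrable_exp_square:
  assumes "e > 0"
  shows "integrable lborel (\<lambda>x :: real. exp (- e * x\<^sup>2))"
proof -
  define \<sigma> where "\<sigma> = sqrt (1 / (2 * e))"
  have s: "\<sigma>\<^sup>2 = 1 / (2 * e)" "\<sigma> > 0" using assms by (auto simp: \<sigma>_def)
  have "integrable lborel (\<lambda>x. sqrt (2 * pi * \<sigma>\<^sup>2) * normal_density 0 \<sigma> x)"
    using s(2) by simp
  moreover have "sqrt (2 * pi * \<sigma>\<^sup>2) * normal_density 0 \<sigma> x = exp (- e * x\<^sup>2)" for x
    using s assms by (simp add: normal_density_def field_simps)
  ultimately show ?thesis by simp
qed

lemma integrable_exp_sum_squares:
  assumes "finite I" "e > 0"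
  shows "integrable (lborel_on I) (\<lambda>y. exp (- e * (\<Sum>k\<in>I. (y k)\<^sup>2)))"
proof -
  interpret product_sigma_finite "\<lambda>_. lborel :: real measure" by (rule product_sigma_finite_lborel)
  have "integrable (lborel_on I) (\<lambda>y. \<Prod>k\<in>I. exp (- e * (y k)\<^sup>2))"
    by (intro product_integrable_prod assms integrable_exp_square)
  thus ?thesis using assms by (simp add: exp_sum sum_distrib_left)
qed

text \<open>
  A class of integrable functions that is closed under multiplication by polynomials and whose
  bound survives the integration over all variables but one.
\<close>

definition gaussian_bounded :: "'i set \<Rightarrow> (('i \<Rightarrow> real) \<Rightarrow> real) \<Rightarrow> bool" where
  "gaussian_bounded I f \<longleftrightarrow> f \<in> borel_measurable (lborel_on I) \<and>
     (\<exists>C e. e > 0 \<and> (\<forall>z. \<bar>f z\<bar> \<le> C * exp (- e * (\<Sum>k\<in>I. (z k)\<^sup>2))))"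

lemma gaussian_bounded_measurable: "gaussian_bounded I f \<Longrightarrow> f \<in> borel_measurable (lborel_on I)"
  by (simp add: gaussian_bounded_def)

lemma gaussian_boundedE:
  assumes "gaussian_bounded I f"
  shows "\<exists>C e. C \<ge> 0 \<and> e > 0 \<and> (\<forall>z. \<bar>f z\<bar> \<le> C * exp (- e * (\<Sum>k\<in>I. (z k)\<^sup>2)))"
proof -
  from assms obtain C e where C: "e > 0" "\<And>z. \<bar>f z\<bar> \<le> C * exp (- e * (\<Sum>k\<in>I. (z k)\<^sup>2))"
    by (auto simp: gaussian_bounded_def)
  have "0 \<le> C * exp (- e * (\<Sum>k\<in>I. ((\<lambda>_. 0) k)\<^sup>2))" using C(2)[of "\<lambda>_. 0"] by linarith
  hence "C \<ge> 0" by simp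
  thus ?thesis using C by blast
qed

lemma gaussian_bounded_integrable:
  assumes "finite I" "gaussian_bounded I f"
  shows "integrable (lborel_on I) f"
proof -
  obtain C e where C: "C \<ge> 0" "e > 0" "\<And>z. \<bar>f z\<bar> \<le> C * exp (- e * (\<Sum>k\<in>I. (z k)\<^sup>2))"
    using gaussian_boundedE[OF assms(2)] by blast
  show ?thesis
  proof (rule Bochner_Integration.integrable_bound)
    show "integrable (lborel_on I) (\<lambda>z. C * exp (- e * (\<Sum>k\<in>I. (z k)\<^sup>2)))"
      by (intro integrable_mult_right integrable_exp_sum_squares assms C)
    show "AE z in lborel_on I. norm (f z) \<le> norm (C * exp (- e * (\<Sum>k\<in>I. (z k)\<^sup>2)))"
      using C by (intro AE_I2) simp
  qed (rule gaussian_bounded_measurable[OF assms(2)])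
qed

lemma gaussian_bounded_cmult:
  assumes "gaussian_bounded I f"
  shows "gaussian_bounded I (\<lambda>z. c * f z)"
proof -
  obtain C e where C: "C \<ge> 0" "e > 0" "\<And>z. \<bar>f z\<bar> \<le> C * exp (- e * (\<Sum>k\<in>I. (z k)\<^sup>2))"
    using gaussian_boundedE[OF assms] by blast
  have "\<bar>c * f z\<bar> \<le> (\<bar>c\<bar> * C) * exp (- e * (\<Sum>k\<in>I. (z k)\<^sup>2))" for z
    using mult_left_mono[OF C(3)[of z], of "\<bar>c\<bar>"] by (simp add: abs_mult mult.assoc)
  thus ?thesis
    using C(2) borel_measurable_times[OF borel_measurable_const gaussian_bounded_measurable[OF assms]]
    unfolding gaussian_bounded_def by blast
qed

lemma gaussian_bounded_add:
  assumes "gaussian_bounded I f" "gaussian_bounded I g"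
  shows "gaussian_bounded I (\<lambda>z. f z + g z)"
proof -
  obtain C e where C: "C \<ge> 0" "e > 0" "\<And>z. \<bar>f z\<bar> \<le> C * exp (- e * (\<Sum>k\<in>I. (z k)\<^sup>2))"
    using gaussian_boundedE[OF assms(1)] by blast
  obtain D d where D: "D \<ge> 0" "d > 0" "\<And>z. \<bar>g z\<bar> \<le> D * exp (- d * (\<Sum>k\<in>I. (z k)\<^sup>2))"
    using gaussian_boundedE[OF assms(2)] by blast
  define b where "b = min d e"
  have "\<bar>f z + g z\<bar> \<le> (C + D) * exp (- b * (\<Sum>k\<in>I. (z k)\<^sup>2))" for z
  proof -
    have S: "(\<Sum>k\<in>I. (z k)\<^sup>2) \<ge> 0" by (intro sum_nonneg) auto
    have "exp (- e * (\<Sum>k\<in>I. (z k)\<^sup>2)) \<le> exp (- b * (\<Sum>k\<in>I. (z k)\<^sup>2))"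
      "exp (- d * (\<Sum>k\<in>I. (z k)\<^sup>2)) \<le> exp (- b * (\<Sum>k\<in>I. (z k)\<^sup>2))"
      using S by (auto simp: b_def intro!: mult_right_mono)
    from mult_left_mono[OF this(1) C(1)] mult_left_mono[OF this(2) D(1)]
    show ?thesis using C(3)[of z] D(3)[of z] by (simp add: distrib_right)
  qed
  moreover have "b > 0" using C D by (simp add: b_def)
  ultimately show ?thesis
    using gaussian_bounded_measurable[OF assms(1)] gaussian_bounded_measurable[OF assms(2)]
    unfolding gaussian_bounded_def by (intro conjI borel_measurable_add) blast+
qed

lemma gaussian_bounded_coordinate:
  assumes "finite I" "l \<in> I" "gaussian_bounded I f"
  shows "gaussian_bounded I (\<lambda>z. z l * f z)"
proof -
  obtain C e where C: "C \<ge> 0" "e > 0" "\<And>z. \<bar>f z\<bar> \<le> C * exp (- e * (\<Sum>k\<in>I. (z k)\<^sup>2))"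
    using gaussian_boundedE[OF assms(3)] by blast
  \<comment> \<open>Half of the exponent absorbs the factor \<open>z l\<close>, by \<open>\<bar>z l\<bar> \<le> d * (z l)\<^sup>2 + 1 / (4 * d)\<close>.\<close>
  define d where "d = e / 2"
  have d: "d > 0" "e = d + d" using C(2) by (auto simp: d_def)
  define K where "K = 1 + 1 / (4 * d)"
  have K: "K \<ge> 0" using d by (simp add: K_def)
  have "\<bar>z l * f z\<bar> \<le> (K * C) * exp (- d * (\<Sum>k\<in>I. (z k)\<^sup>2))" for z
  proof -
    define S where "S = (\<Sum>k\<in>I. (z k)\<^sup>2)"
    have zS: "(z l)\<^sup>2 \<le> S" unfolding S_def using assms by (intro member_le_sum) auto
    have "0 \<le> (2 * d * \<bar>z l\<bar> - 1)\<^sup>2" by simp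
    hence "4 * d * \<bar>z l\<bar> \<le> 4 * d\<^sup>2 * (z l)\<^sup>2 + 1" by (simp add: power2_eq_square algebra_simps)
    hence "\<bar>z l\<bar> \<le> d * (z l)\<^sup>2 + 1 / (4 * d)"
      using d by (simp add: field_simps power2_eq_square)
    also have "\<dots> \<le> d * S + 1 / (4 * d)" using zS d by simp
    also have "\<dots> \<le> exp (d * S) + 1 / (4 * d) * exp (d * S)"
    proof (rule add_mono)
      show "d * S \<le> exp (d * S)" using exp_ge_add_one_self[of "d * S"] by linarith
      have "S \<ge> 0" unfolding S_def by (intro sum_nonneg) auto
      hence "1 \<le> exp (d * S)" using d by simp
      from mult_left_mono[OF this, of "1 / (4 * d)"] show "1 / (4 * d) \<le> 1 / (4 * d) * exp (d * S)"
        using d by simp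
    qed
    also have "\<dots> = K * exp (d * S)" by (simp add: K_def algebra_simps)
    finally have "\<bar>z l\<bar> * \<bar>f z\<bar> \<le> (K * exp (d * S)) * (C * exp (- e * S))"
      using C(3)[of z] unfolding S_def by (intro mult_mono) (auto simp: K)
    also have "\<dots> = (K * C) * (exp (d * S) * exp (- e * S))" by simp
    also have "exp (d * S) * exp (- e * S) = exp (- d * S)"
      unfolding exp_add[symmetric] d(2) by (simp add: algebra_simps)
    finally show ?thesis by (simp add: abs_mult S_def)
  qed
  moreover have "(\<lambda>z. z l * f z) \<in> borel_measurable (lborel_on I)"
    using gaussian_bounded_measurable[OF assms(3)] measurable_component_singleton[OF assms(2), of "\<lambda>_. lborel :: real measure"]
    by (intro borel_measurable_times) auto
  ultimately show ?thesis using d(1) unfolding gaussian_bounded_def by blast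
qed

lemma gaussian_bounded_power:
  assumes "finite I" "l \<in> I" "gaussian_bounded I f"
  shows "gaussian_bounded I (\<lambda>z. z l ^ i * f z)"
proof (induction i)
  case (Suc i)
  show ?case using gaussian_bounded_coordinate[OF assms(1,2) Suc] by (simp add: mult.assoc)
qed (use assms in simp)

text \<open>
  The density of the variable \<open>z l\<close> when all other variables range over their sets. Through it
  the dependence on the endpoints of one level becomes a question about one real variable.
\<close>

definition slice_integral :: "nat set \<Rightarrow> nat \<Rightarrow> (nat \<Rightarrow> real set) \<Rightarrow> ((nat \<Rightarrow> real) \<Rightarrow> real) \<Rightarrow> real \<Rightarrow> real" where
  "slice_integral I l U f s = (\<integral>y. (\<Prod>k\<in>I - {l}. indicator (U k) (y k)) * f (y(l := s)) \<partial>lborel_on (I - {l}))"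

lemma measurable_indicator_component:
  assumes "U k \<in> sets borel" "k \<in> J"
  shows "(\<lambda>y. indicator (U k) (y k) :: real) \<in> borel_measurable (lborel_on J)"
proof -
  have "(\<lambda>y. y k) \<in> measurable (lborel_on J) (lborel :: real measure)"
    by (rule measurable_component_singleton[OF assms(2)])
  moreover have "(indicator (U k) :: real \<Rightarrow> real) \<in> borel_measurable lborel"
    using assms by (intro borel_measurable_indicator) simp
  ultimately show ?thesis by (rule measurable_compose)
qed

lemma abs_box_indicator_le:
  fixes U :: "'i \<Rightarrow> 'a set" and x :: real
  shows "\<bar>(\<Prod>k\<in>J. indicator (U k) (y k)) * x\<bar> \<le> \<bar>x\<bar>"
proof -
  have "\<bar>\<Prod>k\<in>J. indicator (U k) (y k) :: real\<bar> \<le> 1"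
    unfolding abs_prod by (intro prod_le_1) (auto simp: indicator_def)
  from mult_right_mono[OF this, of "\<bar>x\<bar>"] show ?thesis by (simp add: abs_mult)
qed

context
  fixes I :: "nat set" and l :: nat and U :: "nat \<Rightarrow> real set"
  assumes I: "finite I" "l \<in> I" and U: "\<And>k. U k \<in> sets borel"
begin

lemma measurable_slice:
  fixes f :: "(nat \<Rightarrow> real) \<Rightarrow> real"
  assumes "f \<in> borel_measurable (lborel_on I)"
  shows "(\<lambda>y. (\<Prod>k\<in>I - {l}. indicator (U k) (y k)) * f (y(l := s))) \<in> borel_measurable (lborel_on (I - {l}))"
proof -
  have "(\<lambda>y. y(l := s)) \<in> measurable (lborel_on (I - {l})) (lborel_on I)"
    using I by (intro measurable_fun_upd[of _ "I - {l}"]) auto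
  hence 1: "(\<lambda>y. f (y(l := s))) \<in> borel_measurable (lborel_on (I - {l}))"
    by (rule measurable_compose[OF _ assms])
  have "(\<lambda>y. \<Prod>k\<in>I - {l}. indicator (U k) (y k) :: real) \<in> borel_measurable (lborel_on (I - {l}))"
    by (rule borel_measurable_prod, rule measurable_indicator_component[where U = U, OF U])
  from borel_measurable_times[OF this 1] show ?thesis .
qed

lemma sum_squares_update: "(\<Sum>k\<in>I. ((y(l := s)) k)\<^sup>2) = s\<^sup>2 + (\<Sum>k\<in>I - {l}. (y k)\<^sup>2)"
  using I by (subst sum.remove[of _ l]) auto

lemma slice_bound:
  assumes "gaussian_bounded I f"
  shows "\<exists>C e. C \<ge> 0 \<and> e > 0 \<and>
    (\<forall>y s. \<bar>(\<Prod>k\<in>I - {l}. indicator (U k) (y k)) * f (y(l := s))\<bar> \<le>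
       C * exp (- e * s\<^sup>2) * exp (- e * (\<Sum>k\<in>I - {l}. (y k)\<^sup>2)))"
proof -
  obtain C e where C: "C \<ge> 0" "e > 0" "\<And>z. \<bar>f z\<bar> \<le> C * exp (- e * (\<Sum>k\<in>I. (z k)\<^sup>2))"
    using gaussian_boundedE[OF assms] by blast
  have "\<bar>(\<Prod>k\<in>I - {l}. indicator (U k) (y k)) * f (y(l := s))\<bar> \<le>
       C * exp (- e * s\<^sup>2) * exp (- e * (\<Sum>k\<in>I - {l}. (y k)\<^sup>2))" for y s
  proof -
    have "\<bar>(\<Prod>k\<in>I - {l}. indicator (U k) (y k)) * f (y(l := s))\<bar> \<le> \<bar>f (y(l := s))\<bar>"
      by (rule abs_box_indicator_le)
    also have "\<dots> \<le> C * exp (- e * (\<Sum>k\<in>I. ((y(l := s)) k)\<^sup>2))" by (rule C)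
    also have "\<dots> = C * exp (- e * s\<^sup>2) * exp (- e * (\<Sum>k\<in>I - {l}. (y k)\<^sup>2))"
    proof -
      have "exp (- e * (s\<^sup>2 + S)) = exp (- e * s\<^sup>2) * exp (- e * S)" for S
        unfolding exp_add[symmetric] by (simp add: algebra_simps)
      thus ?thesis unfolding sum_squares_update by (simp only: mult.assoc)
    qed
    finally show ?thesis .
  qed
  thus ?thesis using C by blast
qed

lemma slice_dominated:
  assumes "gaussian_bounded I f"
  shows "\<exists>g. integrable (lborel_on (I - {l})) g \<and>
    (\<forall>y s. \<bar>(\<Prod>k\<in>I - {l}. indicator (U k) (y k)) * f (y(l := s))\<bar> \<le> g y)"
proof -
  obtain C e where C: "C \<ge> 0" "e > 0"
    "\<And>y s. \<bar>(\<Prod>k\<in>I - {l}. indicator (U k) (y k)) * f (y(l := s))\<bar> \<le>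
       C * exp (- e * s\<^sup>2) * exp (- e * (\<Sum>k\<in>I - {l}. (y k)\<^sup>2))"
    using slice_bound[OF assms] by blast
  show ?thesis
  proof (intro exI conjI allI)
    show "integrable (lborel_on (I - {l})) (\<lambda>y. C * exp (- e * (\<Sum>k\<in>I - {l}. (y k)\<^sup>2)))"
      using I C by (intro integrable_mult_right integrable_exp_sum_squares) auto
    fix y s
    have "C * exp (- e * s\<^sup>2) * exp (- e * (\<Sum>k\<in>I - {l}. (y k)\<^sup>2)) \<le> C * exp (- e * (\<Sum>k\<in>I - {l}. (y k)\<^sup>2))"
      using C by (intro mult_right_mono mult_left_le) auto
    from order_trans[OF C(3) this]
    show "\<bar>(\<Prod>k\<in>I - {l}. indicator (U k) (y k)) * f (y(l := s))\<bar> \<le> C * exp (- e * (\<Sum>k\<in>I - {l}. (y k)\<^sup>2))" .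
  qed
qed

lemma slice_integrable:
  assumes "gaussian_bounded I f"
  shows "integrable (lborel_on (I - {l})) (\<lambda>y. (\<Prod>k\<in>I - {l}. indicator (U k) (y k)) * f (y(l := s)))"
proof -
  obtain g where g: "integrable (lborel_on (I - {l})) g"
    "\<And>y s. \<bar>(\<Prod>k\<in>I - {l}. indicator (U k) (y k)) * f (y(l := s))\<bar> \<le> g y"
    using slice_dominated[OF assms] by blast
  show ?thesis
    by (rule Bochner_Integration.integrable_bound[OF g(1) measurable_slice[OF gaussian_bounded_measurable[OF assms]]],
        rule AE_I2, unfold real_norm_def, rule order_trans[OF g(2) abs_ge_self])
qed

lemma slice_integral_isCont:
  assumes "gaussian_bounded I f" "\<And>y s. isCont (\<lambda>s. f (y(l := s))) s"
  shows "isCont (slice_integral I l U f) s"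
proof -
  obtain g where g: "integrable (lborel_on (I - {l})) g"
    "\<And>y s. \<bar>(\<Prod>k\<in>I - {l}. indicator (U k) (y k)) * f (y(l := s))\<bar> \<le> g y"
    using slice_dominated[OF assms(1)] by blast
  have "isCont (\<lambda>s. \<integral>y. (\<Prod>k\<in>I - {l}. indicator (U k) (y k)) * f (y(l := s)) \<partial>lborel_on (I - {l})) s"
    by (rule dominated_integral_isCont[OF measurable_slice[OF gaussian_bounded_measurable[OF assms(1)]] g(1) g(2)],
        rule continuous_mult[OF continuous_const assms(2)])
  thus ?thesis by (simp add: slice_integral_def[abs_def])
qed

lemma slice_integral_DERIV:
  assumes f: "gaussian_bounded I f" and f': "gaussian_bounded I f'"
    and der: "\<And>y s. ((\<lambda>s. f (y(l := s))) has_real_derivative f' (y(l := s))) (at s)"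
  shows "(slice_integral I l U f has_real_derivative slice_integral I l U f' s) (at s)"
proof -
  obtain g where g: "integrable (lborel_on (I - {l})) g"
    "\<And>y s. \<bar>(\<Prod>k\<in>I - {l}. indicator (U k) (y k)) * f' (y(l := s))\<bar> \<le> g y"
    using slice_dominated[OF f'] by blast
  show ?thesis
    unfolding slice_integral_def[abs_def]
  proof (rule dominated_integral_DERIV[where e = 1 and g = g, OF _ slice_integrable[OF f] _ g(2) g(1)
           measurable_slice[OF gaussian_bounded_measurable[OF f']]])
    fix s y
    show "((\<lambda>s. (\<Prod>k\<in>I - {l}. indicator (U k) (y k)) * f (y(l := s))) has_real_derivative
           (\<Prod>k\<in>I - {l}. indicator (U k) (y k)) * f' (y(l := s))) (at s)"
      by (rule DERIV_cmult[OF der])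
  qed simp
qed

lemma slice_integral_bound:
  assumes "gaussian_bounded I f"
  shows "\<exists>C e. C \<ge> 0 \<and> e > 0 \<and> (\<forall>s. \<bar>slice_integral I l U f s\<bar> \<le> C * exp (- e * s\<^sup>2))"
proof -
  obtain C e where C: "C \<ge> 0" "e > 0"
    "\<And>y s. \<bar>(\<Prod>k\<in>I - {l}. indicator (U k) (y k)) * f (y(l := s))\<bar> \<le>
       C * exp (- e * s\<^sup>2) * exp (- e * (\<Sum>k\<in>I - {l}. (y k)\<^sup>2))"
    using slice_bound[OF assms] by blast
  define K where "K = (\<integral>y. exp (- e * (\<Sum>k\<in>I - {l}. (y k)\<^sup>2)) \<partial>lborel_on (I - {l}))"
  have int: "integrable (lborel_on (I - {l})) (\<lambda>y. exp (- e * (\<Sum>k\<in>I - {l}. (y k)\<^sup>2)))"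
    using I C by (intro integrable_exp_sum_squares) auto
  have "\<bar>slice_integral I l U f s\<bar> \<le> (C * K) * exp (- e * s\<^sup>2)" for s
  proof -
    have "\<bar>slice_integral I l U f s\<bar> \<le> (\<integral>y. \<bar>(\<Prod>k\<in>I - {l}. indicator (U k) (y k)) * f (y(l := s))\<bar> \<partial>lborel_on (I - {l}))"
      unfolding slice_integral_def by (rule integral_abs_bound)
    also have "\<dots> \<le> (\<integral>y. C * exp (- e * s\<^sup>2) * exp (- e * (\<Sum>k\<in>I - {l}. (y k)\<^sup>2)) \<partial>lborel_on (I - {l}))"
      using C(3) by (intro integral_mono integrable_mult_right int integrable_abs slice_integrable assms) auto
    also have "\<dots> = (C * K) * exp (- e * s\<^sup>2)" by (simp add: K_def)
    finally show ?thesis .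
  qed
  moreover have "K \<ge> 0" unfolding K_def by (intro integral_nonneg_AE) auto
  ultimately show ?thesis using C by (intro exI[of _ "C * K"] exI[of _ e]) auto
qed

lemma slice_integral_integrable:
  assumes "gaussian_bounded I f" "\<And>y s. isCont (\<lambda>s. f (y(l := s))) s"
  shows "integrable lborel (slice_integral I l U f)"
proof -
  obtain C e where C: "C \<ge> 0" "e > 0" "\<And>s. \<bar>slice_integral I l U f s\<bar> \<le> C * exp (- e * s\<^sup>2)"
    using slice_integral_bound[OF assms(1)] by blast
  have "continuous_on UNIV (slice_integral I l U f)"
    by (intro continuous_at_imp_continuous_on ballI slice_integral_isCont assms)
  hence meas: "slice_integral I l U f \<in> borel_measurable lborel"
    by (simp add: borel_measurable_continuous_onI)
  show ?thesis
  proof (rule Bochner_Integration.integrable_bound[OF _ meas])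
    show "integrable lborel (\<lambda>s. C * exp (- e * s\<^sup>2))"
      by (intro integrable_mult_right integrable_exp_square C)
    show "AE s in lborel. norm (slice_integral I l U f s) \<le> norm (C * exp (- e * s\<^sup>2))"
      using C by (intro AE_I2) simp
  qed
qed

lemma slice_integral_limits:
  assumes "gaussian_bounded I f"
  shows "(slice_integral I l U f \<longlongrightarrow> 0) at_top" "(slice_integral I l U f \<longlongrightarrow> 0) at_bot"
proof -
  obtain C e where C: "C \<ge> 0" "e > 0" "\<And>s. \<bar>slice_integral I l U f s\<bar> \<le> C * exp (- e * s\<^sup>2)"
    using slice_integral_bound[OF assms] by blast
  have lims: "((\<lambda>s. C * exp (- e * s\<^sup>2)) \<longlongrightarrow> 0) at_top" "((\<lambda>s. C * exp (- e * s\<^sup>2)) \<longlongrightarrow> 0) at_bot"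
    using C by (real_asymp)+
  have bound: "norm (slice_integral I l U f s) \<le> C * exp (- e * s\<^sup>2)" for s
    using C(3) by simp
  show "(slice_integral I l U f \<longlongrightarrow> 0) at_top"
    by (rule Lim_null_comparison[OF always_eventually[OF allI[OF bound]] lims(1)])
  show "(slice_integral I l U f \<longlongrightarrow> 0) at_bot"
    by (rule Lim_null_comparison[OF always_eventually[OF allI[OF bound]] lims(2)])
qed

lemma integral_by_slices:
  assumes f: "gaussian_bounded I f" "\<And>y s. isCont (\<lambda>s. f (y(l := s))) s"
  shows "(\<integral>z. (\<Prod>k\<in>I. indicator (U k) (z k)) * f z \<partial>lborel_on I) =
         (\<integral>s. indicator (U l) s * slice_integral I l U f s \<partial>lborel)"
proof -
  interpret product_sigma_finite "\<lambda>_. lborel :: real measure" by (rule product_sigma_finite_lborel)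
  let ?J = "I - {l}"
  let ?F = "\<lambda>z. (\<Prod>k\<in>I. indicator (U k) (z k)) * f z"
  have un: "{l} \<union> ?J = I" using I by auto
  have "(\<lambda>z. \<Prod>k\<in>I. indicator (U k) (z k) :: real) \<in> borel_measurable (lborel_on I)"
    by (rule borel_measurable_prod, rule measurable_indicator_component[where U = U, OF U])
  hence meas: "?F \<in> borel_measurable (lborel_on I)"
    by (rule borel_measurable_times[OF _ gaussian_bounded_measurable[OF f(1)]])
  have int: "integrable (lborel_on I) ?F"
    by (rule Bochner_Integration.integrable_bound[OF gaussian_bounded_integrable[OF I(1) f(1)] meas])
       (auto intro!: AE_I2 abs_box_indicator_le)
  have "integral\<^sup>L (lborel_on I) ?F =
        (\<integral>x. (\<integral>y. ?F (merge {l} ?J (x, y)) \<partial>lborel_on ?J) \<partial>lborel_on {l})"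
    using product_integral_fold[of "{l}" ?J ?F] I int unfolding un by simp
  also have "\<dots> = (\<integral>x. indicator (U l) (x l) * slice_integral I l U f (x l) \<partial>lborel_on {l})"
  proof (rule Bochner_Integration.integral_cong[OF refl])
    fix x :: "nat \<Rightarrow> real"
    have "(\<integral>y. ?F (merge {l} ?J (x, y)) \<partial>lborel_on ?J) =
          (\<integral>y. indicator (U l) (x l) * ((\<Prod>k\<in>?J. indicator (U k) (y k)) * f (y(l := x l))) \<partial>lborel_on ?J)"
    proof (rule Bochner_Integration.integral_cong[OF refl])
      fix y assume "y \<in> space (lborel_on ?J)"
      hence "merge {l} ?J (x, y) = y(l := x l)"
        by (auto simp: merge_def space_PiM PiE_iff extensional_def fun_eq_iff)
      moreover have "(\<Prod>k\<in>I. indicator (U k) ((y(l := x l)) k) :: real) =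
                     indicator (U l) (x l) * (\<Prod>k\<in>?J. indicator (U k) (y k))"
        using I by (subst prod.remove[of _ l]) auto
      ultimately show "?F (merge {l} ?J (x, y)) =
        indicator (U l) (x l) * ((\<Prod>k\<in>?J. indicator (U k) (y k)) * f (y(l := x l)))"
        by (simp add: mult.assoc)
    qed
    thus "(\<integral>y. ?F (merge {l} ?J (x, y)) \<partial>lborel_on ?J) = indicator (U l) (x l) * slice_integral I l U f (x l)"
      by (simp add: slice_integral_def)
  qed
  also have "\<dots> = (\<integral>s. indicator (U l) s * slice_integral I l U f s \<partial>lborel)"
    using slice_integral_integrable[OF f] U[of l]
    by (intro product_integral_singleton[of "\<lambda>s. indicator (U l) s * slice_integral I l U f s" l])
       (auto intro!: borel_measurable_times borel_measurable_indicator)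
  finally show ?thesis .
qed

end

section \<open>Derivatives with respect to endpoints\<close>

lemma interval_union_borel [measurable]: "interval_union r a l \<in> sets borel"
  unfolding interval_union_def by (intro sets.finite_UN) auto

definition box_integral :: "(nat \<Rightarrow> nat) \<Rightarrow> (nat \<Rightarrow> nat \<Rightarrow> ereal) \<Rightarrow> nat \<Rightarrow> ((nat \<Rightarrow> real) \<Rightarrow> real) \<Rightarrow> real" where
  "box_integral r a m f = (\<integral>z. (\<Prod>k\<le>m. indicator (interval_union r a k) (z k)) * f z \<partial>lborel_on {..m})"

lemma box_integrable:
  assumes "gaussian_bounded {..m} f"
  shows "integrable (lborel_on {..m}) (\<lambda>z. (\<Prod>k\<le>m. indicator (interval_union r a k) (z k)) * f z)"
proof -
  have "(\<lambda>z. \<Prod>k\<le>m. indicator (interval_union r a k) (z k) :: real) \<in> borel_measurable (lborel_on {..m})"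
    by (rule borel_measurable_prod, rule measurable_indicator_component[where U = "interval_union r a"]) simp_all
  from borel_measurable_times[OF this gaussian_bounded_measurable[OF assms]]
  have meas: "(\<lambda>z. (\<Prod>k\<le>m. indicator (interval_union r a k) (z k)) * f z) \<in> borel_measurable (lborel_on {..m})" .
  show ?thesis
  proof (rule Bochner_Integration.integrable_bound[OF gaussian_bounded_integrable[OF _ assms] meas])
    show "AE z in lborel_on {..m}. norm ((\<Prod>k\<le>m. indicator (interval_union r a k) (z k)) * f z) \<le> norm (f z)"
      unfolding real_norm_def by (intro AE_I2 abs_box_indicator_le)
  qed simp
qed

lemma box_integral_cmult:
  assumes "gaussian_bounded {..m} f"
  shows "box_integral r a m (\<lambda>z. c * f z) = c * box_integral r a m f"
  unfolding box_integral_def by (simp add: mult.left_commute[of _ c])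

lemma box_integral_add:
  assumes "gaussian_bounded {..m} f" "gaussian_bounded {..m} g"
  shows "box_integral r a m (\<lambda>z. f z + g z) = box_integral r a m f + box_integral r a m g"
  unfolding box_integral_def using box_integrable[OF assms(1), of r a] box_integrable[OF assms(2), of r a]
  by (simp add: distrib_left)

lemma gaussian_bounded_sum:
  assumes "finite J" "\<And>l. l \<in> J \<Longrightarrow> gaussian_bounded I (f l)" "gaussian_bounded I h"
  shows "gaussian_bounded I (\<lambda>z. \<Sum>l\<in>J. f l z)"
  using assms(1,2)
proof (induction J rule: finite_induct)
  case empty
  show ?case using gaussian_bounded_cmult[OF assms(3), of 0] by simp
qed (simp add: gaussian_bounded_add)

lemma box_integral_sum:
  assumes "finite J" "\<And>l. l \<in> J \<Longrightarrow> gaussian_bounded {..m} (f l)"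
  shows "box_integral r a m (\<lambda>z. \<Sum>l\<in>J. c l * f l z) = (\<Sum>l\<in>J. c l * box_integral r a m (f l))"
  using assms
proof (induction J rule: finite_induct)
  case empty
  show ?case by (simp add: box_integral_def)
next
  case (insert x J)
  have "gaussian_bounded {..m} (\<lambda>z. \<Sum>l\<in>J. c l * f l z)"
    by (rule gaussian_bounded_sum[OF insert(1) gaussian_bounded_cmult]) (use insert in auto)
  thus ?case using insert
    by (simp add: box_integral_add gaussian_bounded_cmult box_integral_cmult)
qed

lemma slice_integral_cong:
  assumes "\<And>k. k \<in> I - {l} \<Longrightarrow> U k = U' k"
  shows "slice_integral I l U f = slice_integral I l U' f"
  unfolding slice_integral_def using assms
  by (intro ext Bochner_Integration.integral_cong arg_cong2[of _ _ _ _ "(*)"] prod.cong refl) auto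

lemma slice_integral_coordinate_power:
  "slice_integral I l U (\<lambda>z. z l ^ e * f z) s = s ^ e * slice_integral I l U f s"
  unfolding slice_integral_def by (simp add: mult.left_commute[of _ "s ^ e"])

context
  fixes m :: nat and r :: "nat \<Rightarrow> nat" and t :: "nat \<Rightarrow> real" and a :: "nat \<Rightarrow> nat \<Rightarrow> ereal" and l :: nat
  assumes adm: "admissible m r t a" and l: "l \<le> m"
begin

text \<open>
  The density is computed with \<open>a\<close>, which may differ from \<open>a'\<close> at the level \<open>l\<close>. This makes the
  right-hand side an explicit function of the endpoints at that level.
\<close>

lemma box_integral_endpoint_sum:
  assumes "admissible m r t a'" "\<And>k. k \<noteq> l \<Longrightarrow> a' k = a k"
    and f: "gaussian_bounded {..m} f" "\<And>y s. isCont (\<lambda>s. f (y(l := s))) s"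
  shows "box_integral r a' m f = (\<Sum>j = 1..2 * r l. (-1) ^ j *
           lower_integral (slice_integral {..m} l (interval_union r a) f) (a' l j))"
proof -
  have "slice_integral {..m} l (interval_union r a') f = slice_integral {..m} l (interval_union r a) f"
    by (rule slice_integral_cong) (use assms(2) in \<open>auto simp: interval_union_def\<close>)
  moreover have "integrable lborel (slice_integral {..m} l (interval_union r a') f)"
    by (rule slice_integral_integrable) (use l f in auto)
  moreover have "box_integral r a' m f = (\<integral>s. indicator (interval_union r a' l) s *
      slice_integral {..m} l (interval_union r a') f s \<partial>lborel)"
    unfolding box_integral_def by (rule integral_by_slices) (use l f in auto)
  ultimately show ?thesis
    using integral_interval_union[of r l a' "slice_integral {..m} l (interval_union r a') f"] assms(1) l
    by (simp add: admissible_def)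
qed

lemma endpoint_derivative:
  assumes j: "j \<in> {1..2 * r l}" "\<bar>a l j\<bar> \<noteq> \<infinity>"
    and f: "gaussian_bounded {..m} f" "\<And>y s. isCont (\<lambda>s. f (y(l := s))) s"
  shows "((\<lambda>s. box_integral r (a(l := (a l)(j := ereal s))) m f) has_real_derivative
           (-1) ^ j * slice_integral {..m} l (interval_union r a) f (real_of_ereal (a l j)))
         (at (real_of_ereal (a l j)))"
proof -
  define h where "h = slice_integral {..m} l (interval_union r a) f"
  define x where "x = real_of_ereal (a l j)"
  define K where "K = (\<Sum>i\<in>{1..2 * r l} - {j}. (-1) ^ i * lower_integral h (a l i))"
  have h: "integrable lborel h" "isCont h s" for s
    unfolding h_def using l f by (intro slice_integral_integrable slice_integral_isCont; simp)+
  have "Inr (l, j) \<in> coords m r a" using l j by (auto simp: coords_def)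
  \<comment> \<open>The formula for the integral holds while the moving endpoint stays between its neighbours.\<close>
  from eventually_admissible[OF adm this]
  have "\<forall>\<^sub>F s in nhds x. admissible m r t (a(l := (a l)(j := ereal s)))"
    by (simp add: position_def x_def)
  hence ev: "\<forall>\<^sub>F s in nhds x. box_integral r (a(l := (a l)(j := ereal s))) m f =
           K + (-1) ^ j * lower_integral h (ereal s)"
  proof eventually_elim
    case (elim s)
    have "box_integral r (a(l := (a l)(j := ereal s))) m f =
          (\<Sum>i = 1..2 * r l. (-1) ^ i * lower_integral h ((a(l := (a l)(j := ereal s))) l i))"
      unfolding h_def by (rule box_integral_endpoint_sum[OF elim _ f]) simp
    also have "\<dots> = (-1) ^ j * lower_integral h (ereal s) +
       (\<Sum>i\<in>{1..2 * r l} - {j}. (-1) ^ i * lower_integral h ((a(l := (a l)(j := ereal s))) l i))"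
      using j by (subst sum.remove[of _ j]) auto
    also have "(\<Sum>i\<in>{1..2 * r l} - {j}. (-1) ^ i * lower_integral h ((a(l := (a l)(j := ereal s))) l i)) = K"
      unfolding K_def by (intro sum.cong) auto
    finally show ?case by (simp only: add.commute)
  qed
  have "((\<lambda>s. K + (-1) ^ j * lower_integral h (ereal s)) has_real_derivative 0 + (-1) ^ j * h x) (at x)"
    by (rule DERIV_add[OF DERIV_const DERIV_cmult[OF DERIV_lower_integral[OF h]]])
  from iffD2[OF DERIV_cong_ev[OF refl ev refl] this]
  have "((\<lambda>s. box_integral r (a(l := (a l)(j := ereal s))) m f) has_real_derivative (-1) ^ j * h x) (at x)"
    by (simp only: add_0_left)
  thus ?thesis unfolding h_def x_def .
qed

text \<open>
  The divergence theorem for a product of interval unions in one coordinate direction. Together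
  with \<open>endpoint_derivative\<close> it converts derivatives with respect to endpoints into derivatives
  of the integrand.
\<close>

lemma box_integral_divergence:
  assumes f: "gaussian_bounded {..m} f" and f': "gaussian_bounded {..m} f'"
    and der: "\<And>y s. ((\<lambda>s. f (y(l := s))) has_real_derivative f' (y(l := s))) (at s)"
    and cont: "\<And>y s. isCont (\<lambda>s. f' (y(l := s))) s"
  shows "box_integral r a m f' = (\<Sum>j | j \<in> {1..2 * r l} \<and> \<bar>a l j\<bar> \<noteq> \<infinity>. (-1) ^ j *
           slice_integral {..m} l (interval_union r a) f (real_of_ereal (a l j)))"
proof -
  let ?h = "slice_integral {..m} l (interval_union r a) f"
  let ?h' = "slice_integral {..m} l (interval_union r a) f'"
  have "lower_integral ?h' x = (if \<bar>x\<bar> = \<infinity> then 0 else ?h (real_of_ereal x))" for x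
    by (rule lower_integral_derivative)
       (use l f f' der cont in \<open>auto intro!: slice_integral_integrable slice_integral_isCont slice_integral_DERIV slice_integral_limits\<close>)
  hence "box_integral r a m f' = (\<Sum>j = 1..2 * r l. (-1) ^ j * (if \<bar>a l j\<bar> = \<infinity> then 0 else ?h (real_of_ereal (a l j))))"
    using box_integral_endpoint_sum[OF adm _ f' cont] by simp
  also have "\<dots> = (\<Sum>j = 1..2 * r l. if \<bar>a l j\<bar> \<noteq> \<infinity> then (-1) ^ j * ?h (real_of_ereal (a l j)) else 0)"
    by (intro sum.cong) auto
  also have "\<dots> = (\<Sum>j | j \<in> {1..2 * r l} \<and> \<bar>a l j\<bar> \<noteq> \<infinity>. (-1) ^ j * ?h (real_of_ereal (a l j)))"
    by (rule sum.inter_filter[symmetric]) simp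
  finally show ?thesis .
qed

end

text \<open>
  The exponent \<open>e\<close> is 0 when the endpoints are translated and 1 when they are dilated.
\<close>

lemma has_D_box_integral:
  fixes F :: "(nat \<Rightarrow> real) \<Rightarrow> (nat \<Rightarrow> real) \<Rightarrow> real"
  assumes adm: "admissible m r t a"
    and F: "gaussian_bounded {..m} (F t)" "\<And>l y s. l \<le> m \<Longrightarrow> isCont (\<lambda>s. F t (y(l := s))) s"
    and time: "\<And>l. l \<in> {1..m} \<Longrightarrow>
        ((\<lambda>s. box_integral r a m (F (t(l := s)))) has_real_derivative box_integral r a m (T l)) (at (t l))"
    and f': "\<And>l. l \<le> m \<Longrightarrow> gaussian_bounded {..m} (f' l)"
    and der: "\<And>l y s. l \<le> m \<Longrightarrow>
        ((\<lambda>s. s ^ e * F t (y(l := s))) has_real_derivative f' l (y(l := s))) (at s)"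
    and cont: "\<And>l y s. l \<le> m \<Longrightarrow> isCont (\<lambda>s. f' l (y(l := s))) s"
    and w: "\<And>l. w (Inl l) = \<theta> l" "\<And>l j. w (Inr (l, j)) = v l * real_of_ereal (a l j) ^ e"
  shows "has_D m r w t a (\<lambda>t a. box_integral r a m (F t))
           ((\<Sum>l = 1..m. \<theta> l * box_integral r a m (T l)) + (\<Sum>l\<le>m. v l * box_integral r a m (f' l)))"
proof (rule has_D_DERIV)
  define G where "G = (\<lambda>c. case c of Inl l \<Rightarrow> box_integral r a m (T l)
    | Inr (l, j) \<Rightarrow> (-1) ^ j * slice_integral {..m} l (interval_union r a) (F t) (real_of_ereal (a l j)))"
  show "(along c (\<lambda>t a. box_integral r a m (F t)) t a has_real_derivative G c) (at (position c t a))"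
    if c: "c \<in> coords m r a" for c
  proof (cases c)
    case (Inl l)
    thus ?thesis using time[of l] c by (auto simp: along_def[abs_def] position_def G_def coords_def)
  next
    case (Inr lj)
    then obtain l j where c': "c = Inr (l, j)" by (cases lj) auto
    hence "l \<le> m" "j \<in> {1..2 * r l}" "\<bar>a l j\<bar> \<noteq> \<infinity>" using c by (auto simp: coords_def)
    from endpoint_derivative[OF adm this F(1) F(2)[OF this(1)]]
    show ?thesis by (simp add: c' along_def[abs_def] position_def G_def)
  qed
  have "v l * box_integral r a m (f' l) =
        (\<Sum>j | j \<in> {1..2 * r l} \<and> \<bar>a l j\<bar> \<noteq> \<infinity>. w (Inr (l, j)) * G (Inr (l, j)))" if l: "l \<le> m" for l
  proof -
    have "gaussian_bounded {..m} (\<lambda>z. z l ^ e * F t z)"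
      by (rule gaussian_bounded_power) (use l F in auto)
    moreover have "((\<lambda>s. (y(l := s)) l ^ e * F t (y(l := s))) has_real_derivative f' l (y(l := s))) (at s)" for y s
      unfolding fun_upd_same by (rule der[OF l])
    ultimately have "box_integral r a m (f' l) = (\<Sum>j | j \<in> {1..2 * r l} \<and> \<bar>a l j\<bar> \<noteq> \<infinity>. (-1) ^ j *
       slice_integral {..m} l (interval_union r a) (\<lambda>z. z l ^ e * F t z) (real_of_ereal (a l j)))"
      by (rule box_integral_divergence[OF adm l _ f'[OF l] _ cont[OF l]])
    hence "v l * box_integral r a m (f' l) = (\<Sum>j | j \<in> {1..2 * r l} \<and> \<bar>a l j\<bar> \<noteq> \<infinity>. v l * ((-1) ^ j *
       (real_of_ereal (a l j) ^ e * slice_integral {..m} l (interval_union r a) (F t) (real_of_ereal (a l j)))))"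
      unfolding slice_integral_coordinate_power by (simp only: sum_distrib_left)
    also have "\<dots> = (\<Sum>j | j \<in> {1..2 * r l} \<and> \<bar>a l j\<bar> \<noteq> \<infinity>. w (Inr (l, j)) * G (Inr (l, j)))"
      by (rule sum.cong[OF refl]) (simp add: w(2) G_def mult_ac)
    finally show ?thesis .
  qed
  thus "(\<Sum>l = 1..m. \<theta> l * box_integral r a m (T l)) + (\<Sum>l\<le>m. v l * box_integral r a m (f' l)) =
        (\<Sum>c\<in>coords m r a. w c * G c)"
    unfolding sum_coords by (simp add: w(1) G_def)
qed

section \<open>The energy of the one-particle chain\<close>

text \<open>
  The exponent of the Ornstein-Uhlenbeck transition density over the time \<open>s\<close>.
\<close>

definition step_energy :: "real \<Rightarrow> real \<Rightarrow> real \<Rightarrow> real" where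
  "step_energy s x y = (y - exp (- s) * x)\<^sup>2 / (1 - (exp (- s))\<^sup>2)"

definition step_energy_x :: "real \<Rightarrow> real \<Rightarrow> real \<Rightarrow> real" where
  "step_energy_x s x y = - 2 * exp (- s) * (y - exp (- s) * x) / (1 - (exp (- s))\<^sup>2)"

definition step_energy_y :: "real \<Rightarrow> real \<Rightarrow> real \<Rightarrow> real" where
  "step_energy_y s x y = 2 * (y - exp (- s) * x) / (1 - (exp (- s))\<^sup>2)"

definition step_energy_s :: "real \<Rightarrow> real \<Rightarrow> real \<Rightarrow> real" where
  "step_energy_s s x y = 2 * exp (- s) * x * (y - exp (- s) * x) / (1 - (exp (- s))\<^sup>2)
     - 2 * (exp (- s))\<^sup>2 * (y - exp (- s) * x)\<^sup>2 / (1 - (exp (- s))\<^sup>2)\<^sup>2"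

lemma one_minus_exp_pos: "s > 0 \<Longrightarrow> 1 - (exp (- s))\<^sup>2 > (0 :: real)"
  by (simp add: power_less_one_iff abs_square_less_1)

lemma DERIV_step_energy_x: "((\<lambda>x. step_energy s x y) has_real_derivative step_energy_x s x y) (at x)"
  unfolding step_energy_def step_energy_x_def divide_inverse
  by (rule derivative_eq_intros refl | simp)+

lemma DERIV_step_energy_y: "((\<lambda>y. step_energy s x y) has_real_derivative step_energy_y s x y) (at y)"
  unfolding step_energy_def step_energy_y_def divide_inverse
  by (rule derivative_eq_intros refl | simp)+

lemma step_energy_s_eq:
  "step_energy_s s x y = exp (- s) * x * step_energy_y s x y - (exp (- s))\<^sup>2 / 2 * (step_energy_y s x y)\<^sup>2"
proof -
  define I where "I = inverse (1 - (exp (- s))\<^sup>2)"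
  have I2: "inverse ((1 - (exp (- s))\<^sup>2)\<^sup>2) = I\<^sup>2" by (simp add: I_def power_inverse)
  define u where "u = y - exp (- s) * x"
  show ?thesis
    unfolding step_energy_s_def step_energy_y_def divide_inverse[of _ "1 - (exp (- s))\<^sup>2"]
      divide_inverse[of _ "(1 - (exp (- s))\<^sup>2)\<^sup>2"] I2 I_def[symmetric] u_def[symmetric]
    by (simp add: power_mult_distrib)
qed

lemma DERIV_step_energy_s:
  assumes "s > 0"
  shows "((\<lambda>s. step_energy s x y) has_real_derivative step_energy_s s x y) (at s)"
proof -
  define c where "c = exp (- s)"
  define I where "I = inverse (1 - c\<^sup>2)"
  have d: "1 - c\<^sup>2 \<noteq> 0" using one_minus_exp_pos[OF assms] by (simp add: c_def)
  have I2: "inverse ((1 - c\<^sup>2)\<^sup>2) = I\<^sup>2" by (simp add: I_def power_inverse)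
  have E: "((\<lambda>s. exp (- s)) has_real_derivative - c) (at s)"
    by (auto intro!: derivative_eq_intros simp: c_def)
  have "((\<lambda>c. 1 - c\<^sup>2) has_real_derivative - 2 * c) (at c)"
    by (auto intro!: derivative_eq_intros)
  from DERIV_inverse_fun[OF this d]
  have "((\<lambda>c. inverse (1 - c\<^sup>2)) has_real_derivative 2 * c * I\<^sup>2) (at c)"
    by (simp add: I_def power2_eq_square)
  moreover have "((\<lambda>c. (y - c * x)\<^sup>2) has_real_derivative - 2 * x * (y - c * x)) (at c)"
    by (auto intro!: derivative_eq_intros)
  ultimately have "((\<lambda>c. (y - c * x)\<^sup>2 * inverse (1 - c\<^sup>2)) has_real_derivative
      (- 2 * x * (y - c * x)) * inverse (1 - c\<^sup>2) + (2 * c * I\<^sup>2) * (y - c * x)\<^sup>2) (at (exp (- s)))"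
    unfolding c_def[symmetric] by (intro DERIV_mult)
  from DERIV_chain2[OF this E]
  have "((\<lambda>s. step_energy s x y) has_real_derivative
     ((- 2 * x * (y - c * x)) * I + (2 * c * I\<^sup>2) * (y - c * x)\<^sup>2) * (- c)) (at s)"
    by (simp add: step_energy_def divide_inverse I_def)
  also have "((- 2 * x * (y - c * x)) * I + (2 * c * I\<^sup>2) * (y - c * x)\<^sup>2) * (- c) = step_energy_s s x y"
    unfolding step_energy_s_def c_def[symmetric] divide_inverse I2 I_def[symmetric]
    by (simp add: algebra_simps power2_eq_square)
  finally show ?thesis .
qed

definition increasing_times :: "nat \<Rightarrow> (nat \<Rightarrow> real) \<Rightarrow> bool" where
  "increasing_times m t \<longleftrightarrow> (\<forall>l\<in>{1..m}. t (l - 1) < t l)"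

lemma admissible_increasing: "admissible m r t a \<Longrightarrow> increasing_times m t"
  unfolding increasing_times_def admissible_def
proof safe
  fix l assume "\<forall>l<m. t l < t (l + 1)" "l \<in> {1..m}"
  thus "t (l - 1) < t l" by (cases l) auto
qed

text \<open>
  The exponent of the joint density of a stationary Ornstein-Uhlenbeck particle at the times
  \<open>t 0, \<dots>, t m\<close>.
\<close>

definition energy :: "nat \<Rightarrow> (nat \<Rightarrow> real) \<Rightarrow> (nat \<Rightarrow> real) \<Rightarrow> real" where
  "energy m t z = (z 0)\<^sup>2 + (\<Sum>l = 1..m. step_energy (t l - t (l - 1)) (z (l - 1)) (z l))"

definition energy_z :: "nat \<Rightarrow> (nat \<Rightarrow> real) \<Rightarrow> nat \<Rightarrow> (nat \<Rightarrow> real) \<Rightarrow> real" where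
  "energy_z m t l z =
     (if l = 0 then 2 * z 0 else step_energy_y (t l - t (l - 1)) (z (l - 1)) (z l))
   + (if l < m then step_energy_x (t (Suc l) - t l) (z l) (z (Suc l)) else 0)"

definition energy_t :: "nat \<Rightarrow> (nat \<Rightarrow> real) \<Rightarrow> nat \<Rightarrow> (nat \<Rightarrow> real) \<Rightarrow> real" where
  "energy_t m t l z = step_energy_s (t l - t (l - 1)) (z (l - 1)) (z l)
     - (if l < m then step_energy_s (t (Suc l) - t l) (z l) (z (Suc l)) else 0)"

lemma sum_two_deltas:
  fixes A B :: "nat \<Rightarrow> real"
  shows "(\<Sum>k = 1..m. (if k = l then A k else 0) + (if k = Suc l then B k else 0)) =
         (if l \<in> {1..m} then A l else 0) + (if l < m then B (Suc l) else 0)"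
  by (simp add: sum.distrib Suc_le_eq)

lemma DERIV_energy_z:
  assumes l: "l \<le> m"
  shows "((\<lambda>s. energy m t (y(l := s))) has_real_derivative energy_z m t l (y(l := s))) (at s)"
proof -
  let ?z = "\<lambda>s. y(l := s)" and ?s = "\<lambda>k. t k - t (k - 1)"
  have "((\<lambda>s. step_energy (?s k) (?z s (k - 1)) (?z s k)) has_real_derivative
          (if k = l then step_energy_y (?s k) (?z s (k - 1)) (?z s k) else 0)
        + (if k = Suc l then step_energy_x (?s k) (?z s (k - 1)) (?z s k) else 0)) (at s)" if k: "k \<in> {1..m}" for k
  proof -
    consider (1) "k = l" "k - 1 \<noteq> l" "k \<noteq> Suc l" | (2) "k = Suc l" "k - 1 = l" "k \<noteq> l"
      | (3) "k \<noteq> l" "k - 1 \<noteq> l" "k \<noteq> Suc l"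
    proof -
      have "k \<ge> 1" using k by simp
      thus thesis using that by (cases "k = l"; cases "k = Suc l") auto
    qed
    thus ?thesis
    proof cases
      case 1
      thus ?thesis using DERIV_step_energy_y[of "?s k" "y (k - 1)" s] by simp
    next
      case 2
      thus ?thesis using DERIV_step_energy_x[of "?s k" "y k" s] by simp
    qed simp
  qed
  hence "((\<lambda>s. \<Sum>k = 1..m. step_energy (?s k) (?z s (k - 1)) (?z s k)) has_real_derivative
     (\<Sum>k = 1..m. (if k = l then step_energy_y (?s k) (?z s (k - 1)) (?z s k) else 0)
        + (if k = Suc l then step_energy_x (?s k) (?z s (k - 1)) (?z s k) else 0))) (at s)"
    by (rule DERIV_sum)
  moreover have "((\<lambda>s. (?z s 0)\<^sup>2) has_real_derivative (if l = 0 then 2 * ?z s 0 else 0)) (at s)"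
    by (cases "l = 0") (auto intro!: derivative_eq_intros)
  ultimately have "((\<lambda>s. energy m t (?z s)) has_real_derivative
     (if l = 0 then 2 * ?z s 0 else 0) +
     ((if l \<in> {1..m} then step_energy_y (?s l) (?z s (l - 1)) (?z s l) else 0)
      + (if l < m then step_energy_x (?s (Suc l)) (?z s (Suc l - 1)) (?z s (Suc l)) else 0))) (at s)"
    unfolding energy_def sum_two_deltas by (intro DERIV_add)
  moreover have "(if l = 0 then 2 * ?z s 0 else 0) +
     ((if l \<in> {1..m} then step_energy_y (?s l) (?z s (l - 1)) (?z s l) else 0)
      + (if l < m then step_energy_x (?s (Suc l)) (?z s (Suc l - 1)) (?z s (Suc l)) else 0)) = energy_z m t l (?z s)"
    using l by (auto simp: energy_z_def)
  ultimately show ?thesis by simp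
qed

lemma DERIV_energy_t:
  assumes l: "l \<in> {1..m}" and inc: "increasing_times m (t(l := s))"
  shows "((\<lambda>s. energy m (t(l := s)) z) has_real_derivative energy_t m (t(l := s)) l z) (at s)"
proof -
  let ?s = "\<lambda>s k. (t(l := s)) k - (t(l := s)) (k - 1)"
  have "((\<lambda>s. step_energy (?s s k) (z (k - 1)) (z k)) has_real_derivative
          (if k = l then step_energy_s (?s s k) (z (k - 1)) (z k) else 0)
        + (if k = Suc l then - step_energy_s (?s s k) (z (k - 1)) (z k) else 0)) (at s)" if k: "k \<in> {1..m}" for k
  proof -
    have pos: "?s s k > 0" using inc k unfolding increasing_times_def by (metis diff_gt_0_iff_gt)
    consider (1) "k = l" "k - 1 \<noteq> l" "k \<noteq> Suc l" | (2) "k = Suc l" "k - 1 = l" "k \<noteq> l"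
      | (3) "k \<noteq> l" "k - 1 \<noteq> l" "k \<noteq> Suc l"
    proof -
      have "k \<ge> 1" using k by simp
      thus thesis using that by (cases "k = l"; cases "k = Suc l") auto
    qed
    thus ?thesis
    proof cases
      case 1
      have "((\<lambda>s. step_energy (s - t (k - 1)) (z (k - 1)) (z k)) has_real_derivative
              step_energy_s (s - t (k - 1)) (z (k - 1)) (z k) * 1) (at s)"
        by (rule DERIV_chain2[OF DERIV_step_energy_s]) (use pos 1 in \<open>auto intro!: derivative_eq_intros\<close>)
      thus ?thesis using 1 by simp
    next
      case 2
      have "((\<lambda>s. step_energy (t k - s) (z (k - 1)) (z k)) has_real_derivative
              step_energy_s (t k - s) (z (k - 1)) (z k) * (- 1)) (at s)"
        by (rule DERIV_chain2[OF DERIV_step_energy_s]) (use pos 2 in \<open>auto intro!: derivative_eq_intros\<close>)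
      thus ?thesis using 2 by simp
    qed simp
  qed
  hence "((\<lambda>s. \<Sum>k = 1..m. step_energy (?s s k) (z (k - 1)) (z k)) has_real_derivative
     (\<Sum>k = 1..m. (if k = l then step_energy_s (?s s k) (z (k - 1)) (z k) else 0)
        + (if k = Suc l then - step_energy_s (?s s k) (z (k - 1)) (z k) else 0))) (at s)"
    by (rule DERIV_sum)
  from DERIV_add[OF DERIV_const[of "(z 0)\<^sup>2"] this]
  have "((\<lambda>s. energy m (t(l := s)) z) has_real_derivative
     0 + ((if l \<in> {1..m} then step_energy_s (?s s l) (z (l - 1)) (z l) else 0)
      + (if l < m then - step_energy_s (?s s (Suc l)) (z (Suc l - 1)) (z (Suc l)) else 0))) (at s)"
    unfolding energy_def sum_two_deltas .
  moreover have "0 + ((if l \<in> {1..m} then step_energy_s (?s s l) (z (l - 1)) (z l) else 0)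
      + (if l < m then - step_energy_s (?s s (Suc l)) (z (Suc l - 1)) (z (Suc l)) else 0)) = energy_t m (t(l := s)) l z"
    using l by (auto simp: energy_t_def)
  ultimately show ?thesis by simp
qed

text \<open>
  The estimate \<open>y\<^sup>2 \<le> 2 * (y - c x)\<^sup>2 + 2 * (c x)\<^sup>2\<close> with \<open>c \<le> 1\<close> bounds each level by the previous one.
\<close>

lemma square_le_energy:
  assumes "increasing_times m t" "l \<le> m"
  shows "(z l)\<^sup>2 \<le> 2 ^ l * energy l t z"
  using assms(2)
proof (induction l)
  case (Suc l)
  define c where "c = exp (- (t (Suc l) - t l))"
  have s: "t (Suc l) - t l > 0"
  proof -
    have "Suc l \<in> {1..m}" using Suc.prems by simp
    hence "t (Suc l - 1) < t (Suc l)" using assms(1) unfolding increasing_times_def by blast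
    thus ?thesis by simp
  qed
  have d: "1 - c\<^sup>2 > 0" using one_minus_exp_pos[OF s] by (simp add: c_def)
  define u where "u = z (Suc l) - c * z l"
  have st: "step_energy (t (Suc l) - t l) (z l) (z (Suc l)) = u\<^sup>2 / (1 - c\<^sup>2)"
    by (simp add: step_energy_def u_def c_def)
  have u: "u\<^sup>2 \<le> u\<^sup>2 / (1 - c\<^sup>2)"
    using d by (simp add: pos_le_divide_eq mult_left_le)
  have "c\<^sup>2 * (z l)\<^sup>2 \<le> (z l)\<^sup>2"
    using d by (intro mult_right_le_one_le[THEN order_trans[OF eq_refl[OF mult.commute]]]) auto
  moreover have "(z (Suc l))\<^sup>2 \<le> 2 * u\<^sup>2 + 2 * (c\<^sup>2 * (z l)\<^sup>2)"
  proof -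
    have "2 * u\<^sup>2 + 2 * (c * z l)\<^sup>2 - (u + c * z l)\<^sup>2 = (u - c * z l)\<^sup>2"
      by (simp add: power2_eq_square algebra_simps)
    hence "(u + c * z l)\<^sup>2 \<le> 2 * u\<^sup>2 + 2 * (c * z l)\<^sup>2"
      using zero_le_power2[of "u - c * z l"] by linarith
    moreover have "z (Suc l) = u + c * z l" by (simp add: u_def)
    ultimately show ?thesis by (simp only: power_mult_distrib)
  qed
  moreover have "(z l)\<^sup>2 \<le> 2 ^ l * energy l t z" using Suc.IH Suc.prems by simp
  ultimately have "(z (Suc l))\<^sup>2 \<le> 2 * (u\<^sup>2 / (1 - c\<^sup>2)) + 2 * (2 ^ l * energy l t z)"
    using u by linarith
  also have "\<dots> \<le> 2 ^ Suc l * (u\<^sup>2 / (1 - c\<^sup>2)) + 2 * (2 ^ l * energy l t z)"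
    using d by (intro add_right_mono mult_right_mono divide_nonneg_pos) auto
  also have "\<dots> = 2 ^ Suc l * energy (Suc l) t z"
    unfolding energy_def using st by (simp add: algebra_simps)
  finally show ?case .
qed (simp add: energy_def)

lemma energy_mono:
  assumes "increasing_times m t" "l \<le> m"
  shows "energy l t z \<le> energy m t z"
proof -
  have "step_energy (t k - t (k - 1)) (z (k - 1)) (z k) \<ge> 0" if "k \<in> {1..m}" for k
  proof -
    have "t k - t (k - 1) > 0" using assms(1) that by (auto simp: increasing_times_def)
    from one_minus_exp_pos[OF this] show ?thesis
      unfolding step_energy_def by (intro divide_nonneg_pos) auto
  qed
  hence "(\<Sum>k = 1..l. step_energy (t k - t (k - 1)) (z (k - 1)) (z k)) \<le>
         (\<Sum>k = 1..m. step_energy (t k - t (k - 1)) (z (k - 1)) (z k))"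
    using assms(2) by (intro sum_mono2) auto
  thus ?thesis by (simp add: energy_def)
qed

text \<open>
  A lower bound for the quadratic form that does not depend on the times. This uniformity
  provides the dominating functions for derivatives with respect to the times.
\<close>

definition coercivity :: "nat \<Rightarrow> real" where
  "coercivity m = 1 / (real (Suc m) * 2 ^ m)"

lemma coercivity_pos: "coercivity m > 0"
  by (simp add: coercivity_def)

lemma energy_coercive:
  assumes "increasing_times m t"
  shows "coercivity m * (\<Sum>k\<le>m. (z k)\<^sup>2) \<le> energy m t z"
proof -
  have E: "energy m t z \<ge> 0"
    using energy_mono[OF assms, of 0 z] by (simp add: energy_def order_trans[OF zero_le_power2])
  have "(z k)\<^sup>2 \<le> 2 ^ m * energy m t z" if "k \<le> m" for k
  proof -
    have "(z k)\<^sup>2 \<le> 2 ^ k * energy k t z" by (rule square_le_energy[OF assms that])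
    also have "\<dots> \<le> 2 ^ k * energy m t z" using energy_mono[OF assms that] by simp
    also have "\<dots> \<le> 2 ^ m * energy m t z" using E that by (intro mult_right_mono power_increasing) auto
    finally show ?thesis .
  qed
  hence "(\<Sum>k\<le>m. (z k)\<^sup>2) \<le> (\<Sum>k\<le>m. 2 ^ m * energy m t z)" by (intro sum_mono) auto
  also have "\<dots> = real (Suc m) * 2 ^ m * energy m t z" by simp
  finally have "(\<Sum>k\<le>m. (z k)\<^sup>2) \<le> energy m t z * (real (Suc m) * 2 ^ m)" by (simp only: mult.commute)
  moreover have "real (Suc m) * 2 ^ m > 0" by simp
  ultimately show ?thesis
    unfolding coercivity_def times_divide_eq_left mult_1 by (simp only: pos_divide_le_eq)
qed

lemma exp_energy_bound:
  assumes "increasing_times m t"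
  shows "exp (- energy m t z) \<le> exp (- coercivity m * (\<Sum>k\<le>m. (z k)\<^sup>2))"
  using energy_coercive[OF assms, of z] by simp

lemma measurable_coordinate: "k \<in> I \<Longrightarrow> (\<lambda>z. z k) \<in> borel_measurable (lborel_on I)"
  using measurable_component_singleton[of k I "\<lambda>_. lborel :: real measure"] by simp

lemma energy_measurable: "energy m t \<in> borel_measurable (lborel_on {..m})"
  unfolding energy_def[abs_def] step_energy_def
  by (intro borel_measurable_add borel_measurable_sum borel_measurable_power borel_measurable_divide
        borel_measurable_diff borel_measurable_times borel_measurable_const measurable_coordinate) auto

lemma gaussian_bounded_exp_energy:
  assumes "increasing_times m t"
  shows "gaussian_bounded {..m} (\<lambda>z. exp (- energy m t z))"
  unfolding gaussian_bounded_def
proof (intro conjI exI allI)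
  show "(\<lambda>z. exp (- energy m t z)) \<in> borel_measurable (lborel_on {..m})"
    by (intro measurable_compose[OF _ borel_measurable_exp] borel_measurable_uminus energy_measurable)
  show "coercivity m > 0" by (rule coercivity_pos)
  show "\<bar>exp (- energy m t z)\<bar> \<le> 1 * exp (- coercivity m * (\<Sum>k\<le>m. (z k)\<^sup>2))" for z
    using exp_energy_bound[OF assms, of z] by simp
qed

lemma gaussian_bounded_step_energy_y:
  assumes "finite I" "k \<in> I" "k' \<in> I" "gaussian_bounded I g"
  shows "gaussian_bounded I (\<lambda>z. step_energy_y s (z k) (z k') * g z)"
proof -
  let ?d = "1 - (exp (- s))\<^sup>2"
  have "(\<lambda>z. step_energy_y s (z k) (z k') * g z) =
        (\<lambda>z. (2 / ?d) * (z k' * g z) + (- 2 * exp (- s) / ?d) * (z k * g z))"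
    by (simp add: step_energy_y_def fun_eq_iff diff_divide_distrib algebra_simps)
  thus ?thesis
    by (simp only:) (intro gaussian_bounded_add gaussian_bounded_cmult gaussian_bounded_coordinate assms)
qed

lemma gaussian_bounded_step_energy_x:
  assumes "finite I" "k \<in> I" "k' \<in> I" "gaussian_bounded I g"
  shows "gaussian_bounded I (\<lambda>z. step_energy_x s (z k) (z k') * g z)"
proof -
  have "(\<lambda>z. step_energy_x s (z k) (z k') * g z) = (\<lambda>z. (- exp (- s)) * (step_energy_y s (z k) (z k') * g z))"
    by (simp add: step_energy_x_def step_energy_y_def fun_eq_iff)
  thus ?thesis
    by (simp only:) (intro gaussian_bounded_cmult gaussian_bounded_step_energy_y assms)
qed

lemma gaussian_bounded_step_energy_s:
  assumes "finite I" "k \<in> I" "k' \<in> I" "gaussian_bounded I g"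
  shows "gaussian_bounded I (\<lambda>z. step_energy_s s (z k) (z k') * g z)"
proof -
  let ?c = "exp (- s)" and ?d = "1 - (exp (- s))\<^sup>2"
  have "(\<lambda>z. step_energy_s s (z k) (z k') * g z) =
        (\<lambda>z. ?c * (step_energy_y s (z k) (z k') * (z k * g z))
           + (- (?c\<^sup>2 / 2)) * (step_energy_y s (z k) (z k') * (step_energy_y s (z k) (z k') * g z)))"
    by (simp add: step_energy_s_eq fun_eq_iff left_diff_distrib power2_eq_square)
  thus ?thesis
    by (simp only:) (intro gaussian_bounded_add gaussian_bounded_cmult gaussian_bounded_coordinate gaussian_bounded_step_energy_y assms)
qed

lemma gaussian_bounded_energy_z:
  assumes "l \<le> m" "gaussian_bounded {..m} g"
  shows "gaussian_bounded {..m} (\<lambda>z. energy_z m t l z * g z)"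
proof -
  have zero: "gaussian_bounded {..m} (\<lambda>z. 0 * g z)" by (rule gaussian_bounded_cmult[OF assms(2)])
  have "gaussian_bounded {..m} (\<lambda>z. (if l = 0 then 2 * z 0 else step_energy_y (t l - t (l - 1)) (z (l - 1)) (z l)) * g z)"
    using gaussian_bounded_cmult[OF gaussian_bounded_coordinate[of "{..m}" 0, OF _ _ assms(2)], of 2]
      gaussian_bounded_step_energy_y[of "{..m}" "l - 1" l, OF _ _ _ assms(2)] assms(1)
    by (cases "l = 0") (auto simp: mult.assoc)
  moreover have "gaussian_bounded {..m} (\<lambda>z. (if l < m then step_energy_x (t (Suc l) - t l) (z l) (z (Suc l)) else 0) * g z)"
    using gaussian_bounded_step_energy_x[of "{..m}" l "Suc l", OF _ _ _ assms(2)] assms(1) zero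
    by (cases "l < m") auto
  ultimately show ?thesis
    unfolding energy_z_def distrib_right by (rule gaussian_bounded_add)
qed

lemma gaussian_bounded_energy_t:
  assumes "l \<in> {1..m}" "gaussian_bounded {..m} g"
  shows "gaussian_bounded {..m} (\<lambda>z. energy_t m t l z * g z)"
proof -
  have zero: "gaussian_bounded {..m} (\<lambda>z. 0 * g z)" by (rule gaussian_bounded_cmult[OF assms(2)])
  have "gaussian_bounded {..m} (\<lambda>z. step_energy_s (t l - t (l - 1)) (z (l - 1)) (z l) * g z)"
    using gaussian_bounded_step_energy_s[of "{..m}" "l - 1" l, OF _ _ _ assms(2)] assms(1) by auto
  moreover have "gaussian_bounded {..m} (\<lambda>z. (- 1) * ((if l < m then step_energy_s (t (Suc l) - t l) (z l) (z (Suc l)) else 0) * g z))"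
    using gaussian_bounded_step_energy_s[of "{..m}" l "Suc l", OF _ _ _ assms(2)] assms(1) zero
    by (intro gaussian_bounded_cmult, cases "l < m") auto
  moreover have "(\<lambda>z. energy_t m t l z * g z) =
    (\<lambda>z. step_energy_s (t l - t (l - 1)) (z (l - 1)) (z l) * g z
       + (- 1) * ((if l < m then step_energy_s (t (Suc l) - t l) (z l) (z (Suc l)) else 0) * g z))"
    by (simp add: energy_t_def left_diff_distrib)
  ultimately show ?thesis
    by (simp only:) (rule gaussian_bounded_add)
qed

section \<open>Differentiating the moments\<close>

definition moment_integrand :: "nat \<Rightarrow> nat \<Rightarrow> nat \<Rightarrow> (nat \<Rightarrow> real) \<Rightarrow> (nat \<Rightarrow> real) \<Rightarrow> real" where
  "moment_integrand m i j t z = z 0 ^ i * (z m ^ j * exp (- energy m t z))"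

definition moment :: "nat \<Rightarrow> (nat \<Rightarrow> nat) \<Rightarrow> nat \<Rightarrow> nat \<Rightarrow> dyson_fun" where
  "moment m r i j t a = box_integral r a m (moment_integrand m i j t)"

lemma gaussian_bounded_moment_integrand:
  "increasing_times m t \<Longrightarrow> gaussian_bounded {..m} (moment_integrand m i j t)"
  unfolding moment_integrand_def[abs_def]
  by (intro gaussian_bounded_power gaussian_bounded_exp_energy) auto

definition moment_integrand_t :: "nat \<Rightarrow> nat \<Rightarrow> nat \<Rightarrow> nat \<Rightarrow> (nat \<Rightarrow> real) \<Rightarrow> (nat \<Rightarrow> real) \<Rightarrow> real" where
  "moment_integrand_t m i j l t z = (- 1) * (energy_t m t l z * moment_integrand m i j t z)"

lemma gaussian_bounded_moment_integrand_t:
  "increasing_times m t \<Longrightarrow> l \<in> {1..m} \<Longrightarrow> gaussian_bounded {..m} (moment_integrand_t m i j l t)"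
  unfolding moment_integrand_t_def[abs_def]
  by (intro gaussian_bounded_cmult gaussian_bounded_energy_t gaussian_bounded_moment_integrand)

text \<open>
  Uniform as long as the time steps stay away from 0.
\<close>

lemma step_energy_s_bound:
  assumes "s \<ge> \<eta>" "\<eta> > 0"
  defines "d \<equiv> 1 - (exp (- \<eta>))\<^sup>2"
  shows "\<bar>step_energy_s s x y\<bar> \<le> (4 / d + 4 / d\<^sup>2) * (x\<^sup>2 + y\<^sup>2)"
proof -
  define c where "c = exp (- s)"
  define u where "u = y - c * x"
  have d: "d > 0" using one_minus_exp_pos[OF assms(2)] by (simp add: d_def)
  have c: "0 \<le> c" "c \<le> exp (- \<eta>)" "c \<le> 1" using assms by (auto simp: c_def)
  have "c\<^sup>2 \<le> (exp (- \<eta>))\<^sup>2" using c by (intro power_mono) auto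
  hence D: "1 - c\<^sup>2 \<ge> d" by (simp add: d_def)
  have cx: "\<bar>c * x\<bar> \<le> \<bar>x\<bar>" using c by (simp add: abs_mult mult_left_le_one_le)
  hence au: "\<bar>u\<bar> \<le> \<bar>x\<bar> + \<bar>y\<bar>" unfolding u_def by linarith
  have "u\<^sup>2 \<le> (\<bar>x\<bar> + \<bar>y\<bar>)\<^sup>2" using power_mono[OF au, of 2] by simp
  also have "\<dots> \<le> 2 * (x\<^sup>2 + y\<^sup>2)"
    using zero_le_power2[of "\<bar>x\<bar> - \<bar>y\<bar>"] by (simp add: power2_eq_square algebra_simps)
  finally have u2: "u\<^sup>2 \<le> 2 * (x\<^sup>2 + y\<^sup>2)" .
  have "\<bar>c * x * u\<bar> \<le> \<bar>x\<bar> * \<bar>u\<bar>" using mult_right_mono[OF cx, of "\<bar>u\<bar>"] by (simp add: abs_mult)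
  also have "\<dots> \<le> (x\<^sup>2 + u\<^sup>2) / 2"
    using zero_le_power2[of "\<bar>x\<bar> - \<bar>u\<bar>"] by (simp add: power2_eq_square algebra_simps)
  also have "\<dots> \<le> 2 * (x\<^sup>2 + y\<^sup>2)"
  proof -
    have "V \<le> 2 * (X + Y) \<Longrightarrow> 0 \<le> X \<Longrightarrow> 0 \<le> Y \<Longrightarrow> (X + V) / 2 \<le> 2 * (X + Y)" for X Y V :: real
      by simp
    from this[OF u2] show ?thesis by simp
  qed
  finally have xu: "\<bar>2 * c * x * u\<bar> \<le> 4 * (x\<^sup>2 + y\<^sup>2)" by (simp add: abs_mult)
  have "c\<^sup>2 \<le> 1" using c by (simp add: power_le_one)
  hence "c\<^sup>2 * u\<^sup>2 \<le> u\<^sup>2" using mult_right_mono[of "c\<^sup>2" 1 "u\<^sup>2"] by simp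
  hence cu: "\<bar>2 * c\<^sup>2 * u\<^sup>2\<bar> \<le> 4 * (x\<^sup>2 + y\<^sup>2)" using u2 by (simp add: abs_mult)
  have "\<bar>step_energy_s s x y\<bar> \<le> \<bar>2 * c * x * u / (1 - c\<^sup>2)\<bar> + \<bar>2 * c\<^sup>2 * u\<^sup>2 / (1 - c\<^sup>2)\<^sup>2\<bar>"
    unfolding step_energy_s_def c_def[symmetric] u_def[symmetric] by (rule abs_triangle_ineq4)
  also have "\<dots> = \<bar>2 * c * x * u\<bar> / (1 - c\<^sup>2) + \<bar>2 * c\<^sup>2 * u\<^sup>2\<bar> / (1 - c\<^sup>2)\<^sup>2"
    using d D by (simp add: abs_divide)
  also have "\<dots> \<le> (4 * (x\<^sup>2 + y\<^sup>2)) / d + (4 * (x\<^sup>2 + y\<^sup>2)) / d\<^sup>2"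
    using d D xu cu by (intro add_mono frac_le power_mono) auto
  also have "\<dots> = (4 / d + 4 / d\<^sup>2) * (x\<^sup>2 + y\<^sup>2)"
  proof -
    have "(4 * T) / d + (4 * T) / d\<^sup>2 = (4 / d + 4 / d\<^sup>2) * T" for T by (simp add: distrib_right)
    thus ?thesis .
  qed
  finally show ?thesis .
qed

lemma energy_t_bound:
  assumes l: "l \<in> {1..m}" and "\<eta> > 0" "t l - t (l - 1) \<ge> \<eta>" "l < m \<Longrightarrow> t (Suc l) - t l \<ge> \<eta>"
  defines "d \<equiv> 1 - (exp (- \<eta>))\<^sup>2"
  shows "\<bar>energy_t m t l z\<bar> \<le> 4 * (4 / d + 4 / d\<^sup>2) * (\<Sum>k\<le>m. (z k)\<^sup>2)"
proof -
  define K where "K = 4 / d + 4 / d\<^sup>2"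
  define S where "S = (\<Sum>k\<le>m. (z k)\<^sup>2)"
  have "d > 0" using one_minus_exp_pos[OF assms(2)] by (simp add: d_def)
  hence K: "K \<ge> 0" by (simp add: K_def)
  have zS: "(z k)\<^sup>2 \<le> S" if "k \<le> m" for k
    unfolding S_def using that by (intro member_le_sum) auto
  have "\<bar>step_energy_s (t l - t (l - 1)) (z (l - 1)) (z l)\<bar> \<le> K * ((z (l - 1))\<^sup>2 + (z l)\<^sup>2)"
    unfolding K_def d_def by (rule step_energy_s_bound) (use assms in auto)
  also have "\<dots> \<le> K * (S + S)" using l zS[of l] zS[of "l - 1"] K by (intro mult_left_mono add_mono) auto
  finally have 1: "\<bar>step_energy_s (t l - t (l - 1)) (z (l - 1)) (z l)\<bar> \<le> K * (S + S)" .
  have S0: "S \<ge> 0" unfolding S_def by (intro sum_nonneg) auto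
  have 2: "\<bar>if l < m then step_energy_s (t (Suc l) - t l) (z l) (z (Suc l)) else 0\<bar> \<le> K * (S + S)"
  proof (cases "l < m")
    case True
    have "\<bar>step_energy_s (t (Suc l) - t l) (z l) (z (Suc l))\<bar> \<le> K * ((z l)\<^sup>2 + (z (Suc l))\<^sup>2)"
      unfolding K_def d_def by (rule step_energy_s_bound) (use assms True in auto)
    also have "\<dots> \<le> K * (S + S)" using True zS[of l] zS[of "Suc l"] K by (intro mult_left_mono add_mono) auto
    finally show ?thesis using True by simp
  qed (use S0 K in simp)
  have "\<bar>energy_t m t l z\<bar> \<le> K * (S + S) + K * (S + S)"
    unfolding energy_t_def using abs_triangle_ineq4 1 2 by (rule order_trans[OF _ add_mono])
  also have "\<dots> = 4 * K * S" by (simp add: algebra_simps)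
  finally show ?thesis unfolding K_def S_def .
qed

text \<open>
  Near \<open>t l\<close> the adjacent time steps are bounded below, so the time derivative of the energy is
  at most a multiple of \<open>\<bar>z\<bar>\<^sup>2\<close> there, while \<open>exp (- energy)\<close> has a Gaussian bound independent of
  the times.
\<close>

lemma DERIV_moment_time:
  assumes adm: "admissible m r t a" and l: "l \<in> {1..m}"
  shows "((\<lambda>s. box_integral r a m (moment_integrand m i j (t(l := s)))) has_real_derivative
            box_integral r a m (moment_integrand_t m i j l t)) (at (t l))"
proof -
  note inc = admissible_increasing[OF adm]
  \<comment> \<open>Half of the smaller adjacent gap: both gaps exceed \<open>\<eta>\<close> while \<open>t l\<close> moves by less than \<open>\<eta>\<close>.\<close>
  define \<eta> where "\<eta> = min (t l - t (l - 1)) (if l < m then t (Suc l) - t l else 1) / 2"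
  have gaps: "t l - t (l - 1) > 0" "l < m \<Longrightarrow> t (Suc l) - t l > 0"
    using inc l unfolding increasing_times_def
    by (auto dest: bspec[of _ _ l] bspec[of _ _ "Suc l"])
  have \<eta>: "\<eta> > 0" using gaps by (auto simp: \<eta>_def)
  have \<eta>1: "2 * \<eta> \<le> t l - t (l - 1)" "l < m \<Longrightarrow> 2 * \<eta> \<le> t (Suc l) - t l"
    by (auto simp: \<eta>_def)
  have near: "(t(l := s)) l - (t(l := s)) (l - 1) \<ge> \<eta>"
      "l < m \<Longrightarrow> (t(l := s)) (Suc l) - (t(l := s)) l \<ge> \<eta>" "increasing_times m (t(l := s))"
    if "\<bar>s - t l\<bar> < \<eta>" for s
  proof -
    have "l - 1 \<noteq> l" using l by auto
    thus 1: "(t(l := s)) l - (t(l := s)) (l - 1) \<ge> \<eta>" using that \<eta>1(1) by (simp add: abs_less_iff)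
    show 2: "l < m \<Longrightarrow> (t(l := s)) (Suc l) - (t(l := s)) l \<ge> \<eta>" using that \<eta>1(2) by (simp add: abs_less_iff)
    show "increasing_times m (t(l := s))"
      unfolding increasing_times_def
    proof
      fix k assume k: "k \<in> {1..m}"
      consider (a) "k = l" | (b) "k = Suc l" | (c) "k \<noteq> l" "k - 1 \<noteq> l"
      proof -
        have "k \<ge> 1" using k by simp
        thus thesis using that by (cases "k = l"; cases "k = Suc l") auto
      qed
      thus "(t(l := s)) (k - 1) < (t(l := s)) k"
      proof cases
        case a
        thus ?thesis using 1 \<eta> by simp
      next
        case b
        thus ?thesis using 2 \<eta> k by simp
      next
        case c
        thus ?thesis using inc k by (simp add: increasing_times_def)
      qed
    qed
  qed
  define d where "d = 1 - (exp (- \<eta>))\<^sup>2"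
  define K where "K = 4 * (4 / d + 4 / d\<^sup>2)"
  have d: "d > 0" using one_minus_exp_pos[OF \<eta>] by (simp add: d_def)
  have K: "K \<ge> 0" using d by (simp add: K_def)
  \<comment> \<open>The sum over \<open>k\<close> is the bound \<open>K * \<bar>z\<bar>\<^sup>2\<close> for the time derivative, written as a sum of products
    of coordinates so that the closure properties of Gaussian bounds apply.\<close>
  define g where "g = (\<lambda>z :: nat \<Rightarrow> real. K * (\<Sum>k\<le>m. z k * (z k *
     (z 0 ^ i * (z m ^ j * exp (- coercivity m * (\<Sum>k\<le>m. (z k)\<^sup>2)))))))"
  have E: "gaussian_bounded {..m} (\<lambda>z. exp (- coercivity m * (\<Sum>k\<le>m. (z k)\<^sup>2)))"
    unfolding gaussian_bounded_def
  proof
    show "(\<lambda>z. exp (- coercivity m * (\<Sum>k\<le>m. (z k)\<^sup>2))) \<in> borel_measurable (lborel_on {..m})"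
      by (intro measurable_compose[OF _ borel_measurable_exp] borel_measurable_times borel_measurable_const
          borel_measurable_sum borel_measurable_power measurable_coordinate)
    show "\<exists>C e. e > 0 \<and> (\<forall>z. \<bar>exp (- coercivity m * (\<Sum>k\<le>m. (z k)\<^sup>2))\<bar> \<le> C * exp (- e * (\<Sum>k\<le>m. (z k)\<^sup>2)))"
      by (rule exI[of _ 1], rule exI[of _ "coercivity m"]) (simp add: coercivity_pos)
  qed
  have g: "gaussian_bounded {..m} g"
    unfolding g_def
    by (intro gaussian_bounded_cmult gaussian_bounded_sum[OF _ _ E] gaussian_bounded_coordinate gaussian_bounded_power E) auto
  have bound: "\<bar>moment_integrand_t m i j l (t(l := s)) z\<bar> \<le> \<bar>g z\<bar>" if s: "\<bar>s - t l\<bar> < \<eta>" for s z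
  proof -
    define S where "S = (\<Sum>k\<le>m. (z k)\<^sup>2)"
    have S: "S \<ge> 0" unfolding S_def by (intro sum_nonneg) auto
    have "\<bar>energy_t m (t(l := s)) l z\<bar> \<le> K * S"
      unfolding K_def d_def S_def by (rule energy_t_bound[OF l \<eta>]) (use near[OF s] in auto)
    moreover have "exp (- energy m (t(l := s)) z) \<le> exp (- coercivity m * S)"
      unfolding S_def by (rule exp_energy_bound[OF near(3)[OF s]])
    ultimately have "\<bar>energy_t m (t(l := s)) l z\<bar> * (\<bar>z 0 ^ i * z m ^ j\<bar> * exp (- energy m (t(l := s)) z))
        \<le> (K * S) * (\<bar>z 0 ^ i * z m ^ j\<bar> * exp (- coercivity m * S))"
      using K S by (intro mult_mono mult_nonneg_nonneg) auto
    also have "\<dots> = \<bar>(K * S) * (z 0 ^ i * z m ^ j * exp (- coercivity m * S))\<bar>"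
      using K S by (simp add: abs_mult)
    also have "(K * S) * (z 0 ^ i * z m ^ j * exp (- coercivity m * S)) = g z"
    proof -
      have "(\<Sum>k\<le>m. z k * (z k * W)) = S * W" for W
        by (simp add: S_def sum_distrib_right power2_eq_square mult.assoc)
      thus ?thesis unfolding g_def S_def[symmetric] by (simp only: mult.assoc)
    qed
    finally show ?thesis
      unfolding moment_integrand_t_def moment_integrand_def
      by (simp add: abs_mult mult_ac del: fun_upd_apply)
  qed
  let ?B = "\<lambda>z. \<Prod>k\<le>m. indicator (interval_union r a k) (z k) :: real"
  have "((\<lambda>s. \<integral>z. ?B z * moment_integrand m i j (t(l := s)) z \<partial>lborel_on {..m}) has_real_derivative
          (\<integral>z. ?B z * moment_integrand_t m i j l (t(l := t l)) z \<partial>lborel_on {..m})) (at (t l))"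
  proof (rule dominated_integral_DERIV[OF \<eta>, where g = "\<lambda>z. \<bar>g z\<bar>"])
    show "integrable (lborel_on {..m}) (\<lambda>z. ?B z * moment_integrand m i j (t(l := s)) z)" if "\<bar>s - t l\<bar> < \<eta>" for s
      by (rule box_integrable[OF gaussian_bounded_moment_integrand[OF near(3)[OF that]]])
    show "integrable (lborel_on {..m}) (\<lambda>z. \<bar>g z\<bar>)"
      by (intro integrable_abs gaussian_bounded_integrable g) simp
    show "(\<lambda>z. ?B z * moment_integrand_t m i j l (t(l := t l)) z) \<in> borel_measurable (lborel_on {..m})"
      using box_integrable[OF gaussian_bounded_moment_integrand_t[OF inc l]] by (simp add: borel_measurable_integrable)
    show "\<bar>?B z * moment_integrand_t m i j l (t(l := s)) z\<bar> \<le> \<bar>g z\<bar>" if "\<bar>s - t l\<bar> < \<eta>" for s z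
      by (rule order_trans[OF abs_box_indicator_le bound[OF that]])
    show "((\<lambda>s. ?B z * moment_integrand m i j (t(l := s)) z) has_real_derivative
            ?B z * moment_integrand_t m i j l (t(l := s)) z) (at s)" if s: "\<bar>s - t l\<bar> < \<eta>" for s z
    proof (rule DERIV_cmult)
      have "((\<lambda>s. exp (- energy m (t(l := s)) z)) has_real_derivative
              exp (- energy m (t(l := s)) z) * (- energy_t m (t(l := s)) l z)) (at s)"
        by (rule DERIV_fun_exp[OF DERIV_minus[OF DERIV_energy_t[OF l near(3)[OF s]]]])
      from DERIV_cmult[OF DERIV_cmult[OF this]]
      show "((\<lambda>s. moment_integrand m i j (t(l := s)) z) has_real_derivative
              moment_integrand_t m i j l (t(l := s)) z) (at s)"
        unfolding moment_integrand_def moment_integrand_t_def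
        by (rule DERIV_cong) (simp only: mult_ac mult_minus_left mult_minus_right mult_1)
    qed
  qed
  thus ?thesis by (simp add: box_integral_def)
qed

lemma isCont_update: "isCont (\<lambda>s. (y(l := s)) k) s"
  by (cases "k = l") auto

text \<open>
  The derivative of \<open>z l ^ e\<close> times the integrand with respect to \<open>z l\<close>. The powers of \<open>z 0\<close> and \<open>z m\<close>
  contribute only at the first and the last level.
\<close>

definition moment_integrand_z :: "nat \<Rightarrow> nat \<Rightarrow> nat \<Rightarrow> nat \<Rightarrow> nat \<Rightarrow> (nat \<Rightarrow> real) \<Rightarrow> (nat \<Rightarrow> real) \<Rightarrow> real" where
  "moment_integrand_z m i j e l t z =
     real e * (z l ^ (e - 1) * moment_integrand m i j t z)
   + (if l = 0 then real i else 0) * (z l ^ e * moment_integrand m (i - 1) j t z)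
   + (if l = m then real j else 0) * (z l ^ e * moment_integrand m i (j - 1) t z)
   + (- 1) * (energy_z m t l z * (z l ^ e * moment_integrand m i j t z))"

lemma gaussian_bounded_moment_integrand_z:
  assumes "increasing_times m t" "l \<le> m"
  shows "gaussian_bounded {..m} (moment_integrand_z m i j e l t)"
  unfolding moment_integrand_z_def[abs_def]
  by (intro gaussian_bounded_add gaussian_bounded_cmult gaussian_bounded_energy_z gaussian_bounded_power
        gaussian_bounded_moment_integrand assms) (use assms in auto)

lemma isCont_energy: "l \<le> m \<Longrightarrow> isCont (\<lambda>s. energy m t (y(l := s))) s"
  by (rule DERIV_isCont[OF DERIV_energy_z])

lemma isCont_moment_integrand: "l \<le> m \<Longrightarrow> isCont (\<lambda>s. moment_integrand m i j t (y(l := s))) s"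
  unfolding moment_integrand_def
  by (intro continuous_mult continuous_power isCont_update isCont_exp' continuous_minus isCont_energy)

lemma isCont_energy_z: "isCont (\<lambda>s. energy_z m t l (y(l := s))) s"
proof -
  have "isCont (\<lambda>s. step_energy_y \<sigma> ((y(l := s)) k) ((y(l := s)) k')) s"
    "isCont (\<lambda>s. step_energy_x \<sigma> ((y(l := s)) k) ((y(l := s)) k')) s" for \<sigma> k k'
    unfolding step_energy_y_def step_energy_x_def divide_inverse
    by (intro continuous_mult continuous_diff continuous_const isCont_update)+
  note st = this
  have "isCont (\<lambda>s. if l = 0 then 2 * (y(l := s)) 0
          else step_energy_y (t l - t (l - 1)) ((y(l := s)) (l - 1)) ((y(l := s)) l)) s"
  proof (cases "l = 0")
    case True
    thus ?thesis by simp
  next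
    case False
    thus ?thesis using st(1)[of "t l - t (l - 1)" "l - 1" l] by (simp only: if_False)
  qed
  moreover have "isCont (\<lambda>s. if l < m then step_energy_x (t (Suc l) - t l) ((y(l := s)) l) ((y(l := s)) (Suc l)) else 0) s"
    using st(2)[of "t (Suc l) - t l" l "Suc l"] by (cases "l < m") (simp_all only: if_True if_False continuous_const)
  ultimately show ?thesis unfolding energy_z_def by (rule continuous_add)
qed

lemma isCont_moment_integrand_z:
  assumes "l \<le> m"
  shows "isCont (\<lambda>s. moment_integrand_z m i j e l t (y(l := s))) s"
  unfolding moment_integrand_z_def
  by (intro continuous_add continuous_mult continuous_const continuous_power isCont_update isCont_energy_z
      isCont_moment_integrand assms)

lemma DERIV_update_power:
  "((\<lambda>s. ((y(l := s)) k) ^ i) has_real_derivative (if k = l then real i else 0) * ((y(l := s)) k) ^ (i - 1)) (at s)"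
  by (cases "k = l") (auto intro!: derivative_eq_intros)

lemma DERIV_moment_integrand_z:
  assumes l: "l \<le> m"
  shows "((\<lambda>s. s ^ e * moment_integrand m i j t (y(l := s))) has_real_derivative
            moment_integrand_z m i j e l t (y(l := s))) (at s)"
proof -
  let ?z = "y(l := s)"
  have "((\<lambda>s. exp (- energy m t (y(l := s)))) has_real_derivative
          exp (- energy m t ?z) * (- energy_z m t l ?z)) (at s)"
    by (rule DERIV_fun_exp[OF DERIV_minus[OF DERIV_energy_z[OF l]]])
  from DERIV_mult[OF DERIV_update_power[of y l l e s] DERIV_mult[OF DERIV_update_power[of y l 0 i s]
         DERIV_mult[OF DERIV_update_power[of y l m j s] this]]]
  have "((\<lambda>s. ((y(l := s)) l) ^ e * moment_integrand m i j t (y(l := s))) has_real_derivative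
            moment_integrand_z m i j e l t ?z) (at s)"
    unfolding moment_integrand_def moment_integrand_z_def
    by (rule DERIV_cong) (simp add: algebra_simps)
  thus ?thesis by (simp only: fun_upd_same)
qed

section \<open>Symmetries of the energy\<close>

lemma sum_weighted_energy_z:
  fixes p :: "nat \<Rightarrow> real"
  shows "(\<Sum>l\<le>m. p l * energy_z m t l z) = 2 * p 0 * z 0 +
     (\<Sum>l = 1..m. p l * step_energy_y (t l - t (l - 1)) (z (l - 1)) (z l)
                + p (l - 1) * step_energy_x (t l - t (l - 1)) (z (l - 1)) (z l))"
proof -
  have "(\<Sum>l\<le>m. p l * (if l = 0 then 2 * z 0 else step_energy_y (t l - t (l - 1)) (z (l - 1)) (z l))) =
        2 * p 0 * z 0 + (\<Sum>l = 1..m. p l * step_energy_y (t l - t (l - 1)) (z (l - 1)) (z l))"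
  proof -
    have "{..m} = insert 0 {1..m}" by auto
    thus ?thesis by simp
  qed
  moreover have "(\<Sum>l\<le>m. p l * (if l < m then step_energy_x (t (Suc l) - t l) (z l) (z (Suc l)) else 0)) =
        (\<Sum>l = 1..m. p (l - 1) * step_energy_x (t l - t (l - 1)) (z (l - 1)) (z l))"
  proof -
    have "{..m} = insert m {..<m}" by auto
    thus ?thesis by (simp add: sum.atLeast1_atMost_eq)
  qed
  ultimately show ?thesis
    unfolding energy_z_def by (simp only: distrib_left sum.distrib add.assoc)
qed

lemma sum_weighted_energy_t:
  fixes \<theta> :: "nat \<Rightarrow> real"
  assumes "\<theta> 0 = 0"
  shows "(\<Sum>l = 1..m. \<theta> l * energy_t m t l z) =
     (\<Sum>l = 1..m. (\<theta> l - \<theta> (l - 1)) * step_energy_s (t l - t (l - 1)) (z (l - 1)) (z l))"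
proof -
  have "(\<Sum>l = 1..m. \<theta> l * (if l < m then step_energy_s (t (Suc l) - t l) (z l) (z (Suc l)) else 0)) =
        (\<Sum>l = 1..m. \<theta> (l - 1) * step_energy_s (t l - t (l - 1)) (z (l - 1)) (z l))"
  proof (cases m)
    case (Suc m')
    have "(\<Sum>l = 1..m. \<theta> l * (if l < m then step_energy_s (t (Suc l) - t l) (z l) (z (Suc l)) else 0)) =
          (\<Sum>l\<le>m. \<theta> l * (if l < m then step_energy_s (t (Suc l) - t l) (z l) (z (Suc l)) else 0))"
    proof -
      have "{..m} = insert 0 {1..m}" by auto
      thus ?thesis using assms by simp
    qed
    also have "\<dots> = (\<Sum>l<m. \<theta> l * step_energy_s (t (Suc l) - t l) (z l) (z (Suc l)))"
    proof -
      have "{..m} = insert m {..<m}" by auto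
      thus ?thesis by simp
    qed
    finally show ?thesis by (simp add: sum.atLeast1_atMost_eq)
  qed simp
  thus ?thesis
    unfolding energy_t_def by (simp only: right_diff_distrib left_diff_distrib sum_subtractf)
qed

lemma sum_telescope_from_1:
  fixes f :: "nat \<Rightarrow> real"
  shows "(\<Sum>l = 1..m. f l - f (l - 1)) = f m - f 0"
  by (induction m) auto

context
  fixes m :: nat and t :: "nat \<Rightarrow> real"
  assumes inc: "increasing_times m t" and t0: "t 0 = 0"
begin

lemma step_factor:
  assumes "l \<in> {1..m}"
  shows "1 - (exp (- (t l - t (l - 1))))\<^sup>2 > 0"
  using inc assms by (intro one_minus_exp_pos) (auto simp: increasing_times_def)

text \<open>
  The translation \<open>z l \<mapsto> z l + \<epsilon> * exp (- t l)\<close> leaves every difference \<open>z l - exp (- s) * z (l - 1)\<close>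
  unchanged, where \<open>s\<close> is the time step. Only \<open>(z 0)\<^sup>2\<close> varies.
\<close>

lemma energy_translation_forward: "(\<Sum>l\<le>m. exp (- t l) * energy_z m t l z) = 2 * z 0"
proof -
  have "exp (- t l) * step_energy_y (t l - t (l - 1)) (z (l - 1)) (z l)
        + exp (- t (l - 1)) * step_energy_x (t l - t (l - 1)) (z (l - 1)) (z l) = 0" for l
  proof -
    have "exp (- t l) = exp (- t (l - 1)) * exp (- (t l - t (l - 1)))" unfolding exp_add[symmetric] by simp
    thus ?thesis by (simp add: step_energy_y_def step_energy_x_def)
  qed
  thus ?thesis unfolding sum_weighted_energy_z by (simp add: t0)
qed

text \<open>
  The time reversal of \<open>energy_translation_forward\<close>: the energy also equals \<open>(z m)\<^sup>2\<close> plus terms in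
  \<open>z (l - 1) - exp (- s) * z l\<close>, which are invariant under this translation. In the asymmetric form
  of the energy the invariance shows as a telescoping sum.
\<close>

lemma energy_translation_backward: "(\<Sum>l\<le>m. exp (t l - t m) * energy_z m t l z) = 2 * z m"
proof -
  have "exp (t l - t m) * step_energy_y (t l - t (l - 1)) (z (l - 1)) (z l)
        + exp (t (l - 1) - t m) * step_energy_x (t l - t (l - 1)) (z (l - 1)) (z l) =
        2 * exp (t l - t m) * z l - 2 * exp (t (l - 1) - t m) * z (l - 1)" if l: "l \<in> {1..m}" for l
  proof -
    define c where "c = exp (- (t l - t (l - 1)))"
    define E where "E = exp (t l - t m)"
    have E: "exp (t (l - 1) - t m) = E * c" unfolding E_def c_def exp_add[symmetric] by simp
    have d: "1 - c\<^sup>2 \<noteq> 0" using step_factor[OF l] by (simp add: c_def)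
    have "E * (2 * (z l - c * z (l - 1)) / (1 - c\<^sup>2)) + E * c * (- 2 * c * (z l - c * z (l - 1)) / (1 - c\<^sup>2)) =
          2 * E * (z l - c * z (l - 1)) * ((1 - c\<^sup>2) / (1 - c\<^sup>2))"
      unfolding times_divide_eq_right add_divide_distrib[symmetric]
      by (simp add: algebra_simps power2_eq_square)
    also have "\<dots> = 2 * E * z l - 2 * (E * c) * z (l - 1)" using d by (simp add: algebra_simps)
    finally show ?thesis
      unfolding step_energy_y_def step_energy_x_def c_def[symmetric] E E_def[symmetric] .
  qed
  hence "(\<Sum>l\<le>m. exp (t l - t m) * energy_z m t l z) = 2 * exp (t 0 - t m) * z 0 +
      (\<Sum>l = 1..m. 2 * exp (t l - t m) * z l - 2 * exp (t (l - 1) - t m) * z (l - 1))"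
    unfolding sum_weighted_energy_z by simp
  thus ?thesis unfolding sum_telescope_from_1[of "\<lambda>l. 2 * exp (t l - t m) * z l"] by simp
qed

text \<open>
  With \<open>X l = exp (t l) * z l\<close> and \<open>T l = exp (2 * t l)\<close> the energy of a step is
  \<open>(X l - X (l - 1))\<^sup>2 / (T l - T (l - 1))\<close>. The vector field multiplies \<open>X l\<close> with rate 1 and \<open>T l - 1\<close>
  with rate 2. This is the scaling of Brownian motion, which preserves the energy of each step,
  so that only \<open>(z 0)\<^sup>2\<close> varies.
\<close>

lemma energy_scaling_forward:
  "(\<Sum>l\<le>m. exp (- 2 * t l) * z l * energy_z m t l z) + (\<Sum>l = 1..m. (1 - exp (- 2 * t l)) * energy_t m t l z) =
     2 * (z 0)\<^sup>2"
proof -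
  have "exp (- 2 * t l) * z l * step_energy_y (t l - t (l - 1)) (z (l - 1)) (z l)
      + exp (- 2 * t (l - 1)) * z (l - 1) * step_energy_x (t l - t (l - 1)) (z (l - 1)) (z l)
      + ((1 - exp (- 2 * t l)) - (1 - exp (- 2 * t (l - 1)))) * step_energy_s (t l - t (l - 1)) (z (l - 1)) (z l) = 0"
    if l: "l \<in> {1..m}" for l
  proof -
    define c where "c = exp (- (t l - t (l - 1)))"
    define E where "E = exp (- 2 * t (l - 1))"
    define I where "I = inverse (1 - c\<^sup>2)"
    define u where "u = z l - c * z (l - 1)"
    have c2: "c\<^sup>2 = exp (- 2 * (t l - t (l - 1)))" by (simp add: c_def power2_eq_square flip: exp_add)
    have E: "exp (- 2 * t l) = E * c\<^sup>2" unfolding E_def c2 exp_add[symmetric] by (simp add: algebra_simps)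
    have d: "1 - c\<^sup>2 \<noteq> 0" using step_factor[OF l] by (simp add: c_def)
    have dI: "(1 - c\<^sup>2) * I = 1" using d by (simp add: I_def)
    have I2: "inverse ((1 - c\<^sup>2)\<^sup>2) = I\<^sup>2" by (simp add: I_def power_inverse)
    have "E * c\<^sup>2 * z l * (2 * u * I) + E * z (l - 1) * (- 2 * c * u * I)
        + (1 - E * c\<^sup>2 - (1 - E)) * (2 * c * z (l - 1) * u * I - 2 * c\<^sup>2 * u\<^sup>2 * I\<^sup>2) =
          2 * E * u * I * (c\<^sup>2 * z l - c * z (l - 1) + (1 - c\<^sup>2) * c * z (l - 1) - c\<^sup>2 * u * ((1 - c\<^sup>2) * I))"
      by (simp add: algebra_simps power2_eq_square)
    also have "\<dots> = 0" unfolding dI by (simp add: u_def algebra_simps power2_eq_square)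
    finally show ?thesis
      unfolding step_energy_y_def step_energy_x_def step_energy_s_def c_def[symmetric] E E_def[symmetric]
        u_def[symmetric] divide_inverse I2 I_def[symmetric] .
  qed
  hence "(\<Sum>l = 1..m. exp (- 2 * t l) * z l * step_energy_y (t l - t (l - 1)) (z (l - 1)) (z l)
      + exp (- 2 * t (l - 1)) * z (l - 1) * step_energy_x (t l - t (l - 1)) (z (l - 1)) (z l)
      + ((1 - exp (- 2 * t l)) - (1 - exp (- 2 * t (l - 1)))) * step_energy_s (t l - t (l - 1)) (z (l - 1)) (z l)) = 0"
    by (intro sum.neutral ballI)
  thus ?thesis
    using sum_weighted_energy_z[of "\<lambda>l. exp (- 2 * t l) * z l" m t z]
      sum_weighted_energy_t[of "\<lambda>l. 1 - exp (- 2 * t l)" m t z]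
    by (simp add: t0 sum.distrib power2_eq_square)
qed

text \<open>
  The time reversal of \<open>energy_scaling_forward\<close>: along this vector field the reversed times
  \<open>t m - t l\<close> move with speed \<open>1 - exp (- 2 * (t m - t l))\<close>.
\<close>

lemma energy_scaling_backward:
  "(\<Sum>l\<le>m. exp (2 * (t l - t m)) * z l * energy_z m t l z)
   + (\<Sum>l = 1..m. (exp (2 * (t l - t m)) - exp (- 2 * t m)) * energy_t m t l z) = 2 * (z m)\<^sup>2"
proof -
  have "exp (2 * (t l - t m)) * z l * step_energy_y (t l - t (l - 1)) (z (l - 1)) (z l)
      + exp (2 * (t (l - 1) - t m)) * z (l - 1) * step_energy_x (t l - t (l - 1)) (z (l - 1)) (z l)
      + ((exp (2 * (t l - t m)) - exp (- 2 * t m)) - (exp (2 * (t (l - 1) - t m)) - exp (- 2 * t m)))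
          * step_energy_s (t l - t (l - 1)) (z (l - 1)) (z l) =
        2 * exp (2 * (t l - t m)) * (z l)\<^sup>2 - 2 * exp (2 * (t (l - 1) - t m)) * (z (l - 1))\<^sup>2"
    if l: "l \<in> {1..m}" for l
  proof -
    define c where "c = exp (- (t l - t (l - 1)))"
    define E where "E = exp (2 * (t l - t m))"
    define D where "D = exp (- 2 * t m)"
    define I where "I = inverse (1 - c\<^sup>2)"
    define u where "u = z l - c * z (l - 1)"
    have c2: "c\<^sup>2 = exp (- 2 * (t l - t (l - 1)))" by (simp add: c_def power2_eq_square flip: exp_add)
    have E: "exp (2 * (t (l - 1) - t m)) = E * c\<^sup>2" unfolding E_def c2 exp_add[symmetric] by (simp add: algebra_simps)
    have d: "1 - c\<^sup>2 \<noteq> 0" using step_factor[OF l] by (simp add: c_def)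
    have dI: "(1 - c\<^sup>2) * I = 1" using d by (simp add: I_def)
    have I2: "inverse ((1 - c\<^sup>2)\<^sup>2) = I\<^sup>2" by (simp add: I_def power_inverse)
    have "E * z l * (2 * u * I) + E * c\<^sup>2 * z (l - 1) * (- 2 * c * u * I)
        + (E - D - (E * c\<^sup>2 - D)) * (2 * c * z (l - 1) * u * I - 2 * c\<^sup>2 * u\<^sup>2 * I\<^sup>2) =
          2 * E * u * I * (z l - c\<^sup>2 * c * z (l - 1) + (1 - c\<^sup>2) * c * z (l - 1) - c\<^sup>2 * u * ((1 - c\<^sup>2) * I))"
      by (simp add: algebra_simps power2_eq_square)
    also have "\<dots> = 2 * E * u * ((1 - c\<^sup>2) * I) * (z l + c * z (l - 1))"
    proof -
      have "z l - c\<^sup>2 * c * z (l - 1) + (1 - c\<^sup>2) * c * z (l - 1) - c\<^sup>2 * u * 1 = (1 - c\<^sup>2) * (z l + c * z (l - 1))"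
        by (simp add: u_def algebra_simps power2_eq_square)
      hence "z l - c\<^sup>2 * c * z (l - 1) + (1 - c\<^sup>2) * c * z (l - 1) - c\<^sup>2 * u * ((1 - c\<^sup>2) * I) =
             (1 - c\<^sup>2) * (z l + c * z (l - 1))"
        unfolding dI .
      thus ?thesis by (simp only: mult_ac)
    qed
    also have "\<dots> = 2 * E * (z l)\<^sup>2 - 2 * (E * c\<^sup>2) * (z (l - 1))\<^sup>2"
      unfolding dI by (simp add: u_def algebra_simps power2_eq_square)
    finally show ?thesis
      unfolding step_energy_y_def step_energy_x_def step_energy_s_def c_def[symmetric] E E_def[symmetric] D_def[symmetric]
        u_def[symmetric] divide_inverse I2 I_def[symmetric] .
  qed
  hence "(\<Sum>l = 1..m. exp (2 * (t l - t m)) * z l * step_energy_y (t l - t (l - 1)) (z (l - 1)) (z l)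
      + exp (2 * (t (l - 1) - t m)) * z (l - 1) * step_energy_x (t l - t (l - 1)) (z (l - 1)) (z l)
      + ((exp (2 * (t l - t m)) - exp (- 2 * t m)) - (exp (2 * (t (l - 1) - t m)) - exp (- 2 * t m)))
          * step_energy_s (t l - t (l - 1)) (z (l - 1)) (z l)) =
      (\<Sum>l = 1..m. 2 * exp (2 * (t l - t m)) * (z l)\<^sup>2 - 2 * exp (2 * (t (l - 1) - t m)) * (z (l - 1))\<^sup>2)"
    by (intro sum.cong refl)
  also have "\<dots> = 2 * (z m)\<^sup>2 - 2 * exp (- 2 * t m) * (z 0)\<^sup>2"
    unfolding sum_telescope_from_1[of "\<lambda>l. 2 * exp (2 * (t l - t m)) * (z l)\<^sup>2"] by (simp add: t0)
  finally show ?thesis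
    using sum_weighted_energy_z[of "\<lambda>l. exp (2 * (t l - t m)) * z l" m t z]
      sum_weighted_energy_t[of "\<lambda>l. exp (2 * (t l - t m)) - exp (- 2 * t m)" m t z]
    by (simp add: t0 sum.distrib power2_eq_square)
qed

end

lemma sum_weighted_moment_integrand_z:
  assumes "m \<ge> 1"
  shows "(\<Sum>l\<le>m. v l * moment_integrand_z m i j e l t z) =
     (\<Sum>l\<le>m. v l * (real e * z l ^ (e - 1))) * moment_integrand m i j t z
   + v 0 * (real i * (z 0 ^ e * moment_integrand m (i - 1) j t z))
   + v m * (real j * (z m ^ e * moment_integrand m i (j - 1) t z))
   - (\<Sum>l\<le>m. v l * z l ^ e * energy_z m t l z) * moment_integrand m i j t z"
proof -
  have "v l * moment_integrand_z m i j e l t z =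
      v l * (real e * z l ^ (e - 1)) * moment_integrand m i j t z
    + (if l = 0 then v 0 * (real i * (z 0 ^ e * moment_integrand m (i - 1) j t z)) else 0)
    + (if l = m then v m * (real j * (z m ^ e * moment_integrand m i (j - 1) t z)) else 0)
    - (v l * z l ^ e * energy_z m t l z) * moment_integrand m i j t z" for l
    by (simp add: moment_integrand_z_def algebra_simps)
  thus ?thesis
    by (simp add: sum.distrib sum_subtractf sum_distrib_right)
qed

text \<open>
  The derivatives with respect to endpoints turn into derivatives of the integrand. Those of
  the monomial lower an exponent, the divergence of the vector field gives the first sum, and
  those of the energy combine with the time derivatives to the monomial on the right of \<open>id\<close>,
  where \<open>q\<close> is the first level or the last.
\<close>

lemma has_D_moment:
  assumes adm: "admissible m r t a" and m: "m \<ge> 1"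
    and w: "\<And>l. w (Inl l) = \<theta> l" "\<And>l j. w (Inr (l, j)) = v l * real_of_ereal (a l j) ^ e"
    and id: "\<And>z. (\<Sum>l\<le>m. v l * z l ^ e * energy_z m t l z) + (\<Sum>l = 1..m. \<theta> l * energy_t m t l z) = 2 * z q ^ Suc e"
  shows "has_D m r w t a (moment m r i j) (box_integral r a m (\<lambda>z.
     (\<Sum>l\<le>m. v l * (real e * z l ^ (e - 1))) * moment_integrand m i j t z
   + v 0 * (real i * (z 0 ^ e * moment_integrand m (i - 1) j t z))
   + v m * (real j * (z m ^ e * moment_integrand m i (j - 1) t z))
   + (- 2) * (z q ^ Suc e * moment_integrand m i j t z)))"
proof -
  note inc = admissible_increasing[OF adm]
  have "has_D m r w t a (\<lambda>t a. box_integral r a m (moment_integrand m i j t))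
     ((\<Sum>l = 1..m. \<theta> l * box_integral r a m (moment_integrand_t m i j l t)) +
      (\<Sum>l\<le>m. v l * box_integral r a m (moment_integrand_z m i j e l t)))"
    by (rule has_D_box_integral[where e = e])
       (intro adm gaussian_bounded_moment_integrand inc isCont_moment_integrand DERIV_moment_time
          gaussian_bounded_moment_integrand_z DERIV_moment_integrand_z isCont_moment_integrand_z w | assumption)+
  also have "(\<Sum>l = 1..m. \<theta> l * box_integral r a m (moment_integrand_t m i j l t)) =
      box_integral r a m (\<lambda>z. \<Sum>l = 1..m. \<theta> l * moment_integrand_t m i j l t z)"
    by (rule box_integral_sum[symmetric]) (auto intro: gaussian_bounded_moment_integrand_t inc)
  also have "(\<Sum>l\<le>m. v l * box_integral r a m (moment_integrand_z m i j e l t)) =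
      box_integral r a m (\<lambda>z. \<Sum>l\<le>m. v l * moment_integrand_z m i j e l t z)"
    by (rule box_integral_sum[symmetric]) (auto intro: gaussian_bounded_moment_integrand_z inc)
  also have "box_integral r a m (\<lambda>z. \<Sum>l = 1..m. \<theta> l * moment_integrand_t m i j l t z) +
      box_integral r a m (\<lambda>z. \<Sum>l\<le>m. v l * moment_integrand_z m i j e l t z) =
      box_integral r a m (\<lambda>z. (\<Sum>l = 1..m. \<theta> l * moment_integrand_t m i j l t z) +
        (\<Sum>l\<le>m. v l * moment_integrand_z m i j e l t z))"
  proof (rule box_integral_add[symmetric])
    show "gaussian_bounded {..m} (\<lambda>z. \<Sum>l = 1..m. \<theta> l * moment_integrand_t m i j l t z)"
      by (rule gaussian_bounded_sum[OF _ gaussian_bounded_cmult[OF gaussian_bounded_moment_integrand_t[OF inc]]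
            gaussian_bounded_exp_energy[OF inc]]) auto
    show "gaussian_bounded {..m} (\<lambda>z. \<Sum>l\<le>m. v l * moment_integrand_z m i j e l t z)"
      by (rule gaussian_bounded_sum[OF _ gaussian_bounded_cmult[OF gaussian_bounded_moment_integrand_z[OF inc]]
            gaussian_bounded_exp_energy[OF inc]]) auto
  qed
  also have "(\<lambda>z. (\<Sum>l = 1..m. \<theta> l * moment_integrand_t m i j l t z) +
        (\<Sum>l\<le>m. v l * moment_integrand_z m i j e l t z)) =
    (\<lambda>z. (\<Sum>l\<le>m. v l * (real e * z l ^ (e - 1))) * moment_integrand m i j t z
   + v 0 * (real i * (z 0 ^ e * moment_integrand m (i - 1) j t z))
   + v m * (real j * (z m ^ e * moment_integrand m i (j - 1) t z))
   + (- 2) * (z q ^ Suc e * moment_integrand m i j t z))"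
  proof
    fix z
    define R where "R = (\<Sum>l\<le>m. v l * (real e * z l ^ (e - 1))) * moment_integrand m i j t z
      + v 0 * (real i * (z 0 ^ e * moment_integrand m (i - 1) j t z))
      + v m * (real j * (z m ^ e * moment_integrand m i (j - 1) t z))"
    have "(\<Sum>l = 1..m. \<theta> l * moment_integrand_t m i j l t z) =
          - ((\<Sum>l = 1..m. \<theta> l * energy_t m t l z) * moment_integrand m i j t z)"
      by (simp add: moment_integrand_t_def sum_distrib_right sum_negf[symmetric] mult.assoc)
    moreover have "(\<Sum>l\<le>m. v l * moment_integrand_z m i j e l t z) =
        R - (\<Sum>l\<le>m. v l * z l ^ e * energy_z m t l z) * moment_integrand m i j t z"
      unfolding R_def by (rule sum_weighted_moment_integrand_z[OF m])
    ultimately have "(\<Sum>l = 1..m. \<theta> l * moment_integrand_t m i j l t z) +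
        (\<Sum>l\<le>m. v l * moment_integrand_z m i j e l t z) =
        R - ((\<Sum>l\<le>m. v l * z l ^ e * energy_z m t l z) + (\<Sum>l = 1..m. \<theta> l * energy_t m t l z)) * moment_integrand m i j t z"
      by (simp add: algebra_simps)
    thus "(\<Sum>l = 1..m. \<theta> l * moment_integrand_t m i j l t z) +
        (\<Sum>l\<le>m. v l * moment_integrand_z m i j e l t z) = R + (- 2) * (z q ^ Suc e * moment_integrand m i j t z)"
      unfolding id by simp
  qed
  finally show ?thesis unfolding moment_def[abs_def] .
qed

section \<open>The Dyson probability as a determinant of moments\<close>

context
  fixes m :: nat and r :: "nat \<Rightarrow> nat" and t :: "nat \<Rightarrow> real" and a :: "nat \<Rightarrow> nat \<Rightarrow> ereal"
  assumes adm: "admissible m r t a" and m: "m \<ge> 1"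
begin

lemma times_increasing: "increasing_times m t" and time_zero: "t 0 = 0"
  using admissible_increasing[OF adm] adm by (auto simp: admissible_def)

lemma box_integral_three_terms:
  "box_integral r a m (\<lambda>z. A * moment_integrand m i j t z + B * moment_integrand m i' j' t z
      + D * moment_integrand m i'' j'' t z) =
     A * moment m r i j t a + B * moment m r i' j' t a + D * moment m r i'' j'' t a"
proof -
  note gb = gaussian_bounded_moment_integrand[OF times_increasing]
  show ?thesis
    unfolding moment_def
    by (simp add: box_integral_add box_integral_cmult gaussian_bounded_add gaussian_bounded_cmult gb)
qed

lemma coordinate_moment_integrand:
  "z 0 * moment_integrand m i j t z = moment_integrand m (Suc i) j t z"
  "z m * moment_integrand m i j t z = moment_integrand m i (Suc j) t z"
  by (simp_all add: moment_integrand_def)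

lemma weight_coordinate_moment_integrand:
  "real i * (z 0 * moment_integrand m (i - 1) j t z) = real i * moment_integrand m i j t z"
  "real j * (z m * moment_integrand m i (j - 1) t z) = real j * moment_integrand m i j t z"
  unfolding coordinate_moment_integrand by (cases i; simp) (cases j; simp)

lemma A1_moment_formula:
  "has_D m r (w_A1 t) t a (moment m r i j)
     (real i * moment m r (i - 1) j t a + exp (- t m) * (real j * moment m r i (j - 1) t a)
       + (- 2) * moment m r (i + 1) j t a)"
proof -
  have "has_D m r (w_A1 t) t a (moment m r i j) (box_integral r a m (\<lambda>z.
     (\<Sum>l\<le>m. exp (- t l) * (real 0 * z l ^ (0 - 1))) * moment_integrand m i j t z
   + exp (- t 0) * (real i * (z 0 ^ 0 * moment_integrand m (i - 1) j t z))
   + exp (- t m) * (real j * (z m ^ 0 * moment_integrand m i (j - 1) t z))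
   + (- 2) * (z 0 ^ Suc 0 * moment_integrand m i j t z)))"
    by (rule has_D_moment[OF adm m, where \<theta> = "\<lambda>_. 0"])
       (simp_all add: w_A1_def energy_translation_forward[OF times_increasing time_zero])
  also have "(\<lambda>z. (\<Sum>l\<le>m. exp (- t l) * (real 0 * z l ^ (0 - 1))) * moment_integrand m i j t z
   + exp (- t 0) * (real i * (z 0 ^ 0 * moment_integrand m (i - 1) j t z))
   + exp (- t m) * (real j * (z m ^ 0 * moment_integrand m i (j - 1) t z))
   + (- 2) * (z 0 ^ Suc 0 * moment_integrand m i j t z)) =
    (\<lambda>z. real i * moment_integrand m (i - 1) j t z + (exp (- t m) * real j) * moment_integrand m i (j - 1) t z
      + (- 2) * moment_integrand m (i + 1) j t z)"
    by (simp add: time_zero coordinate_moment_integrand mult.assoc)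
  finally show ?thesis unfolding box_integral_three_terms by (simp only: mult.assoc)
qed

lemma B1_moment_formula:
  "has_D m r (w_B1 m t) t a (moment m r i j)
     (exp (- t m) * (real i * moment m r (i - 1) j t a) + real j * moment m r i (j - 1) t a
       + (- 2) * moment m r i (j + 1) t a)"
proof -
  have "has_D m r (w_B1 m t) t a (moment m r i j) (box_integral r a m (\<lambda>z.
     (\<Sum>l\<le>m. exp (t l - t m) * (real 0 * z l ^ (0 - 1))) * moment_integrand m i j t z
   + exp (t 0 - t m) * (real i * (z 0 ^ 0 * moment_integrand m (i - 1) j t z))
   + exp (t m - t m) * (real j * (z m ^ 0 * moment_integrand m i (j - 1) t z))
   + (- 2) * (z m ^ Suc 0 * moment_integrand m i j t z)))"
    by (rule has_D_moment[OF adm m, where \<theta> = "\<lambda>_. 0"])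
       (simp_all add: w_B1_def energy_translation_backward[OF times_increasing time_zero])
  also have "(\<lambda>z. (\<Sum>l\<le>m. exp (t l - t m) * (real 0 * z l ^ (0 - 1))) * moment_integrand m i j t z
   + exp (t 0 - t m) * (real i * (z 0 ^ 0 * moment_integrand m (i - 1) j t z))
   + exp (t m - t m) * (real j * (z m ^ 0 * moment_integrand m i (j - 1) t z))
   + (- 2) * (z m ^ Suc 0 * moment_integrand m i j t z)) =
    (\<lambda>z. (exp (- t m) * real i) * moment_integrand m (i - 1) j t z + real j * moment_integrand m i (j - 1) t z
      + (- 2) * moment_integrand m i (j + 1) t z)"
    by (simp add: time_zero coordinate_moment_integrand mult.assoc)
  finally show ?thesis unfolding box_integral_three_terms by (simp only: mult.assoc)
qed

lemma A2_moment_formula: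
  "has_D m r (w_A2 t a) t a (moment m r i j)
     (((\<Sum>l\<le>m. exp (- 2 * t l)) + real i) * moment m r i j t a + (exp (- 2 * t m) * real j) * moment m r i j t a
       + (- 2) * moment m r (i + 2) j t a)"
proof -
  have "has_D m r (w_A2 t a) t a (moment m r i j) (box_integral r a m (\<lambda>z.
     (\<Sum>l\<le>m. exp (- 2 * t l) * (real 1 * z l ^ (1 - 1))) * moment_integrand m i j t z
   + exp (- 2 * t 0) * (real i * (z 0 ^ 1 * moment_integrand m (i - 1) j t z))
   + exp (- 2 * t m) * (real j * (z m ^ 1 * moment_integrand m i (j - 1) t z))
   + (- 2) * (z 0 ^ Suc 1 * moment_integrand m i j t z)))"
    by (rule has_D_moment[OF adm m, where \<theta> = "\<lambda>l. 1 - exp (- 2 * t l)"])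
       (use energy_scaling_forward[OF times_increasing time_zero] in \<open>simp_all add: w_A2_def power2_eq_square\<close>)
  also have "(\<lambda>z. (\<Sum>l\<le>m. exp (- 2 * t l) * (real 1 * z l ^ (1 - 1))) * moment_integrand m i j t z
   + exp (- 2 * t 0) * (real i * (z 0 ^ 1 * moment_integrand m (i - 1) j t z))
   + exp (- 2 * t m) * (real j * (z m ^ 1 * moment_integrand m i (j - 1) t z))
   + (- 2) * (z 0 ^ Suc 1 * moment_integrand m i j t z)) =
    (\<lambda>z. ((\<Sum>l\<le>m. exp (- 2 * t l)) + real i) * moment_integrand m i j t z
      + (exp (- 2 * t m) * real j) * moment_integrand m i j t z + (- 2) * moment_integrand m (i + 2) j t z)"
    unfolding power_one_right weight_coordinate_moment_integrand
    by (simp add: time_zero coordinate_moment_integrand mult.assoc distrib_right add_ac)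
  finally show ?thesis unfolding box_integral_three_terms .
qed

lemma B2_moment_formula:
  "has_D m r (w_B2 m t a) t a (moment m r i j)
     ((exp (- 2 * t m) * real i) * moment m r i j t a + ((\<Sum>l\<le>m. exp (2 * (t l - t m))) + real j) * moment m r i j t a
       + (- 2) * moment m r i (j + 2) t a)"
proof -
  have "has_D m r (w_B2 m t a) t a (moment m r i j) (box_integral r a m (\<lambda>z.
     (\<Sum>l\<le>m. exp (2 * (t l - t m)) * (real 1 * z l ^ (1 - 1))) * moment_integrand m i j t z
   + exp (2 * (t 0 - t m)) * (real i * (z 0 ^ 1 * moment_integrand m (i - 1) j t z))
   + exp (2 * (t m - t m)) * (real j * (z m ^ 1 * moment_integrand m i (j - 1) t z))
   + (- 2) * (z m ^ Suc 1 * moment_integrand m i j t z)))"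
    by (rule has_D_moment[OF adm m, where \<theta> = "\<lambda>l. exp (2 * (t l - t m)) - exp (- 2 * t m)"])
       (use energy_scaling_backward[OF times_increasing time_zero] in \<open>simp_all add: w_B2_def power2_eq_square\<close>)
  also have "(\<lambda>z. (\<Sum>l\<le>m. exp (2 * (t l - t m)) * (real 1 * z l ^ (1 - 1))) * moment_integrand m i j t z
   + exp (2 * (t 0 - t m)) * (real i * (z 0 ^ 1 * moment_integrand m (i - 1) j t z))
   + exp (2 * (t m - t m)) * (real j * (z m ^ 1 * moment_integrand m i (j - 1) t z))
   + (- 2) * (z m ^ Suc 1 * moment_integrand m i j t z)) =
    (\<lambda>z. (exp (- 2 * t m) * real i) * moment_integrand m i j t z
      + ((\<Sum>l\<le>m. exp (2 * (t l - t m))) + real j) * moment_integrand m i j t z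
      + (- 2) * moment_integrand m i (j + 2) t z)"
    unfolding power_one_right weight_coordinate_moment_integrand
    by (simp add: time_zero coordinate_moment_integrand mult.assoc distrib_right add_ac)
  finally show ?thesis unfolding box_integral_three_terms .
qed

end

text \<open>
  Together with the factors \<open>confinement\<close> this splits \<open>exp (- energy)\<close> into the factors that occur in
  \<open>dyson_weight\<close>.
\<close>

definition coupling :: "(nat \<Rightarrow> real) \<Rightarrow> nat \<Rightarrow> real" where
  "coupling t l = 2 * dyson_c t l / (1 - (dyson_c t l)\<^sup>2)"

definition confinement :: "nat \<Rightarrow> (nat \<Rightarrow> real) \<Rightarrow> nat \<Rightarrow> real" where
  "confinement m t l = (if l = 0 then 1 else 1 / (1 - (dyson_c t l)\<^sup>2))
     + (if l < m then (dyson_c t (l + 1))\<^sup>2 / (1 - (dyson_c t (l + 1))\<^sup>2) else 0)"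

lemma energy_expansion:
  "energy m t z = (\<Sum>l\<le>m. confinement m t l * (z l)\<^sup>2) - (\<Sum>l = 1..m. coupling t l * z (l - 1) * z l)"
proof -
  let ?c = "dyson_c t"
  have "step_energy (t l - t (l - 1)) (z (l - 1)) (z l) =
        1 / (1 - (?c l)\<^sup>2) * (z l)\<^sup>2 + (?c l)\<^sup>2 / (1 - (?c l)\<^sup>2) * (z (l - 1))\<^sup>2 - coupling t l * z (l - 1) * z l" for l
  proof -
    define I where "I = inverse (1 - (?c l)\<^sup>2)"
    show ?thesis
      unfolding step_energy_def coupling_def dyson_c_def[symmetric] divide_inverse I_def[symmetric]
      by (simp add: power2_eq_square algebra_simps)
  qed
  hence "energy m t z = (z 0)\<^sup>2 + (\<Sum>l = 1..m. 1 / (1 - (?c l)\<^sup>2) * (z l)\<^sup>2)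
     + (\<Sum>l = 1..m. (?c l)\<^sup>2 / (1 - (?c l)\<^sup>2) * (z (l - 1))\<^sup>2) - (\<Sum>l = 1..m. coupling t l * z (l - 1) * z l)"
    unfolding energy_def by (simp only: sum.distrib sum_subtractf add.assoc add_diff_eq)
  also have "(z 0)\<^sup>2 + (\<Sum>l = 1..m. 1 / (1 - (?c l)\<^sup>2) * (z l)\<^sup>2) =
             (\<Sum>l\<le>m. (if l = 0 then 1 else 1 / (1 - (?c l)\<^sup>2)) * (z l)\<^sup>2)"
  proof -
    have "{..m} = insert 0 {1..m}" by auto
    thus ?thesis by simp
  qed
  also have "(\<Sum>l = 1..m. (?c l)\<^sup>2 / (1 - (?c l)\<^sup>2) * (z (l - 1))\<^sup>2) =
      (\<Sum>l\<le>m. (if l < m then (?c (l + 1))\<^sup>2 / (1 - (?c (l + 1))\<^sup>2) else 0) * (z l)\<^sup>2)"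
  proof -
    have "{..m} = insert m {..<m}" by auto
    thus ?thesis by (simp add: sum.atLeast1_atMost_eq)
  qed
  finally show ?thesis
    unfolding confinement_def by (simp only: distrib_right sum.distrib)
qed

text \<open>
  With the indicator included in the one-particle weight, the integral over the product set
  becomes an integral over the whole space.
\<close>

definition level_factor :: "(nat \<Rightarrow> nat) \<Rightarrow> (nat \<Rightarrow> nat \<Rightarrow> ereal) \<Rightarrow> nat \<Rightarrow> (nat \<Rightarrow> real) \<Rightarrow> nat \<Rightarrow> real \<Rightarrow> real" where
  "level_factor r a m t l y = indicator (interval_union r a l) y * exp (- confinement m t l * y\<^sup>2)"

lemma chain_kernel_energy:
  "chain_kernel m (coupling t) (level_factor r a m t) z =
     (\<Prod>l\<le>m. indicator (interval_union r a l) (z l)) * exp (- energy m t z)"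
  unfolding chain_kernel_def level_factor_def prod.distrib energy_expansion
  by (simp add: exp_sum[symmetric] exp_add[symmetric] exp_diff[symmetric] sum_negf mult.left_commute[of "exp _"]
      flip: exp_add)

lemma moment_eq_chain_integral:
  "moment m r i j t a = (\<integral>z. z 0 ^ i * z m ^ j * chain_kernel m (coupling t) (level_factor r a m t) z \<partial>lborel_on {..m})"
  unfolding moment_def box_integral_def chain_kernel_energy moment_integrand_def by (simp add: mult_ac)

lemma andreief_moments:
  assumes "admissible m r t a"
  shows "integrable (config_measure n m) (partial_weight n m (coupling t) (level_factor r a m t) 0)"
    and "integral\<^sup>L (config_measure n m) (partial_weight n m (coupling t) (level_factor r a m t) 0) =
           fact n ^ Suc m * fdet n (\<lambda>i j. moment m r i j t a)"
proof -
  have int: "integrable (lborel_on {..m}) (\<lambda>z. z 0 ^ i * z m ^ j * chain_kernel m (coupling t) (level_factor r a m t) z)" for i j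
    using box_integrable[OF gaussian_bounded_moment_integrand[OF admissible_increasing[OF assms], of i j], of r a]
    unfolding chain_kernel_energy moment_integrand_def by (simp add: mult_ac)
  from andreief_chain[OF int, of n]
  show "integrable (config_measure n m) (partial_weight n m (coupling t) (level_factor r a m t) 0)"
    "integral\<^sup>L (config_measure n m) (partial_weight n m (coupling t) (level_factor r a m t) 0) =
           fact n ^ Suc m * fdet n (\<lambda>i j. moment m r i j t a)"
    unfolding moment_eq_chain_integral by auto
qed

lemma dyson_weight_eq_partial_weight:
  assumes "m \<ge> 1" "increasing_times m t"
  shows "(\<Prod>l\<le>m. \<Prod>k<n. indicator (interval_union r a l) (x (l, k))) * dyson_weight n m t x =
         partial_weight n m (coupling t) (level_factor r a m t) 0 x"
proof -
  let ?c = "dyson_c t"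
  have split: "prod f {..m} = f 0 * (f m * prod f {1..<m})" for f :: "nat \<Rightarrow> real"
  proof -
    have "{..m} = insert 0 (insert m {1..<m})" using assms(1) by auto
    thus ?thesis using assms(1) by simp
  qed
  have "(\<Prod>l\<le>m. \<Prod>k<n. exp (- confinement m t l * (x (l, k))\<^sup>2)) =
        (\<Prod>l\<le>m. exp (- confinement m t l * sum_squares n (\<lambda>k. x (l, k))))"
    by (simp add: sum_squares_def exp_sum[symmetric] sum_distrib_left sum_negf)
  also have "\<dots> = exp (- confinement m t 0 * sum_squares n (\<lambda>k. x (0, k)))
      * (exp (- confinement m t m * sum_squares n (\<lambda>k. x (m, k)))
      * (\<Prod>l = 1..<m. exp (- confinement m t l * sum_squares n (\<lambda>k. x (l, k)))))"
    by (rule split)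
  also have "confinement m t m = 1 / (1 - (?c m)\<^sup>2)" using assms(1) by (simp add: confinement_def)
  \<comment> \<open>The stationary density at time 0 adds 1 to the coefficient \<open>c\<^sup>2 / (1 - c\<^sup>2)\<close> of the first step.\<close>
  also have "confinement m t 0 = 1 / (1 - (?c 1)\<^sup>2)"
  proof -
    have "1 \<in> {1..m}" using assms(1) by simp
    hence "t (1 - 1) < t 1" using assms(2) unfolding increasing_times_def by blast
    hence "t 1 - t (1 - 1) > 0" by simp
    from one_minus_exp_pos[OF this] have "1 - (?c 1)\<^sup>2 \<noteq> 0" by (simp add: dyson_c_def)
    thus ?thesis using assms(1) by (simp add: confinement_def field_simps)
  qed
  also have "(\<Prod>l = 1..<m. exp (- confinement m t l * sum_squares n (\<lambda>k. x (l, k)))) =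
     (\<Prod>l = 1..<m. exp (- (1 / (1 - (?c l)\<^sup>2) + (?c (l + 1))\<^sup>2 / (1 - (?c (l + 1))\<^sup>2)) * sum_squares n (\<lambda>k. x (l, k))))"
    by (rule prod.cong[OF refl]) (simp add: confinement_def)
  finally have gauss: "(\<Prod>l\<le>m. \<Prod>k<n. exp (- confinement m t l * (x (l, k))\<^sup>2)) =
      exp (- (1 / (1 - (?c 1)\<^sup>2)) * sum_squares n (\<lambda>k. x (0, k)))
      * (exp (- (1 / (1 - (?c m)\<^sup>2)) * sum_squares n (\<lambda>k. x (m, k)))
      * (\<Prod>l = 1..<m. exp (- (1 / (1 - (?c l)\<^sup>2) + (?c (l + 1))\<^sup>2 / (1 - (?c (l + 1))\<^sup>2)) * sum_squares n (\<lambda>k. x (l, k)))))" .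
  show ?thesis
    unfolding partial_weight_def level_factor_def prod.distrib gauss dyson_weight_def Let_def fdet_def coupling_def
    by (simp add: mult_ac)
qed

lemma partial_weight_pos:
  assumes "m \<ge> 1" "\<And>l. l \<in> {1..m} \<Longrightarrow> b l > 0"
    and "\<And>l. l \<le> m \<Longrightarrow> inj_on (\<lambda>k. x (l, k)) {..<n}" "\<And>l k. l \<le> m \<Longrightarrow> k < n \<Longrightarrow> g l (x (l, k)) > 0"
  shows "partial_weight n m b g 0 x > 0"
proof -
  have "vandermonde n (\<lambda>k. x (0, k)) * vandermonde n (\<lambda>k. x (m, k)) *
         (\<Prod>l = 1..m. fdet n (\<lambda>i j. exp (b l * x (l - 1, i) * x (l, j)))) > 0"
    using chain_of_determinants_pos[of m "\<lambda>l k. x (l, k)" n b] assms by simp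
  moreover have "(\<Prod>l\<le>m. \<Prod>k<n. g l (x (l, k))) > 0"
    using assms by (intro prod_pos) auto
  ultimately show ?thesis unfolding partial_weight_def by simp
qed

text \<open>
  If two particles coincide at some level, a determinant involving this level vanishes.
  Otherwise \<open>chain_of_determinants_pos\<close> applies.
\<close>

lemma partial_weight_nonneg:
  assumes "m \<ge> 1" "\<And>l. l \<in> {1..m} \<Longrightarrow> b l > 0" "\<And>l y. g l y \<ge> 0"
  shows "partial_weight n m b g 0 x \<ge> 0"
proof (cases "\<forall>l\<le>m. inj_on (\<lambda>k. x (l, k)) {..<n}")
  case True
  have "vandermonde n (\<lambda>k. x (0, k)) * vandermonde n (\<lambda>k. x (m, k)) *
         (\<Prod>l = 1..m. fdet n (\<lambda>i j. exp (b l * x (l - 1, i) * x (l, j)))) > 0"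
    using chain_of_determinants_pos[of m "\<lambda>l k. x (l, k)" n b] assms True by simp
  moreover have "(\<Prod>l\<le>m. \<Prod>k<n. g l (x (l, k))) \<ge> 0"
    using assms by (intro prod_nonneg) auto
  ultimately show ?thesis unfolding partial_weight_def by simp
next
  case False
  then obtain l i j where l: "l \<le> m" "i < n" "j < n" "i \<noteq> j" "x (l, i) = x (l, j)"
    by (auto simp: inj_on_def)
  show ?thesis
  proof (cases "l = 0")
    case True
    have "fdet n (\<lambda>i j. x (0, i) ^ j) = 0"
      by (rule fdet_identical_rows[OF l(2,3,4)]) (use l True in auto)
    thus ?thesis unfolding partial_weight_def vandermonde_eq_fdet by simp
  next
    case False
    have "fdet n (\<lambda>i j. exp (b l * x (l - 1, i) * x (l, j))) = 0"
      by (rule fdet_identical_cols[OF l(2,3,4)]) (use l in auto)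
    hence "(\<Prod>l = 0 + 1..m. fdet n (\<lambda>i j. exp (b l * x (l - 1, i) * x (l, j)))) = 0"
      using l False by (intro prod_zero bexI[of _ l]) auto
    thus ?thesis
      unfolding partial_weight_def by (simp only: mult_zero_left mult_zero_right order.refl)
  qed
qed

text \<open>
  By Andreief's identity a positive multiple of the determinant is the integral of a
  nonnegative weight. This weight is positive whenever the particles at each level are distinct
  and lie in the prescribed set, for instance when they occupy successive cells of an interval.
\<close>

lemma fdet_moment_pos:
  assumes adm: "admissible m r t a" and m: "m \<ge> 1"
  shows "fdet n (\<lambda>i j. moment m r i j t a) > 0"
proof -
  interpret product_sigma_finite "\<lambda>_. lborel :: real measure" by (rule product_sigma_finite_lborel)
  let ?W = "partial_weight n m (coupling t) (level_factor r a m t) 0"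
  let ?I = "{..m} \<times> {..<n}"
  have b: "coupling t l > 0" if "l \<in> {1..m}" for l
  proof -
    have "t l - t (l - 1) > 0" using admissible_increasing[OF adm] that by (auto simp: increasing_times_def)
    from one_minus_exp_pos[OF this] show ?thesis by (simp add: coupling_def dyson_c_def)
  qed
  have nonneg: "?W x \<ge> 0" for x
    by (rule partial_weight_nonneg[OF m b]) (auto simp: level_factor_def)
  have "\<exists>s e. e > 0 \<and> {s<..<s + e} \<subseteq> interval_union r a l" if l: "l \<le> m" for l
  proof -
    have "r l \<ge> 1" "a l 1 < a l 2"
      using adm l unfolding admissible_def by (auto simp: numeral_2_eq_2)
    then obtain s where s: "s \<in> einterval (a l 1) (a l 2)"
      using einterval_nonempty by blast
    then obtain e where e: "e > 0" "ball s e \<subseteq> einterval (a l 1) (a l 2)"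
      using open_einterval openE by blast
    have "{s<..<s + e} \<subseteq> ball s e" by (auto simp: dist_real_def)
    moreover have "einterval (a l 1) (a l 2) \<subseteq> interval_union r a l"
      using \<open>r l \<ge> 1\<close> unfolding interval_union_def by (intro UN_upper[of 1, THEN order_trans[rotated]]) auto
    ultimately show ?thesis using e by blast
  qed
  then obtain s e where se: "\<And>l. l \<le> m \<Longrightarrow> e l > 0" "\<And>l. l \<le> m \<Longrightarrow> {s l<..<s l + e l} \<subseteq> interval_union r a l"
    by metis
  \<comment> \<open>The interval at level \<open>l\<close> is divided into \<open>n\<close> cells, one for each particle.\<close>
  define cell where "cell = (\<lambda>(l, k). {s l + e l * (real k / real n)<..<s l + e l * (real (Suc k) / real n)})"
  have pos: "?W x > 0" if x: "x \<in> Pi\<^sub>E ?I cell" for x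
  proof (rule partial_weight_pos[OF m b])
    have mem: "x (l, k) \<in> cell (l, k)" if "l \<le> m" "k < n" for l k
      using x that by (auto simp: PiE_iff)
    show "inj_on (\<lambda>k. x (l, k)) {..<n}" if l: "l \<le> m" for l
    proof (rule linorder_inj_onI)
      fix i j assume ij: "i < j" "i \<in> {..<n}" "j \<in> {..<n}"
      have "e l * (real (Suc i) / real n) \<le> e l * (real j / real n)"
        using ij se(1)[OF l] by (intro mult_left_mono divide_right_mono) auto
      thus "x (l, i) \<noteq> x (l, j)" using mem[OF l, of i] mem[OF l, of j] ij by (auto simp: cell_def)
    qed auto
    show "level_factor r a m t l (x (l, k)) > 0" if l: "l \<le> m" and k: "k < n" for l k
    proof -
      have "e l * (real (Suc k) / real n) \<le> e l * 1" "e l * (real k / real n) \<ge> 0"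
        using k se(1)[OF l] by (auto intro!: mult_left_mono simp: divide_le_eq)
      hence "x (l, k) \<in> {s l<..<s l + e l}" using mem[OF l k] by (auto simp: cell_def)
      hence "x (l, k) \<in> interval_union r a l" using se(2)[OF l] by blast
      thus ?thesis by (simp add: level_factor_def)
    qed
  qed
  have cell: "cell p \<in> sets borel" for p by (cases p) (simp add: cell_def)
  have B: "Pi\<^sub>E ?I cell \<in> sets (lborel_on ?I)"
    by (intro sets_PiM_I_finite) (auto simp: cell)
  have "emeasure (lborel_on ?I) (Pi\<^sub>E ?I cell) = (\<Prod>p\<in>?I. emeasure lborel (cell p))"
    by (rule emeasure_PiM) (auto simp: cell)
  also have "\<dots> \<noteq> 0"
  proof -
    have "emeasure lborel (cell p) \<noteq> 0" if "p \<in> ?I" for p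
    proof -
      obtain l k where p: "p = (l, k)" "l \<le> m" "k < n" using \<open>p \<in> ?I\<close> by auto
      have "e l * (real k / real n) < e l * (real (Suc k) / real n)"
        using p se(1)[of l] by (intro mult_strict_left_mono divide_strict_right_mono) auto
      thus ?thesis using p se(1)[of l] by (simp add: cell_def)
    qed
    thus ?thesis by (simp add: prod_zero_iff)
  qed
  finally have not_null: "Pi\<^sub>E ?I cell \<notin> null_sets (lborel_on ?I)" by auto
  note A = andreief_moments[OF adm, of n, unfolded config_measure_def]
  have "integral\<^sup>L (lborel_on ?I) ?W \<noteq> 0"
  proof
    assume "integral\<^sup>L (lborel_on ?I) ?W = 0"
    hence "AE x in lborel_on ?I. ?W x = 0"
      using integral_nonneg_eq_0_iff_AE[OF A(1)] nonneg by auto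
    hence "AE x in lborel_on ?I. x \<notin> Pi\<^sub>E ?I cell"
    proof eventually_elim
      case (elim x)
      thus ?case using pos[of x] by auto
    qed
    hence "Pi\<^sub>E ?I cell \<in> null_sets (lborel_on ?I)" using AE_iff_null_sets[OF B] by blast
    with not_null show False by contradiction
  qed
  moreover have "integral\<^sup>L (lborel_on ?I) ?W \<ge> 0" by (intro integral_nonneg_AE AE_I2 nonneg)
  ultimately have "fact n ^ Suc m * fdet n (\<lambda>i j. moment m r i j t a) > 0" unfolding A(2) by linarith
  thus ?thesis by (rule zero_less_mult_pos) simp
qed

text \<open>
  A single interval without finite endpoints, which makes the normalising constant a case of the
  integrals over interval unions.
\<close>

definition whole_line :: "nat \<Rightarrow> nat \<Rightarrow> ereal" where
  "whole_line l i = (if i \<le> 1 then -\<infinity> else \<infinity>)"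

lemma interval_union_whole_line: "interval_union (\<lambda>_. 1) whole_line l = UNIV"
  by (simp add: interval_union_def whole_line_def einterval_def)

lemma dyson_const_eq:
  assumes "admissible m r t a" "m \<ge> 1"
  shows "dyson_const n m t = fact n ^ Suc m * fdet n (\<lambda>i j. moment m (\<lambda>_. 1) i j t whole_line)"
    and "dyson_const n m t > 0"
proof -
  have adm: "admissible m (\<lambda>_. 1) t whole_line"
    using assms(1) by (auto simp: admissible_def whole_line_def)
  have "dyson_weight n m t x = partial_weight n m (coupling t) (level_factor (\<lambda>_. 1) whole_line m t) 0 x" for x
    using dyson_weight_eq_partial_weight[OF assms(2) admissible_increasing[OF adm], where n = n and r = "\<lambda>_. 1" and a = whole_line and x = x]
    unfolding interval_union_whole_line by simp
  hence "dyson_const n m t = integral\<^sup>L (config_measure n m)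
     (partial_weight n m (coupling t) (level_factor (\<lambda>_. 1) whole_line m t) 0)"
    by (simp add: dyson_const_def)
  also have "\<dots> = fact n ^ Suc m * fdet n (\<lambda>i j. moment m (\<lambda>_. 1) i j t whole_line)"
    by (rule andreief_moments[OF adm])
  finally show 1: "dyson_const n m t = \<dots>" .
  show "dyson_const n m t > 0" unfolding 1 using fdet_moment_pos[OF adm assms(2)] by simp
qed

text \<open>
  All dependence on the endpoints is in the determinant, since the normalising constant is a
  function of the times.
\<close>

lemma dyson_prob_eq:
  assumes adm: "admissible m r t a" and m: "m \<ge> 1"
  shows "dyson_prob n m r t a = fact n ^ Suc m / dyson_const n m t * fdet n (\<lambda>i j. moment m r i j t a)"
proof -
  let ?I = "{..m} \<times> {..<n}"
  let ?B = "\<Pi>\<^sub>E p\<in>?I. interval_union r a (fst p)"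
  have "indicator ?B x *\<^sub>R dyson_density n m t x =
     1 / dyson_const n m t * partial_weight n m (coupling t) (level_factor r a m t) 0 x"
    if x: "x \<in> space (config_measure n m)" for x
  proof -
    have B: "x \<in> ?B \<longleftrightarrow> (\<forall>p\<in>?I. x p \<in> interval_union r a (fst p))"
      using x unfolding config_measure_def space_PiM PiE_iff by blast
    have "(indicator ?B x :: real) = (\<Prod>p\<in>?I. indicator (interval_union r a (fst p)) (x p))"
    proof (cases "x \<in> ?B")
      case True
      hence "(\<Prod>p\<in>?I. indicator (interval_union r a (fst p)) (x p) :: real) = 1"
        using B by (intro prod.neutral) simp
      thus ?thesis using True by simp
    next
      case False
      then obtain p where "p \<in> ?I" "x p \<notin> interval_union r a (fst p)" using B by blast
      hence "(\<Prod>p\<in>?I. indicator (interval_union r a (fst p)) (x p) :: real) = 0"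
        by (intro prod_zero bexI[of _ p]) auto
      thus ?thesis using False by simp
    qed
    also have "\<dots> = (\<Prod>l\<le>m. \<Prod>k<n. indicator (interval_union r a l) (x (l, k)))"
      by (simp add: prod.cartesian_product case_prod_beta)
    finally show ?thesis
      using dyson_weight_eq_partial_weight[OF m admissible_increasing[OF adm], where n = n and r = r and a = a and x = x]
      by (simp add: dyson_density_def)
  qed
  hence "dyson_prob n m r t a = (\<integral>x. 1 / dyson_const n m t *
      partial_weight n m (coupling t) (level_factor r a m t) 0 x \<partial>config_measure n m)"
    unfolding dyson_prob_def set_lebesgue_integral_def by (intro Bochner_Integration.integral_cong refl)
  also have "\<dots> = 1 / dyson_const n m t * (fact n ^ Suc m * fdet n (\<lambda>i j. moment m r i j t a))"
    unfolding andreief_moments(2)[OF adm, symmetric] by (rule integral_mult_right_zero)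
  finally show ?thesis by simp
qed

theorem theorem1:
  fixes n m :: nat
    and r :: "nat \<Rightarrow> nat"
    and t :: "nat \<Rightarrow> real"
    and a :: "nat \<Rightarrow> nat \<Rightarrow> ereal"
  defines "logP \<equiv> (\<lambda>t a. ln (dyson_prob n m r t a))"
  assumes "n \<ge> 1" and "m \<ge> 1"
    and "t 0 = 0" and "\<And>l. l < m \<Longrightarrow> t l < t (l + 1)"
    and "\<And>l. l \<le> m \<Longrightarrow> r l \<ge> 1"
    and "\<And>l i. l \<le> m \<Longrightarrow> 1 \<le> i \<Longrightarrow> i < 2 * r l \<Longrightarrow> a l i < a l (i + 1)"
  shows "A1 m r (\<lambda>t a. B2 m r (A1 m r logP) t a
                     / (B1 m r (A1 m r logP) t a + 2 * real n * exp (- t m))) t a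
       = B1 m r (\<lambda>t a. A2 m r (B1 m r logP) t a
                     / (A1 m r (B1 m r logP) t a + 2 * real n * exp (- t m))) t a"
proof -
  interpret moment_array m r "moment m r" "\<lambda>t. \<Sum>l\<le>m. exp (- 2 * t l)" "\<lambda>t. \<Sum>l\<le>m. exp (2 * (t l - t m))"
    by unfold_locales
       (simp_all only: A1_moment_formula B1_moment_formula A2_moment_formula B2_moment_formula fdet_moment_pos \<open>m \<ge> 1\<close>)
  show ?thesis
  proof (rule nonlinear_pde)
    show "admissible m r t a" using assms by (simp add: admissible_def)
    fix t :: "nat \<Rightarrow> real" and a :: "nat \<Rightarrow> nat \<Rightarrow> ereal"
    assume adm: "admissible m r t a"
    have "fact n ^ Suc m / dyson_const n m t > 0"
      using dyson_const_eq(2)[OF adm \<open>m \<ge> 1\<close>, of n] by simp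
    moreover have "tau n t a > 0" by (rule tau_gt_0[OF adm])
    ultimately show "logP t a = ln (fact n ^ Suc m / dyson_const n m t) + ln (tau n t a)"
      unfolding logP_def dyson_prob_eq[OF adm \<open>m \<ge> 1\<close>] tau_def by (rule ln_mult_pos)
  qed (rule \<open>n \<ge> 1\<close>)
qed

end
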